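(* Let $a,b,c$ be pairwise relatively prime positive integers with $\frac1a+\frac1b+\frac1c<1$, let $m,n\ge 2$ be integers, let $R=\mathbb{C}[X,Y,Z]/(X^a+Y^b+Z^c)$ with $x,y,z$ the images of $X,Y,Z$, and let $A_{n,m}=R[U,V]/(x^mU-y^nV-1)$ with $u,v$ the images of $U,V$. Then the group $\mathrm{Aut}_{\mathbb{C}}A_{n,m}$ is generated by the $\mathbb{C}$-algebra automorphisms given on generators by (1) $(x,y,z,u,v)\mapsto (x,y,z,\,f(x,y,z)y^n+u,\,f(x,y,z)x^m+v)$ for $f\in R$, and (2) $(x,y,z,u,v)\mapsto(\mu^{bc}x,\mu^{ac}y,\mu^{ab}z,\mu^{-mbc}u,\mu^{-nac}v)$ for $\mu\in\mathbb{C}^*$. Thus $\mathrm{Aut}_{\mathbb{C}}A_{n,m}\cong\mathbb{C}^*\ltimes\langle R,+\rangle$.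
   Context: $\mathrm{Aut}_{\mathbb{C}}A_{n,m}$ is the group of $\mathbb{C}$-algebra automorphisms of $A_{n,m}$. $\langle R,+\rangle$ is the additive group of $R$; in the semidirect product it is the normal factor, corresponding to the automorphisms of type (1), and $\mathbb{C}^*$ corresponds to the automorphisms of type (2). *)

theory Defs
  imports Complex_Main "HOL-Algebra.Algebra" "HOL-Algebra.Algebraic_Closure_Type"
begin

section \<open>Polynomial rings\<close>

abbreviation complex_ring :: "complex ring"
  where "complex_ring \<equiv> ring_of_type_algebra"

definition up_const :: "('a, 'm) ring_scheme \<Rightarrow> 'a \<Rightarrow> nat \<Rightarrow> 'a"
  where "up_const S s = up_ring.monom (UP S) s 0"

definition up_var :: "('a, 'm) ring_scheme \<Rightarrow> nat \<Rightarrow> 'a"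
  where "up_var S = up_ring.monom (UP S) \<one>\<^bsub>S\<^esub> 1"

text \<open>
  Polynomial rings in several variables are iterated: \<open>\<complex>[X,Y,Z] = \<complex>[X][Y][Z]\<close> and
  \<open>S[U,V] = S[U][V]\<close>, with \<open>X\<close> and \<open>U\<close> the innermost variables.
\<close>

type_synonym cxyz = "nat \<Rightarrow> nat \<Rightarrow> nat \<Rightarrow> complex"

definition CXYZ :: "(nat \<Rightarrow> nat \<Rightarrow> complex, cxyz) up_ring"
  where "CXYZ = UP (UP (UP complex_ring))"

definition CXYZ_const :: "complex \<Rightarrow> cxyz"
  where "CXYZ_const k =
    up_const (UP (UP complex_ring)) (up_const (UP complex_ring) (up_const complex_ring k))"

definition CXYZ_X :: cxyz
  where "CXYZ_X = up_const (UP (UP complex_ring)) (up_const (UP complex_ring) (up_var complex_ring))"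

definition CXYZ_Y :: cxyz
  where "CXYZ_Y = up_const (UP (UP complex_ring)) (up_var (UP complex_ring))"

definition CXYZ_Z :: cxyz
  where "CXYZ_Z = up_var (UP (UP complex_ring))"

definition poly_UV :: "('a, 'm) ring_scheme \<Rightarrow> (nat \<Rightarrow> 'a, nat \<Rightarrow> nat \<Rightarrow> 'a) up_ring"
  where "poly_UV S = UP (UP S)"

definition UV_const :: "('a, 'm) ring_scheme \<Rightarrow> 'a \<Rightarrow> nat \<Rightarrow> nat \<Rightarrow> 'a"
  where "UV_const S s = up_const (UP S) (up_const S s)"

definition UV_U :: "('a, 'm) ring_scheme \<Rightarrow> nat \<Rightarrow> nat \<Rightarrow> 'a"
  where "UV_U S = up_const (UP S) (up_var S)"

definition UV_V :: "('a, 'm) ring_scheme \<Rightarrow> nat \<Rightarrow> nat \<Rightarrow> 'a"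
  where "UV_V S = up_var (UP S)"


section \<open>The ring \<open>R = \<complex>[X,Y,Z]/(X\<^sup>a + Y\<^sup>b + Z\<^sup>c)\<close>\<close>

definition R_ideal :: "nat \<Rightarrow> nat \<Rightarrow> nat \<Rightarrow> cxyz set"
  where "R_ideal a b c =
    PIdl\<^bsub>CXYZ\<^esub> (CXYZ_X [^]\<^bsub>CXYZ\<^esub> a \<oplus>\<^bsub>CXYZ\<^esub> CXYZ_Y [^]\<^bsub>CXYZ\<^esub> b \<oplus>\<^bsub>CXYZ\<^esub> CXYZ_Z [^]\<^bsub>CXYZ\<^esub> c)"

definition R_ring :: "nat \<Rightarrow> nat \<Rightarrow> nat \<Rightarrow> cxyz set ring"
  where "R_ring a b c = CXYZ Quot (R_ideal a b c)"

definition R_class :: "nat \<Rightarrow> nat \<Rightarrow> nat \<Rightarrow> cxyz \<Rightarrow> cxyz set"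
  where "R_class a b c p = R_ideal a b c +>\<^bsub>CXYZ\<^esub> p"


section \<open>The algebra \<open>A = R[U,V]/(x\<^sup>mU - y\<^sup>nV - 1)\<close>\<close>

type_synonym r_uv = "nat \<Rightarrow> nat \<Rightarrow> cxyz set"

definition A_ideal :: "nat \<Rightarrow> nat \<Rightarrow> nat \<Rightarrow> nat \<Rightarrow> nat \<Rightarrow> r_uv set"
  where "A_ideal a b c n m =
    (let R = R_ring a b c; P = poly_UV R;
         x = UV_const R (R_class a b c CXYZ_X);
         y = UV_const R (R_class a b c CXYZ_Y)
     in PIdl\<^bsub>P\<^esub> (x [^]\<^bsub>P\<^esub> m \<otimes>\<^bsub>P\<^esub> UV_U R \<ominus>\<^bsub>P\<^esub> y [^]\<^bsub>P\<^esub> n \<otimes>\<^bsub>P\<^esub> UV_V R \<ominus>\<^bsub>P\<^esub> \<one>\<^bsub>P\<^esub>))"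

definition A_ring :: "nat \<Rightarrow> nat \<Rightarrow> nat \<Rightarrow> nat \<Rightarrow> nat \<Rightarrow> r_uv set ring"
  where "A_ring a b c n m = poly_UV (R_ring a b c) Quot (A_ideal a b c n m)"

definition A_class :: "nat \<Rightarrow> nat \<Rightarrow> nat \<Rightarrow> nat \<Rightarrow> nat \<Rightarrow> r_uv \<Rightarrow> r_uv set"
  where "A_class a b c n m p = A_ideal a b c n m +>\<^bsub>poly_UV (R_ring a b c)\<^esub> p"

definition R_to_A :: "nat \<Rightarrow> nat \<Rightarrow> nat \<Rightarrow> nat \<Rightarrow> nat \<Rightarrow> cxyz set \<Rightarrow> r_uv set"
  where "R_to_A a b c n m f = A_class a b c n m (UV_const (R_ring a b c) f)"

definition C_to_A :: "nat \<Rightarrow> nat \<Rightarrow> nat \<Rightarrow> nat \<Rightarrow> nat \<Rightarrow> complex \<Rightarrow> r_uv set"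
  where "C_to_A a b c n m k = R_to_A a b c n m (R_class a b c (CXYZ_const k))"

definition A_x :: "nat \<Rightarrow> nat \<Rightarrow> nat \<Rightarrow> nat \<Rightarrow> nat \<Rightarrow> r_uv set"
  where "A_x a b c n m = R_to_A a b c n m (R_class a b c CXYZ_X)"

definition A_y :: "nat \<Rightarrow> nat \<Rightarrow> nat \<Rightarrow> nat \<Rightarrow> nat \<Rightarrow> r_uv set"
  where "A_y a b c n m = R_to_A a b c n m (R_class a b c CXYZ_Y)"

definition A_z :: "nat \<Rightarrow> nat \<Rightarrow> nat \<Rightarrow> nat \<Rightarrow> nat \<Rightarrow> r_uv set"
  where "A_z a b c n m = R_to_A a b c n m (R_class a b c CXYZ_Z)"

definition A_u :: "nat \<Rightarrow> nat \<Rightarrow> nat \<Rightarrow> nat \<Rightarrow> nat \<Rightarrow> r_uv set"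
  where "A_u a b c n m = A_class a b c n m (UV_U (R_ring a b c))"

definition A_v :: "nat \<Rightarrow> nat \<Rightarrow> nat \<Rightarrow> nat \<Rightarrow> nat \<Rightarrow> r_uv set"
  where "A_v a b c n m = A_class a b c n m (UV_V (R_ring a b c))"


section \<open>Automorphism groups and semidirect products\<close>

text \<open>
  \<open>\<iota>\<close> is the structure map of the \<open>K\<close>-algebra \<open>S\<close>.  As in \<open>AutoGroup\<close>, automorphisms are
  extensional functions on the carrier, and the product \<open>g \<otimes> f\<close> is \<open>g\<close> after \<open>f\<close>.
\<close>

definition alg_auts :: "('k, 'm) ring_scheme \<Rightarrow> ('k \<Rightarrow> 'a) \<Rightarrow> ('a, 'n) ring_scheme \<Rightarrow> ('a \<Rightarrow> 'a) set"
  where "alg_auts K \<iota> S =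
    {\<phi> \<in> ring_hom S S \<inter> Bij (carrier S). \<forall>k\<in>carrier K. \<phi> (\<iota> k) = \<iota> k}"

definition alg_aut_group ::
    "('k, 'm) ring_scheme \<Rightarrow> ('k \<Rightarrow> 'a) \<Rightarrow> ('a, 'n) ring_scheme \<Rightarrow> ('a \<Rightarrow> 'a) monoid"
  where "alg_aut_group K \<iota> S = BijGroup (carrier S) \<lparr>carrier := alg_auts K \<iota> S\<rparr>"

definition semidirect_prod ::
    "('h, 'm) monoid_scheme \<Rightarrow> ('g, 'n) monoid_scheme \<Rightarrow> ('h \<Rightarrow> 'g \<Rightarrow> 'g) \<Rightarrow> ('h \<times> 'g) monoid"
  where "semidirect_prod H N \<theta> =
    \<lparr>carrier = carrier H \<times> carrier N,
     Group.monoid.mult = (\<lambda>(h, g) (h', g'). (h \<otimes>\<^bsub>H\<^esub> h', g \<otimes>\<^bsub>N\<^esub> \<theta> h g')),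
     one = (\<one>\<^bsub>H\<^esub>, \<one>\<^bsub>N\<^esub>)\<rparr>"

definition Aut_A :: "nat \<Rightarrow> nat \<Rightarrow> nat \<Rightarrow> nat \<Rightarrow> nat \<Rightarrow> (r_uv set \<Rightarrow> r_uv set) monoid"
  where "Aut_A a b c n m = alg_aut_group complex_ring (C_to_A a b c n m) (A_ring a b c n m)"

definition is_type1 ::
    "nat \<Rightarrow> nat \<Rightarrow> nat \<Rightarrow> nat \<Rightarrow> nat \<Rightarrow> cxyz set \<Rightarrow> (r_uv set \<Rightarrow> r_uv set) \<Rightarrow> bool"
  where "is_type1 a b c n m f \<phi> \<longleftrightarrow>
    (let A = A_ring a b c n m; x = A_x a b c n m; y = A_y a b c n m; z = A_z a b c n m;
         u = A_u a b c n m; v = A_v a b c n m; f' = R_to_A a b c n m f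
     in \<phi> \<in> carrier (Aut_A a b c n m) \<and>
        \<phi> x = x \<and> \<phi> y = y \<and> \<phi> z = z \<and>
        \<phi> u = f' \<otimes>\<^bsub>A\<^esub> y [^]\<^bsub>A\<^esub> n \<oplus>\<^bsub>A\<^esub> u \<and>
        \<phi> v = f' \<otimes>\<^bsub>A\<^esub> x [^]\<^bsub>A\<^esub> m \<oplus>\<^bsub>A\<^esub> v)"

definition is_type2 ::
    "nat \<Rightarrow> nat \<Rightarrow> nat \<Rightarrow> nat \<Rightarrow> nat \<Rightarrow> complex \<Rightarrow> (r_uv set \<Rightarrow> r_uv set) \<Rightarrow> bool"
  where "is_type2 a b c n m \<mu> \<phi> \<longleftrightarrow>
    (let A = A_ring a b c n m; x = A_x a b c n m; y = A_y a b c n m; z = A_z a b c n m;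
         u = A_u a b c n m; v = A_v a b c n m; C = C_to_A a b c n m
     in \<phi> \<in> carrier (Aut_A a b c n m) \<and>
        \<phi> x = C (\<mu> ^ (b * c)) \<otimes>\<^bsub>A\<^esub> x \<and>
        \<phi> y = C (\<mu> ^ (a * c)) \<otimes>\<^bsub>A\<^esub> y \<and>
        \<phi> z = C (\<mu> ^ (a * b)) \<otimes>\<^bsub>A\<^esub> z \<and>
        \<phi> u = C (\<mu> powi (- int (m * b * c))) \<otimes>\<^bsub>A\<^esub> u \<and>
        \<phi> v = C (\<mu> powi (- int (n * a * c))) \<otimes>\<^bsub>A\<^esub> v)"

end

theory Submission
  imports Defs "HOL-Number_Theory.Cong"
begin

text \<open>
  Both rings are realised inside polynomial rings over fields of characteristic zero. With weights
  \<open>bc, ac, ab\<close> for \<open>x, y, z\<close>, the ring \<open>R\<close> embeds into \<open>\<complex>((r))[w]\<close> by \<open>x = r w\<^bsup>bc\<^esup>\<close>, \<open>y = w\<^bsup>ac\<^esup>\<close>,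
  \<open>z = \<zeta> w\<^bsup>ab\<^esup>\<close> with \<open>\<zeta>\<^sup>c = -(1 + r\<^sup>a)\<close>, and \<open>A\<close> embeds into \<open>\<complex>((r))((w))[v]\<close> by
  \<open>u = (1 + y\<^sup>n v) / x\<^sup>m\<close>.

  Let \<open>s\<close> be an automorphism of \<open>A\<close>. The images of \<open>x, y, z\<close> satisfy the Fermat-type equation, and those
  of \<open>x, y\<close> are comaximal, so Mason--Stothers in \<open>v\<close> makes them constant in \<open>v\<close>; the elements of \<open>A\<close>
  constant in \<open>v\<close> are those of \<open>R\<close>, since \<open>x, y\<close> is a regular sequence. Thus \<open>s\<close> restricts to \<open>R\<close>.
  Mason--Stothers in \<open>w\<close>, in a form that allows common factors \<open>w\<^sup>N\<close>, shows that the restriction is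
  homogeneous, hence a scaling by some \<open>\<mu>\<close>. After composing with the inverse of the scaling, \<open>s\<close> fixes
  \<open>R\<close> and is of the form \<open>u \<mapsto> u + f y\<^sup>n\<close>, \<open>v \<mapsto> v + f x\<^sup>m\<close> with \<open>f \<in> A\<close>; a degree argument in \<open>v\<close>
  puts \<open>f\<close> into \<open>R\<close>.
\<close>

text \<open>Both uses of Mason--Stothers need a Bezout identity, of different strength. In
  \<open>A\<close> the relation x^m u - y^n v = 1 survives every automorphism, so the images of x
  and y generate the unit ideal. In \<open>R\<close> all of x, y, z vanish at w = 0, and for an
  automorphism of \<open>R\<close> one only finds some w^N in the ideal of the images. Hence the
  Wronskian is formed with w d/dw, for which powers of w split off as factors. This derivation does
  not lower degrees, so the customary -1 in the degree inequality is lost; the strict bound on 1/a +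
  1/b + 1/c makes up for it. Coprimality acts through the weights bc, ac, ab. The weight of a
  monomial fixes its z-exponent modulo c, which makes the parametrisation injective whatever
  relations the powers of \<open>\<zeta>\<close> satisfy. The weights have gcd 1, which rules out
  images of larger weight and produces one common \<mu>. The last step, that the shear parameter
  lies in \<open>R\<close>, rests on a contrast with the first: x^m p - y^n q = 1 is unsolvable in
  \<open>R\<close>.\<close>

hide_const (open) up_ring.monom up_ring.coeff

section \<open>A Mason--Stothers theorem with monomial common factors\<close>

text \<open>Coprimality in Bezout form: it is read off directly from identities such as x^m u - y^n
  v = 1, and the cancellation rules below follow from it over any commutative ring.\<close>

definition comaximal :: "'a::comm_ring_1 \<Rightarrow> 'a \<Rightarrow> bool"
  where "comaximal p q \<longleftrightarrow> (\<exists>s t. s * p + t * q = 1)"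

lemma comaximal_sym: "comaximal p q \<Longrightarrow> comaximal q p"
  unfolding comaximal_def by (metis add.commute)

lemma comaximal_mult_right:
  assumes "comaximal p q" "comaximal p r"
  shows "comaximal p (q * r)"
proof -
  obtain s t s' t' where "s * p + t * q = 1" "s' * p + t' * r = 1"
    using assms unfolding comaximal_def by blast
  hence "(s * p + t * q) * (s' * p + t' * r) = 1" by simp
  hence "(s * s' * p + s * t' * r + t * q * s') * p + (t * t') * (q * r) = 1"
    by (simp add: algebra_simps)
  thus ?thesis unfolding comaximal_def by blast
qed

lemma comaximal_power_right: "comaximal p q \<Longrightarrow> comaximal p (q ^ n)"
proof (induction n)
  case 0
  have "0 * p + 1 * q ^ 0 = 1" by simp
  thus ?case unfolding comaximal_def by blast
qed (simp add: comaximal_mult_right)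

lemma comaximal_power: "comaximal p q \<Longrightarrow> comaximal (p ^ k) (q ^ n)"
  by (meson comaximal_power_right comaximal_sym)

lemma comaximal_dvd_cancel:
  assumes "comaximal p q" "p dvd q * r"
  shows "p dvd r"
proof -
  obtain s t where "s * p + t * q = 1"
    using assms(1) unfolding comaximal_def by blast
  hence "r = (s * p + t * q) * r" by simp
  also have "\<dots> = p * (s * r) + t * (q * r)" by (simp add: algebra_simps)
  finally show ?thesis using assms(2) by (metis dvd_add dvd_mult dvd_triv_left)
qed

lemma comaximal_mult_dvd:
  assumes "comaximal p q" "p dvd r" "q dvd r"
  shows "p * q dvd r"
proof -
  obtain k where "r = q * k" using assms(3) by blast
  moreover from this have "p dvd k" using assms(1,2) comaximal_dvd_cancel by blast
  ultimately show ?thesis by (metis mult.commute mult_dvd_mono dvd_refl)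
qed

text \<open>The derivation w d/dw, for which w is an eigenvector: a factor w^i passes through
  unchanged, and degrees are not raised.\<close>

definition euler_op :: "'a::idom poly \<Rightarrow> 'a poly"
  where "euler_op p = [:0, 1:] * pderiv p"

lemma euler_op_mult: "euler_op (p * q) = p * euler_op q + q * euler_op p"
  by (simp add: euler_op_def pderiv_mult algebra_simps)

lemma euler_op_add: "euler_op (p + q) = euler_op p + euler_op q"
  by (simp add: euler_op_def pderiv_add algebra_simps)

lemma euler_op_minus: "euler_op (- p) = - euler_op p"
  by (simp add: euler_op_def pderiv_minus)

lemma euler_op_power: "euler_op (p ^ Suc n) = of_nat (Suc n) * p ^ n * euler_op p"
  unfolding euler_op_def pderiv_power_Suc by (simp add: of_nat_poly algebra_simps)

lemma euler_op_X_power_mult: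
  "euler_op ([:0, 1:] ^ i * p) = [:0, 1:] ^ i * (of_nat i * p + euler_op p)"
proof (cases i)
  case (Suc k)
  have "euler_op [:0, 1::'a:] = [:0, 1:]" by (simp add: euler_op_def pderiv_pCons)
  thus ?thesis unfolding Suc euler_op_mult euler_op_power by (simp add: algebra_simps)
qed simp

lemma degree_euler_op_le:
  fixes p :: "'a::{idom,semiring_char_0} poly"
  shows "degree (euler_op p) \<le> degree p"
proof (cases "degree p = 0")
  case True
  then obtain k where "p = [:k:]" using degree_eq_zeroE by blast
  thus ?thesis by (simp add: euler_op_def pderiv_pCons)
next
  case False
  have "degree (euler_op p) \<le> 1 + degree (pderiv p)"
    unfolding euler_op_def using degree_mult_le[of "[:0,1:]" "pderiv p"] by simp
  thus ?thesis using False degree_pderiv[of p] by linarith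
qed

text \<open>Degrees force the quotient of \<open>euler_op p\<close> by \<open>p\<close> to be a
  constant. At 0 the first vanishes and the second does not, so that constant is 0; in
  characteristic zero a vanishing derivative leaves only constants.\<close>

lemma dvd_euler_op_imp_const:
  fixes p :: "'a::field_char_0 poly"
  assumes "p dvd euler_op p" "poly p 0 \<noteq> 0"
  shows "degree p = 0"
proof -
  obtain k where k: "euler_op p = p * k" using assms(1) by blast
  have "euler_op p = 0"
  proof (rule ccontr)
    assume nz: "euler_op p \<noteq> 0"
    hence "k \<noteq> 0" "p \<noteq> 0" using k by auto
    hence "degree k = 0" using degree_mult_eq[of p k] degree_euler_op_le[of p] k by simp
    then obtain l where l: "k = [:l:]" using degree_eq_zeroE by blast
    have "poly (euler_op p) 0 = 0" by (simp add: euler_op_def)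
    hence "l = 0" using k l assms(2) by simp
    thus False using \<open>k \<noteq> 0\<close> l by simp
  qed
  hence "pderiv p = 0" by (simp add: euler_op_def)
  thus ?thesis using pderiv_eq_0_iff by blast
qed

definition wronskian :: "'a::idom poly \<Rightarrow> 'a poly \<Rightarrow> 'a poly"
  where "wronskian f g = f * euler_op g - g * euler_op f"

text \<open>The Wronskian is alternating and additive, so an argument may be replaced by minus the
  sum of both. Powers of all three summands can therefore be found as divisors of one and the same
  Wronskian.\<close>

lemma wronskian_cyclic:
  assumes "f + g + h = 0"
  shows "wronskian g h = wronskian f g" "wronskian h f = wronskian f g"
proof -
  have h: "h = - (f + g)" using assms by (metis add.inverse_unique)
  show "wronskian g h = wronskian f g" "wronskian h f = wronskian f g"
    unfolding wronskian_def h euler_op_minus euler_op_add by (simp_all add: algebra_simps)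
qed

lemma degree_wronskian_le:
  fixes f g :: "'a::{idom,semiring_char_0} poly"
  shows "degree (wronskian f g) \<le> degree f + degree g"
  unfolding wronskian_def
proof (rule degree_diff_le)
  show "degree (f * euler_op g) \<le> degree f + degree g"
    using degree_mult_le[of f "euler_op g"] degree_euler_op_le[of g] by linarith
  show "degree (g * euler_op f) \<le> degree f + degree g"
    using degree_mult_le[of g "euler_op f"] degree_euler_op_le[of f] by linarith
qed

text \<open>With w d/dw the extracted exponent is exactly i + j, also when both are 0; the ordinary
  derivative would give i + j - 1.\<close>

lemma wronskian_X_powers:
  "wronskian ([:0, 1:] ^ i * f) ([:0, 1:] ^ j * g) =
    [:0, 1:] ^ (i + j) * (f * (of_nat j * g + euler_op g) - g * (of_nat i * f + euler_op f))"
  unfolding wronskian_def euler_op_X_power_mult by (simp add: algebra_simps power_add)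

lemma power_dvd_euler_op: "p ^ (n - 1) dvd of_nat k * p ^ n + euler_op (p ^ n)"
proof (cases n)
  case (Suc l)
  show ?thesis unfolding Suc euler_op_power by (auto intro!: dvd_add dvd_mult dvd_mult2)
qed simp

text \<open>The reduced Wronskian \<open>E\<close>, with w^(ai+bj) removed, is divisible by P^(a-1),
  Q^(b-1) and T^(c-1), hence by their product, while its degree is at most a deg P + b deg Q. The
  comparison leaves a bound for \<open>T\<close>; those for \<open>P\<close> and \<open>Q\<close>
  follow by cyclic exchange.\<close>

lemma mason_degree_bound:
  fixes P Q T :: "'a::field_char_0 poly"
  assumes sum: "([:0, 1:] ^ i * P) ^ a + ([:0, 1:] ^ j * Q) ^ b + ([:0, 1:] ^ k * T) ^ c = 0"
    and nz: "P \<noteq> 0" "Q \<noteq> 0" "T \<noteq> 0" and pos: "a > 0" "b > 0" "c > 0"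
    and com: "comaximal P Q" "comaximal T P" "comaximal T Q" "comaximal T [:0, 1:]"
    and W: "wronskian (([:0, 1:] ^ i * P) ^ a) (([:0, 1:] ^ j * Q) ^ b) \<noteq> 0"
  shows "c * degree T \<le> degree P + degree Q + degree T"
proof -
  let ?w = "[:0, 1::'a:]"
  let ?W = "wronskian ((?w ^ i * P) ^ a) ((?w ^ j * Q) ^ b)"
  define E where "E = P ^ a * (of_nat (b * j) * Q ^ b + euler_op (Q ^ b))
      - Q ^ b * (of_nat (a * i) * P ^ a + euler_op (P ^ a))"
  have WE: "?W = ?w ^ (a * i + b * j) * E"
    using wronskian_X_powers[of "a * i" "P ^ a" "b * j" "Q ^ b"]
    by (simp add: E_def power_mult_distrib power_mult[symmetric] mult.commute)
  have "E \<noteq> 0" using W WE by auto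
  have PE: "P ^ (a - 1) dvd E"
    unfolding E_def by (intro dvd_diff dvd_mult dvd_mult2 power_dvd_euler_op le_imp_power_dvd) simp
  have QE: "Q ^ (b - 1) dvd E"
    unfolding E_def
    by (intro dvd_diff dvd_mult[OF power_dvd_euler_op] dvd_mult2[OF le_imp_power_dvd]) simp
  have "T ^ (c - 1) dvd ?W"
  proof -
    let ?F = "Q ^ b * (of_nat (c * k) * T ^ c + euler_op (T ^ c))
      - T ^ c * (of_nat (b * j) * Q ^ b + euler_op (Q ^ b))"
    have "?W = wronskian ((?w ^ j * Q) ^ b) ((?w ^ k * T) ^ c)"
      using wronskian_cyclic(1)[OF sum] by simp
    also have "\<dots> = ?w ^ (b * j + c * k) * ?F"
      using wronskian_X_powers[of "b * j" "Q ^ b" "c * k" "T ^ c"]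
      by (simp add: power_mult_distrib power_mult[symmetric] mult.commute)
    finally have "?W = ?w ^ (b * j + c * k) * ?F" .
    moreover have "T ^ (c - 1) dvd ?F"
      by (intro dvd_diff dvd_mult[OF power_dvd_euler_op] dvd_mult2[OF le_imp_power_dvd]) simp
    ultimately show ?thesis by simp
  qed
  \<comment> \<open>\<open>E\<close> arises by removing w^(ai+bj), whereas the second form of the
    Wronskian carries w^(bj+ck). Comaximality of \<open>T\<close> with w absorbs the
    discrepancy.\<close>
  hence "T ^ (c - 1) dvd E"
    using comaximal_dvd_cancel[OF comaximal_power[OF com(4)]] WE by metis
  moreover have "P ^ (a - 1) * Q ^ (b - 1) dvd E"
    by (rule comaximal_mult_dvd[OF comaximal_power[OF com(1)] PE QE])
  moreover have "comaximal (T ^ (c - 1)) (P ^ (a - 1) * Q ^ (b - 1))"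
    by (intro comaximal_mult_right comaximal_power com)
  ultimately have "T ^ (c - 1) * (P ^ (a - 1) * Q ^ (b - 1)) dvd E"
    by (metis comaximal_mult_dvd)
  hence "degree (T ^ (c - 1) * (P ^ (a - 1) * Q ^ (b - 1))) \<le> degree E"
    using \<open>E \<noteq> 0\<close> by (rule dvd_imp_degree_le)
  hence 1: "(c - 1) * degree T + ((a - 1) * degree P + (b - 1) * degree Q) \<le> degree E"
    using nz by (simp add: degree_mult_eq degree_power_eq)
  have "degree ?W = a * i + b * j + degree E"
    unfolding WE using \<open>E \<noteq> 0\<close> by (simp add: degree_mult_eq degree_power_eq)
  moreover have "degree ?W \<le> degree ((?w ^ i * P) ^ a) + degree ((?w ^ j * Q) ^ b)"
    by (rule degree_wronskian_le)
  moreover have "degree ((?w ^ i * P) ^ a) = a * i + a * degree P"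
    "degree ((?w ^ j * Q) ^ b) = b * j + b * degree Q"
    using nz by (simp_all add: degree_mult_eq degree_power_eq algebra_simps)
  ultimately have "degree E \<le> a * degree P + b * degree Q" by linarith
  moreover obtain a' b' c' where "a = Suc a'" "b = Suc b'" "c = Suc c'"
    using pos gr0_implies_Suc by metis
  ultimately show ?thesis using 1 by simp
qed

text \<open>The degenerate case, in which the degree comparison says nothing. After cancelling
  P^(a-1), \<open>P\<close> divides Q^b (a i P + a w P'), so comaximality with \<open>Q\<close> and
  characteristic zero leave that \<open>P\<close> divides w P'.\<close>

lemma wronskian_zero_imp_const:
  fixes P Q :: "'a::field_char_0 poly"
  assumes W: "wronskian (([:0, 1:] ^ i * P) ^ a) (([:0, 1:] ^ j * Q) ^ b) = 0"
    and "comaximal P Q" "poly P 0 \<noteq> 0" "a > 0"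
  shows "degree P = 0"
proof -
  let ?w = "[:0, 1::'a:]"
  obtain n where n: "a = Suc n" using assms(4) gr0_implies_Suc by blast
  have "?w ^ (a * i + b * j) * (P ^ a * (of_nat (b * j) * Q ^ b + euler_op (Q ^ b))
      - Q ^ b * (of_nat (a * i) * P ^ a + euler_op (P ^ a))) = 0"
    using W wronskian_X_powers[of "a * i" "P ^ a" "b * j" "Q ^ b"]
    by (simp add: power_mult_distrib power_mult[symmetric] mult.commute)
  hence "P ^ a * (of_nat (b * j) * Q ^ b + euler_op (Q ^ b))
      = Q ^ b * (of_nat (a * i) * P ^ a + euler_op (P ^ a))"
    by simp
  hence "P ^ n * (P * (of_nat (b * j) * Q ^ b + euler_op (Q ^ b)))
      = P ^ n * (Q ^ b * (of_nat (a * i) * P + of_nat a * euler_op P))"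
    unfolding n euler_op_power by (simp add: algebra_simps)
  hence eq: "P * (of_nat (b * j) * Q ^ b + euler_op (Q ^ b))
      = Q ^ b * (of_nat (a * i) * P + of_nat a * euler_op P)"
    using assms(3) by (subst (asm) mult_cancel_left) auto
  have "P dvd Q ^ b * (of_nat (a * i) * P + of_nat a * euler_op P)"
    using eq by (metis dvd_triv_left)
  hence "P dvd of_nat (a * i) * P + of_nat a * euler_op P"
    using comaximal_dvd_cancel[OF comaximal_power_right[OF assms(2)]] by blast
  hence "P dvd of_nat a * euler_op P" by (simp add: dvd_add_right_iff)
  hence "P dvd smult (of_nat a) (euler_op P)" by (simp add: of_nat_poly)
  hence "P dvd euler_op P" using assms(4) by (simp add: dvd_smult_iff)
  thus ?thesis using assms(3) dvd_euler_op_imp_const by blast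
qed

section \<open>Bezout identities up to powers of the variable\<close>

lemma comaximal_X:
  fixes p :: "'a::field poly"
  assumes "poly p 0 \<noteq> 0"
  shows "comaximal p [:0, 1:]"
proof -
  obtain k q where p: "p = pCons k q" by (cases p)
  hence "k \<noteq> 0" using assms by simp
  hence "[:inverse k:] * p + (- smult (inverse k) q) * [:0, 1:] = 1" by (simp add: p one_pCons)
  thus ?thesis unfolding comaximal_def by blast
qed

text \<open>As \<open>p\<close> does not vanish at 0, it is comaximal with w^N. The ideal of
  \<open>p\<close> and \<open>q\<close> contains w^N, hence also 1.\<close>

lemma comaximal_modulo_X_power:
  fixes p q :: "'a::field poly"
  assumes "s * ([:0, 1:] ^ i * p) + t * ([:0, 1:] ^ j * q) = [:0, 1:] ^ N" "poly p 0 \<noteq> 0"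
  shows "comaximal p q"
proof -
  obtain \<alpha> \<beta> where "\<alpha> * p + \<beta> * [:0, 1:] ^ N = 1"
    using comaximal_power_right[OF comaximal_X[OF assms(2)], of N] unfolding comaximal_def by blast
  hence "(\<alpha> + \<beta> * s * [:0, 1:] ^ i) * p + (\<beta> * t * [:0, 1:] ^ j) * q = 1"
    unfolding assms(1)[symmetric] by (simp add: algebra_simps)
  thus ?thesis unfolding comaximal_def by blast
qed

text \<open>Modulo \<open>P\<close> the power d^b equals (t Q)^b, and the equation turns Q^b into a
  combination of \<open>P\<close> and \<open>T\<close>. So a Bezout identity for one pair passes, up
  to a power, to the other pairs.\<close>

lemma combination_power_third:
  fixes P Q T :: "'a::comm_ring_1"
  assumes "P ^ a + Q ^ b + T ^ c = 0" "s * P + t * Q = d" "a > 0" "c > 0"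
  shows "\<exists>s' t'. s' * P + t' * T = d ^ b"
proof -
  have "s * P + t * Q - t * Q dvd (s * P + t * Q) ^ b - (t * Q) ^ b"
    by (simp add: power_diff_sumr2)
  then obtain k where "d ^ b - (t * Q) ^ b = (s * P) * k" using assms(2) by auto
  hence "d ^ b = (s * P) * k + t ^ b * Q ^ b" by (simp add: algebra_simps power_mult_distrib)
  also have "Q ^ b = - (P ^ a + T ^ c)" using assms(1) by (simp add: algebra_simps eq_neg_iff_add_eq_0)
  also have "P ^ a = P ^ (a - 1) * P" using assms(3) by (simp add: power_eq_if)
  also have "T ^ c = T ^ (c - 1) * T" using assms(4) by (simp add: power_eq_if)
  finally have "(s * k - t ^ b * P ^ (a - 1)) * P + (- (t ^ b) * T ^ (c - 1)) * T = d ^ b"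
    by (simp add: algebra_simps)
  thus ?thesis by blast
qed

lemma X_power_decomp:
  fixes p :: "'a::field poly"
  assumes "p \<noteq> 0"
  obtains i q where "p = [:0, 1:] ^ i * q" "poly q 0 \<noteq> 0"
  using order_decomp[OF assms, of 0] by (auto simp: poly_eq_0_iff_dvd)

text \<open>An exponent met only once would keep its nonzero coefficient, and three exponents none
  of which is met only once are equal.\<close>

lemma sum_three_monoms_zero:
  fixes \<alpha> \<beta> \<gamma> :: "'a::field"
  assumes "monom \<alpha> i + monom \<beta> j + monom \<gamma> k = 0" "\<alpha> \<noteq> 0" "\<beta> \<noteq> 0" "\<gamma> \<noteq> 0"
  shows "i = j \<and> j = k"
proof -
  have e: "coeff (monom \<alpha> i + monom \<beta> j + monom \<gamma> k) l = 0" for l using assms(1) by simp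
  show ?thesis using e[of i] e[of j] e[of k] assms(2-4) by (auto split: if_splits)
qed

text \<open>The powers of the variable are split off from \<open>P\<close>, \<open>Q\<close>,
  \<open>T\<close>, and the cofactors are shown to be constant. Allowing w^N on the right of
  \<open>bez\<close> admits common monomial factors; the application in the variable v has N =
  0.\<close>

theorem mason_monomials:
  fixes P Q T :: "'a::field_char_0 poly"
  assumes sum: "P ^ a + Q ^ b + T ^ c = 0"
    and bez: "s * P + t * Q = [:0, 1:] ^ N"
    and nz: "P \<noteq> 0" "Q \<noteq> 0" "T \<noteq> 0"
    and pos: "a > 0" "b > 0" "c > 0"
    and hyp: "1 / real a + 1 / real b + 1 / real c < 1"
  obtains \<alpha> \<beta> \<gamma> i j k where "P = monom \<alpha> i" "Q = monom \<beta> j" "T = monom \<gamma> k"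
    "a * i = b * j" "b * j = c * k"
proof -
  let ?w = "[:0, 1::'a:]"
  obtain i P1 where P: "P = ?w ^ i * P1" and P0: "poly P1 0 \<noteq> 0" using X_power_decomp nz(1) .
  obtain j Q1 where Q: "Q = ?w ^ j * Q1" and Q0: "poly Q1 0 \<noteq> 0" using X_power_decomp nz(2) .
  obtain k T1 where T: "T = ?w ^ k * T1" and T0: "poly T1 0 \<noteq> 0" using X_power_decomp nz(3) .
  have cPQ: "comaximal P1 Q1" using comaximal_modulo_X_power[OF bez[unfolded P Q] P0] .
  obtain s1 t1 where "s1 * P + t1 * T = (?w ^ N) ^ b"
    using combination_power_third[OF sum bez pos(1,3)] by blast
  hence "s1 * (?w ^ i * P1) + t1 * (?w ^ k * T1) = ?w ^ (N * b)" by (simp add: P T power_mult)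
  hence cPT: "comaximal P1 T1" using P0 by (rule comaximal_modulo_X_power)
  have "Q ^ b + P ^ a + T ^ c = 0" "t * Q + s * P = ?w ^ N" using sum bez by (simp_all add: ac_simps)
  then obtain s2 t2 where "s2 * Q + t2 * T = (?w ^ N) ^ a"
    using combination_power_third pos(2,3) by metis
  hence "s2 * (?w ^ j * Q1) + t2 * (?w ^ k * T1) = ?w ^ (N * a)" by (simp add: Q T power_mult)
  hence cQT: "comaximal Q1 T1" using Q0 by (rule comaximal_modulo_X_power)
  note com = cPQ cPT cQT cPQ[THEN comaximal_sym] cPT[THEN comaximal_sym] cQT[THEN comaximal_sym]
    comaximal_X[OF P0] comaximal_X[OF Q0] comaximal_X[OF T0]
  have nz1: "P1 \<noteq> 0" "Q1 \<noteq> 0" "T1 \<noteq> 0" using P0 Q0 T0 by auto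
  have sum': "Q ^ b + T ^ c + P ^ a = 0" "T ^ c + P ^ a + Q ^ b = 0"
    using sum by (simp_all add: ac_simps)
  note cyc = wronskian_cyclic[OF sum]
  have "degree P1 = 0 \<and> degree Q1 = 0 \<and> degree T1 = 0"
  proof (cases "wronskian (P ^ a) (Q ^ b) = 0")
    case True
    have "degree P1 = 0"
      using wronskian_zero_imp_const[OF True[unfolded P Q]] com P0 pos by blast
    moreover have "wronskian (Q ^ b) (T ^ c) = 0" using True cyc by simp
    hence "degree Q1 = 0"
      using wronskian_zero_imp_const[of j Q1 b k T1 c] Q T com Q0 pos by blast
    moreover have "wronskian (T ^ c) (P ^ a) = 0" using True cyc by simp
    hence "degree T1 = 0"
      using wronskian_zero_imp_const[of k T1 c i P1 a] T P com T0 pos by blast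
    ultimately show ?thesis by blast
  next
    case False
    define S where "S = degree P1 + degree Q1 + degree T1"
    have "c * degree T1 \<le> S"
      using mason_degree_bound[OF sum[unfolded P Q T]] False com nz1 pos unfolding S_def P Q by blast
    moreover have "a * degree P1 \<le> S"
      using mason_degree_bound[OF sum'(1)[unfolded P Q T]] False cyc com nz1 pos
      unfolding S_def P Q T by (simp add: ac_simps)
    moreover have "b * degree Q1 \<le> S"
      using mason_degree_bound[OF sum'(2)[unfolded P Q T]] False cyc com nz1 pos
      unfolding S_def P Q T by (simp add: ac_simps)
    ultimately have "real c * real (degree T1) \<le> real S" "real a * real (degree P1) \<le> real S"
      "real b * real (degree Q1) \<le> real S" by (metis of_nat_le_iff of_nat_mult)+
    hence "real (degree P1) \<le> real S * (1 / real a)" "real (degree Q1) \<le> real S * (1 / real b)"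
      "real (degree T1) \<le> real S * (1 / real c)" using pos by (simp_all add: field_simps)
    \<comment> \<open>The sum of the three bounds; the strict hypothesis on the exponents leaves
      only S = 0.\<close>
    hence "real S \<le> real S * (1 / real a + 1 / real b + 1 / real c)"
      unfolding distrib_left by (simp add: S_def)
    hence "S = 0" using hyp mult_le_cancel_left1[of "real S"] by (smt (verit) of_nat_0_le_iff of_nat_eq_0_iff)
    thus ?thesis unfolding S_def by simp
  qed
  then obtain \<alpha> \<beta> \<gamma> where cc: "P1 = [:\<alpha>:]" "Q1 = [:\<beta>:]" "T1 = [:\<gamma>:]"
    by (meson degree_eq_zeroE)
  have mon: "P = monom \<alpha> i" "Q = monom \<beta> j" "T = monom \<gamma> k"
    unfolding P Q T cc by (simp_all add: monom_altdef mult.commute)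
  have "monom (\<alpha> ^ a) (i * a) + monom (\<beta> ^ b) (j * b) + monom (\<gamma> ^ c) (k * c) = 0"
    using sum unfolding mon by (simp add: monom_power)
  hence "i * a = j * b \<and> j * b = k * c"
    by (rule sum_three_monoms_zero) (use nz1 cc in auto)
  thus thesis using mon that by (simp add: mult.commute)
qed


section \<open>Polynomial evaluation and generated subalgebras\<close>

definition rhom :: "('a::comm_ring_1 \<Rightarrow> 'b::comm_ring_1) \<Rightarrow> bool"
  where "rhom h \<longleftrightarrow> h 0 = 0 \<and> h 1 = 1 \<and>
    (\<forall>p q. h (p + q) = h p + h q) \<and> (\<forall>p q. h (p * q) = h p * h q)"

lemma rhomD:
  assumes "rhom h"
  shows "h 0 = 0" "h 1 = 1" "h (p + q) = h p + h q" "h (p * q) = h p * h q"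
    "h (p ^ n) = h p ^ n" "h (- p) = - h p" "h (p - q) = h p - h q"
proof -
  show h: "h 0 = 0" "h 1 = 1" "h (p + q) = h p + h q" "h (p * q) = h p * h q" for p q
    using assms unfolding rhom_def by auto
  show "h (p ^ n) = h p ^ n" by (induction n) (simp_all add: h)
  show m: "h (- p) = - h p" for p using h(3)[of p "- p"] h(1) by (simp add: eq_neg_iff_add_eq_0 add.commute)
  show "h (p - q) = h p - h q" using h(3)[of p "- q"] m by simp
qed

lemma rhom_comp: "rhom g \<Longrightarrow> rhom h \<Longrightarrow> rhom (\<lambda>p. g (h p))"
  unfolding rhom_def by simp

lemma rhom_const_poly: "rhom (\<lambda>t. [:t:])"
  unfolding rhom_def by (simp add: one_pCons)

definition eval_poly :: "('a::comm_ring_1 \<Rightarrow> 'b::comm_ring_1) \<Rightarrow> 'b \<Rightarrow> 'a poly \<Rightarrow> 'b"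
  where "eval_poly h s p = poly (map_poly h p) s"

lemma eval_poly_pCons:
  assumes "rhom h"
  shows "eval_poly h s (pCons p q) = h p + s * eval_poly h s q"
  by (cases "p = 0 \<and> q = 0") (auto simp: eval_poly_def map_poly_pCons rhomD[OF assms])

lemma eval_poly_monom:
  assumes "rhom h"
  shows "eval_poly h s (monom p n) = h p * s ^ n"
  by (simp add: eval_poly_def map_poly_monom rhomD[OF assms] poly_monom)

lemma rhom_eval_poly:
  assumes "rhom h"
  shows "rhom (eval_poly h s)"
proof -
  note h = rhomD[OF assms] and e = eval_poly_pCons[OF assms]
  have 0: "eval_poly h s 0 = 0" by (simp add: eval_poly_def)
  have add: "eval_poly h s (p + q) = eval_poly h s p + eval_poly h s q" for p q
    by (induction p q rule: poly_induct2) (simp_all add: e 0 h algebra_simps)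
  have smult: "eval_poly h s (smult k q) = h k * eval_poly h s q" for k q
    by (induction q) (simp_all add: e 0 h algebra_simps)
  have "eval_poly h s (p * q) = eval_poly h s p * eval_poly h s q" for p q
    by (induction p) (simp_all add: e 0 h add smult algebra_simps)
  thus ?thesis unfolding rhom_def by (auto simp: 0 add one_pCons e h)
qed

lemma eval_poly_simps:
  assumes "rhom h"
  shows "eval_poly h s [:p:] = h p" "eval_poly h s [:0, 1:] = s"
    "eval_poly h s (smult k q) = h k * eval_poly h s q"
proof -
  have 0: "eval_poly h s 0 = 0" by (simp add: eval_poly_def)
  show 1: "eval_poly h s [:p:] = h p" for p
    by (simp add: eval_poly_pCons[OF assms] 0)
  show "eval_poly h s [:0, 1:] = s"
    by (simp add: eval_poly_pCons[OF assms] 0 rhomD[OF assms])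
  have "eval_poly h s ([:k:] * q) = h k * eval_poly h s q"
    by (simp only: rhomD[OF rhom_eval_poly[OF assms]] 1)
  thus "eval_poly h s (smult k q) = h k * eval_poly h s q" by simp
qed

lemma rhom_sum:
  assumes "rhom h"
  shows "h (sum f A) = (\<Sum>i\<in>A. h (f i))"
  by (induction A rule: infinite_finite_induct) (simp_all add: rhomD[OF assms])

lemma eval_poly_altdef:
  assumes "rhom h"
  shows "eval_poly h s p = (\<Sum>i\<le>degree p. h (coeff p i) * s ^ i)"
proof -
  have "eval_poly h s (\<Sum>i\<le>degree p. monom (coeff p i) i) = (\<Sum>i\<le>degree p. h (coeff p i) * s ^ i)"
    unfolding rhom_sum[OF rhom_eval_poly[OF assms]] eval_poly_monom[OF assms] ..
  thus ?thesis unfolding poly_as_sum_of_monoms .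
qed

definition polys_over :: "'a::zero set \<Rightarrow> 'a poly set"
  where "polys_over B = {p. \<forall>i. coeff p i \<in> B}"

lemma polys_over_UNIV [simp]: "polys_over UNIV = UNIV"
  by (simp add: polys_over_def)

lemma pCons_in_polys_over: "pCons k q \<in> polys_over B \<longleftrightarrow> k \<in> B \<and> q \<in> polys_over B"
  unfolding polys_over_def by (auto simp: coeff_pCons split: nat.splits)

text \<open>Negation needs no rule of its own, since -1 is the image of a scalar when \<iota> is a
  ring map.\<close>

inductive_set subalg :: "('k \<Rightarrow> 'a::comm_ring_1) \<Rightarrow> 'a set \<Rightarrow> 'a set" for \<iota> G where
  const: "\<iota> k \<in> subalg \<iota> G"
| gen: "g \<in> G \<Longrightarrow> g \<in> subalg \<iota> G"
| add: "p \<in> subalg \<iota> G \<Longrightarrow> q \<in> subalg \<iota> G \<Longrightarrow> p + q \<in> subalg \<iota> G"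
| mult: "p \<in> subalg \<iota> G \<Longrightarrow> q \<in> subalg \<iota> G \<Longrightarrow> p * q \<in> subalg \<iota> G"

lemma subalg_power: "rhom \<iota> \<Longrightarrow> p \<in> subalg \<iota> G \<Longrightarrow> p ^ n \<in> subalg \<iota> G"
proof (induction n)
  case 0
  have "\<iota> 1 \<in> subalg \<iota> G" by (rule subalg.const)
  thus ?case using 0 by (simp add: rhomD)
qed (simp add: subalg.mult)

lemma subalg_0: "rhom \<iota> \<Longrightarrow> 0 \<in> subalg \<iota> G"
  using subalg.const[of \<iota> 0] by (simp add: rhomD)

lemma subalg_1: "rhom \<iota> \<Longrightarrow> 1 \<in> subalg \<iota> G"
  using subalg.const[of \<iota> 1] by (simp add: rhomD)

lemma subalg_minus:
  assumes "rhom \<iota>" "p \<in> subalg \<iota> G"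
  shows "- p \<in> subalg \<iota> G"
proof -
  have "\<iota> (- 1) * p \<in> subalg \<iota> G" by (intro subalg.mult subalg.const assms)
  thus ?thesis using assms(1) by (simp add: rhomD)
qed

lemma subalg_diff:
  assumes "rhom \<iota>" "p \<in> subalg \<iota> G" "q \<in> subalg \<iota> G"
  shows "p - q \<in> subalg \<iota> G"
  using subalg.add[OF assms(2) subalg_minus[OF assms(1,3)]] by simp

text \<open>Adjoins one generator at a time. Iterated over x, y, z and then u, v, it turns the image
  of a nested polynomial ring into an algebra given by generators, on which inductions run.
  Coefficients are confined to a set \<open>B\<close> because R itself occurs as a subset of a
  type.\<close>

lemma eval_poly_image_polys_over:
  assumes h: "rhom h" and \<iota>: "rhom \<iota>" and im: "h ` B = subalg \<iota> G"
    and B0: "0 \<in> B" "1 \<in> B"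
    and Badd: "\<And>p q. p \<in> B \<Longrightarrow> q \<in> B \<Longrightarrow> p + q \<in> B"
    and Bmult: "\<And>p q. p \<in> B \<Longrightarrow> q \<in> B \<Longrightarrow> p * q \<in> B"
  shows "eval_poly h s ` polys_over B = subalg \<iota> (insert s G)"
proof
  have mono: "p \<in> subalg \<iota> (insert s G)" if "p \<in> subalg \<iota> G" for p
    using that by induction (auto intro: subalg.intros)
  have "p \<in> polys_over B \<Longrightarrow> eval_poly h s p \<in> subalg \<iota> (insert s G)" for p
  proof (induction p)
    case 0
    thus ?case using subalg_0[OF \<iota>] by (simp add: eval_poly_def)
  next
    case (pCons k q)
    hence "k \<in> B" "q \<in> polys_over B" by (simp_all add: pCons_in_polys_over)
    moreover have "h k \<in> subalg \<iota> (insert s G)" using \<open>k \<in> B\<close> im mono by blast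
    moreover have "s \<in> subalg \<iota> (insert s G)" by (rule subalg.gen) simp
    ultimately show ?case using pCons
      by (simp add: eval_poly_pCons[OF h] subalg.add subalg.mult)
  qed
  thus "eval_poly h s ` polys_over B \<subseteq> subalg \<iota> (insert s G)" by blast
  let ?E = "eval_poly h s ` polys_over B"
  note E = rhomD[OF rhom_eval_poly[OF h, of s]]
  have sums: "sum f A \<in> B" if "\<And>i. i \<in> A \<Longrightarrow> f i \<in> B" for f :: "nat \<Rightarrow> 'a" and A
    using that by (induction A rule: infinite_finite_induct) (simp_all add: B0 Badd)
  have inc: "e \<in> ?E" if "e \<in> subalg \<iota> G" for e
  proof -
    have "e \<in> h ` B" using that unfolding im .
    then obtain k where "k \<in> B" "e = h k" by blast
    hence "e = eval_poly h s [:k:]" "[:k:] \<in> polys_over B"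
      by (simp_all add: eval_poly_simps[OF h] pCons_in_polys_over) (simp add: polys_over_def B0)
    thus ?thesis by blast
  qed
  show "subalg \<iota> (insert s G) \<subseteq> ?E"
  proof
    fix e assume "e \<in> subalg \<iota> (insert s G)"
    thus "e \<in> ?E"
    proof induction
      case (const k)
      show ?case by (intro inc subalg.const)
    next
      case (gen g)
      show ?case
      proof (cases "g = s")
        case True
        have "[:0, 1:] \<in> polys_over B"
          by (simp add: pCons_in_polys_over B0) (simp add: polys_over_def B0)
        moreover have "g = eval_poly h s [:0, 1:]" using True by (simp add: eval_poly_simps[OF h])
        ultimately show ?thesis by blast
      next
        case False
        thus ?thesis using gen by (intro inc subalg.gen) auto
      qed
    next
      case (add p q)
      then obtain p' q' where "p' \<in> polys_over B" "q' \<in> polys_over B"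
        "p = eval_poly h s p'" "q = eval_poly h s q'" by blast
      hence "p' + q' \<in> polys_over B" "p + q = eval_poly h s (p' + q')"
        by (auto simp: polys_over_def Badd E)
      thus ?case by blast
    next
      case (mult p q)
      then obtain p' q' where "p' \<in> polys_over B" "q' \<in> polys_over B"
        "p = eval_poly h s p'" "q = eval_poly h s q'" by blast
      hence "p' * q' \<in> polys_over B" "p * q = eval_poly h s (p' * q')"
        by (auto simp: polys_over_def coeff_mult E intro!: sums Bmult)
      thus ?case by blast
    qed
  qed
qed

section \<open>The surface inside a polynomial ring over a field\<close>

locale surface =
  fixes a b c :: nat
  assumes pos: "a > 0" "b > 0" "c > 0"
    and cop: "coprime a b" "coprime a c" "coprime b c"
    and hyp: "1 / real a + 1 / real b + 1 / real c < 1"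
begin

lemma exponents_gt_1: "a > 1" "b > 1" "c > 1"
proof -
  have "1 / real a > 0" "1 / real b > 0" "1 / real c > 0" using pos by auto
  hence "1 / real a < 1" "1 / real b < 1" "1 / real c < 1" using hyp by linarith+
  thus "a > 1" "b > 1" "c > 1" using pos by (simp_all add: field_simps)
qed

definition \<zeta> :: "complex fls"
  where "\<zeta> = (SOME t. t ^ c = - (1 + fls_X ^ a))"

text \<open>The constant term of -(1 + r^a) is -1, which has a complex c-th root, and a c-th root of
  the nonzero constant term extends to one of the power series.\<close>

lemma \<zeta>_power: "\<zeta> ^ c = - (1 + fls_X ^ a)"
proof -
  define rt :: "nat \<Rightarrow> complex \<Rightarrow> complex" where "rt = (\<lambda>k s. SOME t. t ^ k = s)"
  let ?f = "- (1 + fps_X ^ a) :: complex fps"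
  obtain k where k: "c = Suc k" using pos(3) gr0_implies_Suc by blast
  have f0: "?f $ 0 = - 1" using pos(1) by (simp add: fps_X_power_nth)
  have "cis (pi / real c) ^ c = - 1" using pos(3) by (simp add: DeMoivre)
  hence "\<exists>t::complex. t ^ c = - 1" by blast
  hence "rt c (?f $ 0) ^ c = ?f $ 0" unfolding rt_def f0 by (rule someI_ex)
  hence "fps_radical rt c ?f ^ c = ?f"
    using power_radical[of ?f rt k] f0 unfolding k by simp
  hence "fps_to_fls (fps_radical rt c ?f ^ c) = fps_to_fls ?f" by simp
  hence "fps_to_fls (fps_radical rt c ?f) ^ c = - (1 + fls_X ^ a)"
    by (simp add: fps_to_fls_power)
  thus ?thesis unfolding \<zeta>_def by (rule someI)
qed

lemma \<zeta>_nz: "\<zeta> \<noteq> 0"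
proof
  assume "\<zeta> = 0"
  hence "1 + fls_X ^ a = (0 :: complex fls)"
    using \<zeta>_power pos(3) by (metis neg_equal_0_iff_equal power_0_left neq0_conv)
  hence "fls_nth (1 + fls_X ^ a :: complex fls) 0 = 0" by simp
  thus False using pos(1) by simp
qed

definition scalar :: "complex \<Rightarrow> complex fls poly"
  where "scalar t = [:fls_const t:]"

text \<open>The exponents of w are the weights that put x^a, y^b and z^c into the same degree abc;
  the coefficient \<open>fls_X\<close> keeps x algebraically independent of y.\<close>

definition sx :: "complex fls poly" where "sx = monom fls_X (b * c)"
definition sy :: "complex fls poly" where "sy = monom 1 (a * c)"
definition sz :: "complex fls poly" where "sz = monom \<zeta> (a * b)"

lemma rhom_scalar: "rhom scalar"
  unfolding rhom_def scalar_def by (simp add: one_pCons flip: fls_const_mult_const fls_plus_const)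

lemma surface_equation: "sx ^ a + sy ^ b + sz ^ c = 0"
  unfolding sx_def sy_def sz_def
  by (simp add: monom_power \<zeta>_power add_monom ac_simps)

definition ev1 :: "complex poly \<Rightarrow> complex fls poly" where "ev1 = eval_poly scalar sx"
definition ev2 :: "complex poly poly \<Rightarrow> complex fls poly" where "ev2 = eval_poly ev1 sy"
definition ev :: "complex poly poly poly \<Rightarrow> complex fls poly" where "ev = eval_poly ev2 sz"

definition surf :: "complex fls poly set" where "surf = range ev"

lemma rhom_ev1: "rhom ev1" unfolding ev1_def by (rule rhom_eval_poly[OF rhom_scalar])
lemma rhom_ev2: "rhom ev2" unfolding ev2_def by (rule rhom_eval_poly[OF rhom_ev1])
lemma rhom_ev: "rhom ev" unfolding ev_def by (rule rhom_eval_poly[OF rhom_ev2])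

lemma surf_eq_subalg: "surf = subalg scalar {sz, sy, sx}"
proof -
  have "range scalar = subalg scalar {}"
  proof
    show "subalg scalar {} \<subseteq> range scalar"
    proof
      fix e assume "e \<in> subalg scalar {}"
      thus "e \<in> range scalar"
        by induction (auto simp flip: rhomD(3,4)[OF rhom_scalar])
    qed
  qed (auto intro: subalg.const)
  hence "range ev1 = subalg scalar {sx}"
    using eval_poly_image_polys_over[OF rhom_scalar rhom_scalar, of UNIV "{}" sx] by (simp add: ev1_def)
  hence "range ev2 = subalg scalar {sy, sx}"
    using eval_poly_image_polys_over[OF rhom_ev1 rhom_scalar, of UNIV "{sx}" sy] by (simp add: ev2_def)
  thus ?thesis
    using eval_poly_image_polys_over[OF rhom_ev2 rhom_scalar, of UNIV "{sy, sx}" sz]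
    by (simp add: ev_def surf_def)
qed

section \<open>Weights, and recovery of coefficients from the parametrisation\<close>

abbreviation weight :: "nat \<Rightarrow> nat \<Rightarrow> nat \<Rightarrow> nat"
  where "weight i j k \<equiv> b * c * i + a * c * j + a * b * k"

text \<open>Modulo c only the summand a b k survives, and a b is invertible there; since k < c, the
  weight determines k. What remains is one linear relation between i and j.\<close>

lemma weight_eq_imp:
  assumes "weight i j k = weight i' j' k'" "k < c" "k' < c"
  shows "k = k'" "i = i' \<Longrightarrow> j = j'"
proof -
  have "[a * b * k + c * (b * i + a * j) = a * b * k' + c * (b * i' + a * j')] (mod c)"
    using assms(1) by (simp add: algebra_simps cong_def)
  hence "[a * b * k = a * b * k'] (mod c)"
    by (simp add: cong_def)
  moreover have "coprime (a * b) c" using cop by simp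
  ultimately have "[k = k'] (mod c)" by (simp add: cong_mult_lcancel_nat)
  thus k: "k = k'" using assms(2,3) by (simp add: cong_def)
  show "j = j'" if "i = i'" using assms(1) k that pos by simp
qed

text \<open>Inverts the parametrisation on polynomials of z-degree below c: the weight singles out
  k, division by \<open>\<zeta> ^ k\<close> leaves a polynomial in \<open>fls_X\<close>, and its
  exponent i together with the weight fixes j.\<close>

definition extr_coeff :: "nat \<Rightarrow> nat \<Rightarrow> nat \<Rightarrow> complex fls poly \<Rightarrow> complex"
  where "extr_coeff i j k p = fls_nth (coeff p (weight i j k) / \<zeta> ^ k) (int i)"

lemma extr_coeff_sum: "extr_coeff i j k (sum f A) = (\<Sum>l\<in>A. extr_coeff i j k (f l))"
  by (induction A rule: infinite_finite_induct)
    (simp_all add: extr_coeff_def add_divide_distrib)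

lemma extr_coeff_monomial:
  assumes "k < c" "k' < c"
  shows "extr_coeff i j k (scalar t * sx ^ i' * sy ^ j' * sz ^ k') =
    (if k' = k then if j' = j then if i' = i then t else 0 else 0 else 0)"
proof -
  have m: "scalar t * sx ^ i' * sy ^ j' * sz ^ k' =
      monom (fls_const t * fls_X ^ i' * \<zeta> ^ k') (weight i' j' k')"
    by (simp add: scalar_def sx_def sy_def sz_def monom_power mult_monom smult_monom algebra_simps)
  show ?thesis
  proof (cases "weight i' j' k' = weight i j k")
    case True
    note w = weight_eq_imp[OF True assms(2,1)]
    have "extr_coeff i j k (scalar t * sx ^ i' * sy ^ j' * sz ^ k') =
        fls_nth (fls_const t * fls_X ^ i') (int i)"
      unfolding extr_coeff_def m using True w(1) \<zeta>_nz by simp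
    also have "\<dots> = (if i' = i then t else 0)" by auto
    finally show ?thesis using w by auto
  next
    case False
    thus ?thesis unfolding extr_coeff_def m by auto
  qed
qed

lemma extr_coeff_ev:
  assumes "degree p < c" "k < c"
  shows "extr_coeff i j k (ev p) = coeff (coeff (coeff p k) j) i"
proof -
  have pull: "(\<Sum>l\<in>S. if Q then f l else 0) = (if Q then sum f S else 0)"
    for S :: "nat set" and Q and f :: "nat \<Rightarrow> complex" by simp
  have "ev p = (\<Sum>k'\<le>degree p. \<Sum>j'\<le>degree (coeff p k'). \<Sum>i'\<le>degree (coeff (coeff p k') j').
      scalar (coeff (coeff (coeff p k') j') i') * sx ^ i' * sy ^ j' * sz ^ k')"
    unfolding ev_def eval_poly_altdef[OF rhom_ev2] unfolding ev2_def eval_poly_altdef[OF rhom_ev1]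
    unfolding ev1_def eval_poly_altdef[OF rhom_scalar] by (simp add: sum_distrib_right)
  hence "extr_coeff i j k (ev p) = (\<Sum>k'\<le>degree p. \<Sum>j'\<le>degree (coeff p k').
      \<Sum>i'\<le>degree (coeff (coeff p k') j'). if k' = k then if j' = j then if i' = i
        then coeff (coeff (coeff p k') j') i' else 0 else 0 else 0)"
    unfolding extr_coeff_sum using assms
    by (auto simp: extr_coeff_sum extr_coeff_monomial intro!: sum.cong)
  also have "\<dots> = (\<Sum>k'\<le>degree p. if k' = k then
      \<Sum>j'\<le>degree (coeff p k'). if j' = j then \<Sum>i'\<le>degree (coeff (coeff p k') j').
      if i' = i then coeff (coeff (coeff p k') j') i' else 0 else 0 else 0)"
    by (simp only: pull)
  also have "\<dots> = coeff (coeff (coeff p k) j) i"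
    by (auto simp: coeff_eq_0)
  finally show ?thesis .
qed

lemma ev_inject:
  assumes "degree p < c" "degree q < c" "ev p = ev q"
  shows "p = q"
proof (intro poly_eqI)
  fix k j i
  show "coeff (coeff (coeff p k) j) i = coeff (coeff (coeff q k) j) i"
  proof (cases "k < c")
    case True
    thus ?thesis using extr_coeff_ev assms by metis
  next
    case False
    thus ?thesis using assms by (simp add: coeff_eq_0)
  qed
qed

section \<open>The kernel of the parametrisation\<close>

definition brieskorn :: "complex poly poly poly"
  where "brieskorn = [:[:[:0, 1:] ^ a:]:] + [:[:0, 1:] ^ b:] + [:0, 1:] ^ c"

lemma ev_generators:
  "ev [:[:[:t:]:]:] = scalar t" "ev [:[:[:0, 1:]:]:] = sx" "ev [:[:0, 1:]:] = sy" "ev [:0, 1:] = sz"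
  by (simp_all add: ev_def ev2_def ev1_def eval_poly_simps rhom_scalar
      rhom_ev1[unfolded ev1_def] rhom_ev2[unfolded ev2_def ev1_def])

lemma ev_smult: "ev (smult s p) = ev [:s:] * ev p"
  by (simp flip: rhomD(4)[OF rhom_ev])

lemma const_poly_power: "[:p:] ^ n = [:p ^ n:]"
  by (induction n) (simp_all add: one_pCons mult.commute)

lemma ev_brieskorn: "ev brieskorn = 0"
proof -
  have "brieskorn = [:[:[:0, 1:]:]:] ^ a + [:[:0, 1:]:] ^ b + [:0, 1:] ^ c"
    by (simp add: brieskorn_def const_poly_power)
  thus ?thesis by (simp add: rhomD[OF rhom_ev] ev_generators surface_equation)
qed

lemma brieskorn_degree: "degree brieskorn = c" "coeff brieskorn c = 1"
proof -
  have "[:0, 1:] ^ c = (monom 1 c :: complex poly poly poly)" by (simp add: monom_altdef)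
  moreover have "degree ([:[:[:0, 1:] ^ a:]:] + [:[:0, 1:] ^ b:] :: complex poly poly poly) = 0" by simp
  ultimately show "degree brieskorn = c" "coeff brieskorn c = 1"
    using pos(3) unfolding brieskorn_def
    by (simp_all add: degree_add_eq_right degree_monom_eq coeff_eq_0)
qed

text \<open>\<open>brieskorn\<close> has leading coefficient 1 in the outermost variable, so the
  multiplier of pseudo-division disappears.\<close>

lemma normal_form:
  obtains q r where "p = q * brieskorn + r" "degree r < c"
proof -
  obtain q r where qr: "pseudo_divmod p brieskorn = (q, r)" by fastforce
  have "brieskorn \<noteq> 0" using brieskorn_degree by auto
  from pseudo_divmod[OF this qr] have "p = brieskorn * q + r" "r = 0 \<or> degree r < c"
    by (simp_all add: brieskorn_degree)
  thus thesis using that[of q r] pos by (auto simp: mult.commute)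
qed

lemma ev_eq_0_iff: "ev p = 0 \<longleftrightarrow> (\<exists>q. p = q * brieskorn)"
proof
  assume "ev p = 0"
  obtain q r where qr: "p = q * brieskorn + r" "degree r < c" by (rule normal_form)
  hence "ev r = ev 0" using \<open>ev p = 0\<close> by (simp add: rhomD[OF rhom_ev] ev_brieskorn)
  hence "r = 0" using ev_inject[OF qr(2)] pos by simp
  thus "\<exists>q. p = q * brieskorn" using qr by auto
qed (auto simp: rhomD[OF rhom_ev] ev_brieskorn)

lemma surfE:
  assumes "e \<in> surf"
  obtains p where "e = ev p" "degree p < c"
proof -
  obtain p where p: "e = ev p" using assms unfolding surf_def by blast
  obtain q r where qr: "p = q * brieskorn + r" "degree r < c" by (rule normal_form)
  hence "e = ev r" using p by (simp add: rhomD[OF rhom_ev] ev_brieskorn)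
  thus thesis using qr(2) that by blast
qed

text \<open>The normal form of an element concentrated in one weight contains monomials of that
  weight only. If there is just one such monomial, the Laurent series \<xi> has no freedom beyond a
  complex factor.\<close>

lemma homogeneous_in_surf:
  assumes e: "monom \<xi> (weight i0 j0 k0) \<in> surf" and "k0 < c"
    and uniq: "\<And>i j k. k < c \<Longrightarrow> weight i j k = weight i0 j0 k0 \<Longrightarrow> i = i0 \<and> j = j0 \<and> k = k0"
  shows "\<exists>t. monom \<xi> (weight i0 j0 k0) = scalar t * sx ^ i0 * sy ^ j0 * sz ^ k0"
proof -
  obtain p where p: "monom \<xi> (weight i0 j0 k0) = ev p" "degree p < c" using surfE[OF e] .
  define t where "t = coeff (coeff (coeff p k0) j0) i0"
  have "p = monom (monom (monom t i0) j0) k0"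
  proof (intro poly_eqI)
    fix k j i
    show "coeff (coeff (coeff p k) j) i = coeff (coeff (coeff (monom (monom (monom t i0) j0) k0) k) j) i"
    proof (cases "k < c \<and> (i, j, k) \<noteq> (i0, j0, k0)")
      case True
      hence "weight i0 j0 k0 \<noteq> weight i j k" using uniq by force
      hence "extr_coeff i j k (ev p) = 0" unfolding p(1)[symmetric] extr_coeff_def by simp
      thus ?thesis using extr_coeff_ev[OF p(2)] True by auto
    next
      case False
      thus ?thesis using p(2) assms(2) by (auto simp: coeff_eq_0 t_def)
    qed
  qed
  hence "ev p = scalar t * sx ^ i0 * sy ^ j0 * sz ^ k0"
    by (simp add: ev_def ev2_def ev1_def eval_poly_monom rhom_scalar
      rhom_ev1[unfolded ev1_def] rhom_ev2[unfolded ev2_def ev1_def])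
  thus ?thesis using p(1) by metis
qed

text \<open>In each of these weights there is a single monomial. For instance, weight bc without a
  factor x would make a divide bc, against coprimality and a > 1.\<close>

lemma surf_homogeneous:
  "monom \<xi> (b * c) \<in> surf \<Longrightarrow> \<exists>t. monom \<xi> (b * c) = scalar t * sx"
  "monom \<xi> (a * c) \<in> surf \<Longrightarrow> \<exists>t. monom \<xi> (a * c) = scalar t * sy"
  "monom \<xi> (a * b) \<in> surf \<Longrightarrow> \<exists>t. monom \<xi> (a * b) = scalar t * sz"
  "monom \<xi> 0 \<in> surf \<Longrightarrow> \<exists>t. monom \<xi> 0 = scalar t"
proof -
  have not_dvd: "\<not> a dvd b * c" "\<not> b dvd a * c" "\<not> c dvd a * b"
    using exponents_gt_1 cop coprime_absorb_left[of a "b * c"] coprime_absorb_left[of b "a * c"]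
      coprime_absorb_left[of c "a * b"] by (auto simp: coprime_commute[of _ a] coprime_commute[of c b])
  have aux: "weight i j k = b * c \<Longrightarrow> i = 1 \<and> j = 0 \<and> k = 0" for i j k
  proof -
    assume w: "weight i j k = b * c"
    have "a * (c * j + b * k) = b * c" if "i = 0" using w that by (simp add: algebra_simps)
    hence "i \<noteq> 0" using not_dvd(1) by (metis dvd_triv_left)
    then obtain l where "i = Suc l" using not0_implies_Suc by blast
    thus ?thesis using w pos by simp
  qed
  thus "monom \<xi> (b * c) \<in> surf \<Longrightarrow> \<exists>t. monom \<xi> (b * c) = scalar t * sx"
    using homogeneous_in_surf[of \<xi> 1 0 0] pos by simp
  have aux: "weight i j k = a * c \<Longrightarrow> i = 0 \<and> j = 1 \<and> k = 0" for i j k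
  proof -
    assume w: "weight i j k = a * c"
    have "b * (c * i + a * k) = a * c" if "j = 0" using w that by (simp add: algebra_simps)
    hence "j \<noteq> 0" using not_dvd(2) by (metis dvd_triv_left)
    then obtain l where "j = Suc l" using not0_implies_Suc by blast
    thus ?thesis using w pos by simp
  qed
  thus "monom \<xi> (a * c) \<in> surf \<Longrightarrow> \<exists>t. monom \<xi> (a * c) = scalar t * sy"
    using homogeneous_in_surf[of \<xi> 0 1 0] pos by simp
  have aux: "weight i j k = a * b \<Longrightarrow> i = 0 \<and> j = 0 \<and> k = 1" for i j k
  proof -
    assume w: "weight i j k = a * b"
    have "c * (b * i + a * j) = a * b" if "k = 0" using w that by (simp add: algebra_simps)
    hence "k \<noteq> 0" using not_dvd(3) by (metis dvd_triv_left)
    then obtain l where "k = Suc l" using not0_implies_Suc by blast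
    thus ?thesis using w pos by simp
  qed
  thus "monom \<xi> (a * b) \<in> surf \<Longrightarrow> \<exists>t. monom \<xi> (a * b) = scalar t * sz"
    using homogeneous_in_surf[of \<xi> 0 0 1] pos exponents_gt_1 by simp
  show "monom \<xi> 0 \<in> surf \<Longrightarrow> \<exists>t. monom \<xi> 0 = scalar t"
    using homogeneous_in_surf[of \<xi> 0 0 0] pos by simp
qed

text \<open>This is the regularity of the sequence x, y. Multiplication by x or y does not raise the
  z-degree, so the equation between normal forms already holds in the free polynomial ring, where
  coefficients can be compared.\<close>

lemma sx_dvd_of_sy_power:
  assumes "p \<in> surf" "q \<in> surf" "sy ^ N * p = sx * q"
  shows "\<exists>p'\<in>surf. p = sx * p'"
proof -
  obtain P where P: "p = ev P" "degree P < c" using surfE[OF assms(1)] .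
  obtain Q where Q: "q = ev Q" "degree Q < c" using surfE[OF assms(2)] .
  have 1: "ev (smult ([:0, 1:] ^ N) P) = sy ^ N * p"
    unfolding ev_smult P(1) by (simp add: ev_generators rhomD[OF rhom_ev] flip: const_poly_power)
  have 2: "ev (smult [:[:0, 1:]:] Q) = sx * q"
    unfolding ev_smult Q(1) by (simp add: ev_generators)
  have "smult ([:0, 1:] ^ N) P = smult [:[:0, 1:]:] Q"
    by (rule ev_inject) (use 1 2 assms(3) P Q in simp_all)
  hence eq: "monom 1 N * coeff P k = [:[:0, 1:]:] * coeff Q k" for k
    by (metis coeff_smult monom_altdef smult_1_left)
  \<comment> \<open>The candidate is \<open>Q\<close> with its Y-exponents lowered by
    \<open>N\<close>, which undoes the factor Y^N on the other side.\<close>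
  define P' where "P' = map_poly (poly_shift N) Q"
  have "P = smult [:[:0, 1:]:] P'"
  proof (intro poly_eqI)
    fix k j i
    have "coeff (monom 1 N * coeff P k) (j + N) = coeff (coeff P k) j"
      by (simp add: coeff_monom_mult)
    hence "coeff (coeff P k) j = [:0, 1:] * coeff (coeff Q k) (j + N)" unfolding eq by simp
    thus "coeff (coeff (coeff P k) j) i = coeff (coeff (coeff (smult [:[:0, 1:]:] P') k) j) i"
      by (simp add: P'_def coeff_map_poly coeff_poly_shift)
  qed
  hence "p = sx * ev P'" unfolding P(1) by (simp add: ev_smult ev_generators)
  thus ?thesis unfolding surf_def by blast
qed

lemma sx_nz: "sx \<noteq> 0" and sy_nz: "sy \<noteq> 0" and sz_nz: "sz \<noteq> 0"
  using \<zeta>_nz by (simp_all add: sx_def sy_def sz_def)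

lemma surf_mult: "p \<in> surf \<Longrightarrow> q \<in> surf \<Longrightarrow> p * q \<in> surf"
  unfolding surf_eq_subalg by (rule subalg.mult)

lemma surf_add: "p \<in> surf \<Longrightarrow> q \<in> surf \<Longrightarrow> p + q \<in> surf"
  unfolding surf_eq_subalg by (rule subalg.add)

lemma surf_power: "p \<in> surf \<Longrightarrow> p ^ n \<in> surf"
  unfolding surf_eq_subalg by (rule subalg_power[OF rhom_scalar])

lemma surf_gens: "sx \<in> surf" "sy \<in> surf" "sz \<in> surf" "scalar t \<in> surf"
  unfolding surf_eq_subalg by (auto intro: subalg.intros)

lemma surf_minus: "p \<in> surf \<Longrightarrow> - p \<in> surf"
  unfolding surf_eq_subalg by (rule subalg_minus[OF rhom_scalar])

lemma surf_01: "0 \<in> surf" "1 \<in> surf"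
  unfolding surf_eq_subalg by (rule subalg_0[OF rhom_scalar], rule subalg_1[OF rhom_scalar])

lemma sx_power_dvd_of_sy_power:
  assumes "p \<in> surf" "q \<in> surf" "sy ^ N * p = sx ^ K * q"
  shows "\<exists>p'\<in>surf. p = sx ^ K * p'"
  using assms
proof (induction K arbitrary: p)
  case (Suc K)
  have "sy ^ N * p = sx * (sx ^ K * q)" using Suc.prems(3) by simp
  from sx_dvd_of_sy_power[OF Suc.prems(1) surf_mult[OF surf_power[OF surf_gens(1)] Suc.prems(2)] this]
  obtain p1 where p1: "p1 \<in> surf" "p = sx * p1" by blast
  have "sx * (sy ^ N * p1) = sx * (sx ^ K * q)" using Suc.prems(3) p1 by (simp add: ac_simps)
  hence "sy ^ N * p1 = sx ^ K * q" using sx_nz by simp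
  then obtain p' where "p' \<in> surf" "p1 = sx ^ K * p'" using Suc.IH p1 Suc.prems(2) by blast
  thus ?case using p1 by (auto simp: ac_simps)
qed auto

end


section \<open>The threefold inside a polynomial ring over a field\<close>

lemma eval_poly_0 [simp]: "eval_poly h s 0 = 0"
  by (simp add: eval_poly_def)

lemma subalg_image:
  assumes "rhom h"
  shows "h ` subalg \<iota> G = subalg (\<lambda>t. h (\<iota> t)) (h ` G)"
proof
  show "h ` subalg \<iota> G \<subseteq> subalg (\<lambda>t. h (\<iota> t)) (h ` G)"
  proof
    fix e assume "e \<in> h ` subalg \<iota> G"
    then obtain p where "p \<in> subalg \<iota> G" "e = h p" by blast
    from this(1) have "h p \<in> subalg (\<lambda>t. h (\<iota> t)) (h ` G)"
      by induction (simp_all add: rhomD[OF assms] subalg.add subalg.mult subalg.const[of "\<lambda>t. h (\<iota> t)"] subalg.gen)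
    thus "e \<in> subalg (\<lambda>t. h (\<iota> t)) (h ` G)" using \<open>e = h p\<close> by simp
  qed
  show "subalg (\<lambda>t. h (\<iota> t)) (h ` G) \<subseteq> h ` subalg \<iota> G"
  proof
    fix e assume "e \<in> subalg (\<lambda>t. h (\<iota> t)) (h ` G)"
    thus "e \<in> h ` subalg \<iota> G"
    proof induction
      case (add p q)
      then obtain p' q' where "p' \<in> subalg \<iota> G" "q' \<in> subalg \<iota> G" "p = h p'" "q = h q'" by blast
      hence "p + q = h (p' + q')" "p' + q' \<in> subalg \<iota> G"
        by (simp_all add: rhomD[OF assms] subalg.add)
      thus ?case by blast
    next
      case (mult p q)
      then obtain p' q' where "p' \<in> subalg \<iota> G" "q' \<in> subalg \<iota> G" "p = h p'" "q = h q'" by blast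
      hence "p * q = h (p' * q')" "p' * q' \<in> subalg \<iota> G"
        by (simp_all add: rhomD[OF assms] subalg.mult)
      thus ?case by blast
    qed (auto intro: subalg.const subalg.gen)
  qed
qed

locale threefold = surface +
  fixes n m :: nat
  assumes npos: "n > 0" and mpos: "m > 0"
begin

text \<open>Laurent series in w provide a field of coefficients for Mason--Stothers in v, and in it
  x is invertible, as \<open>tu\<close> requires.\<close>

definition emb :: "complex fls poly \<Rightarrow> complex fls fls"
  where "emb p = fps_to_fls (fps_of_poly p)"

definition lft :: "complex fls poly \<Rightarrow> complex fls fls poly"
  where "lft p = [:emb p:]"

lemma rhom_emb: "rhom emb"
  unfolding rhom_def emb_def
  by (simp add: fps_of_poly_add fps_of_poly_mult fls_times_fps_to_fls)

lemma rhom_lft: "rhom lft"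
  using rhom_comp[OF rhom_const_poly rhom_emb] by (simp add: lft_def[abs_def])

lemma emb_eq_iff [simp]: "emb p = emb q \<longleftrightarrow> p = q"
  by (simp add: emb_def fps_of_poly_eq_iff)

lemma emb_eq_0_iff [simp]: "emb p = 0 \<longleftrightarrow> p = 0"
  using emb_eq_iff[of p 0] by (simp add: rhomD[OF rhom_emb])

lemma lft_eq_iff [simp]: "lft p = lft q \<longleftrightarrow> p = q"
  by (simp add: lft_def)

lemma lft_eq_0_iff [simp]: "lft p = 0 \<longleftrightarrow> p = 0"
  by (simp add: lft_def)

definition tv :: "complex fls fls poly" where "tv = [:0, 1:]"
definition tu :: "complex fls fls poly"
  where "tu = [:1 / emb sx ^ m, emb sy ^ n / emb sx ^ m:]"

abbreviation tx where "tx \<equiv> lft sx"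
abbreviation ty where "ty \<equiv> lft sy"
abbreviation tz where "tz \<equiv> lft sz"

lemma txyz_nz: "tx \<noteq> 0" "ty \<noteq> 0" "tz \<noteq> 0"
  by (simp_all add: sx_nz sy_nz sz_nz)

lemma lft_power: "lft p ^ k = [:emb p ^ k:]"
  by (simp add: lft_def const_poly_power)

lemma threefold_equation: "tx ^ m * tu - ty ^ n * tv = 1"
  by (simp add: lft_power tu_def tv_def sx_nz one_pCons)

lemma tx_tu: "tx ^ m * tu = 1 + ty ^ n * tv"
  using threefold_equation by (simp add: algebra_simps)

lemma ty_tv: "ty ^ n * tv = tx ^ m * tu - 1"
  using threefold_equation by (simp add: algebra_simps)

definition evU :: "complex fls poly poly \<Rightarrow> complex fls fls poly" where "evU = eval_poly lft tu"
definition evA :: "complex fls poly poly poly \<Rightarrow> complex fls fls poly" where "evA = eval_poly evU tv"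

lemma rhom_evU: "rhom evU" unfolding evU_def by (rule rhom_eval_poly[OF rhom_lft])
lemma rhom_evA: "rhom evA" unfolding evA_def by (rule rhom_eval_poly[OF rhom_evU])

definition surf_UV :: "complex fls poly poly poly set"
  where "surf_UV = polys_over (polys_over surf)"

definition thr :: "complex fls fls poly set" where "thr = evA ` surf_UV"

definition cst :: "complex \<Rightarrow> complex fls fls poly" where "cst t = lft (scalar t)"

lemma rhom_cst: "rhom cst"
  using rhom_comp[OF rhom_lft rhom_scalar] by (simp add: cst_def[abs_def])

lemma sum_in_surf: "(\<And>i. i \<in> A \<Longrightarrow> f i \<in> surf) \<Longrightarrow> sum f A \<in> surf"
  by (induction A rule: infinite_finite_induct) (simp_all add: surf_01 surf_add)

lemma polys_over_surf_closed:
  "0 \<in> polys_over surf" "1 \<in> polys_over surf"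
  "p \<in> polys_over surf \<Longrightarrow> q \<in> polys_over surf \<Longrightarrow> p + q \<in> polys_over surf"
  "p \<in> polys_over surf \<Longrightarrow> q \<in> polys_over surf \<Longrightarrow> p * q \<in> polys_over surf"
  "p \<in> polys_over surf \<Longrightarrow> - p \<in> polys_over surf"
  unfolding polys_over_def
  by (auto simp: surf_01 surf_add surf_minus coeff_mult coeff_1 intro!: sum_in_surf surf_mult)

lemma surf_UV_closed:
  "0 \<in> surf_UV" "1 \<in> surf_UV"
  "p \<in> surf_UV \<Longrightarrow> q \<in> surf_UV \<Longrightarrow> p + q \<in> surf_UV"
  "p \<in> surf_UV \<Longrightarrow> q \<in> surf_UV \<Longrightarrow> p * q \<in> surf_UV"
  "p \<in> surf_UV \<Longrightarrow> - p \<in> surf_UV"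
proof -
  have s: "(\<And>i. i \<in> A \<Longrightarrow> f i \<in> polys_over surf) \<Longrightarrow> sum f A \<in> polys_over surf"
    for f :: "nat \<Rightarrow> complex fls poly poly" and A
    by (induction A rule: infinite_finite_induct) (simp_all add: polys_over_surf_closed)
  show "0 \<in> surf_UV" "1 \<in> surf_UV"
    "p \<in> surf_UV \<Longrightarrow> q \<in> surf_UV \<Longrightarrow> p + q \<in> surf_UV"
    "p \<in> surf_UV \<Longrightarrow> q \<in> surf_UV \<Longrightarrow> p * q \<in> surf_UV"
    "p \<in> surf_UV \<Longrightarrow> - p \<in> surf_UV"
    unfolding surf_UV_def polys_over_def[of "polys_over surf"]
    by (auto simp: polys_over_surf_closed coeff_mult coeff_1 intro!: s)
qed

lemma thr_eq_subalg: "thr = subalg cst {tv, tu, tz, ty, tx}"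
proof -
  have "lft ` surf = subalg cst {tz, ty, tx}"
    unfolding surf_eq_subalg subalg_image[OF rhom_lft] cst_def by simp
  hence "evU ` polys_over surf = subalg cst {tu, tz, ty, tx}"
    unfolding evU_def by (intro eval_poly_image_polys_over rhom_lft rhom_cst surf_01 surf_add surf_mult)
  thus ?thesis unfolding thr_def evA_def surf_UV_def
    by (intro eval_poly_image_polys_over rhom_evU rhom_cst polys_over_surf_closed)
qed

lemma thr_closed:
  "0 \<in> thr" "1 \<in> thr" "cst t \<in> thr"
  "p \<in> thr \<Longrightarrow> q \<in> thr \<Longrightarrow> p + q \<in> thr"
  "p \<in> thr \<Longrightarrow> q \<in> thr \<Longrightarrow> p - q \<in> thr"
  "p \<in> thr \<Longrightarrow> q \<in> thr \<Longrightarrow> p * q \<in> thr"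
  "p \<in> thr \<Longrightarrow> p ^ k \<in> thr"
  unfolding thr_eq_subalg
  by (auto intro: subalg_0 subalg_1 subalg.const subalg.add subalg.mult subalg_power subalg_diff rhom_cst)

lemma thr_gens: "tx \<in> thr" "ty \<in> thr" "tz \<in> thr" "tu \<in> thr" "tv \<in> thr"
  unfolding thr_eq_subalg by (auto intro: subalg.gen)

lemma lft_surf_in_thr: "p \<in> surf \<Longrightarrow> lft p \<in> thr"
proof -
  assume "p \<in> surf"
  hence "lft p \<in> lft ` surf" by blast
  hence "lft p \<in> subalg cst {tz, ty, tx}"
    unfolding surf_eq_subalg subalg_image[OF rhom_lft] cst_def by simp
  thus ?thesis unfolding thr_eq_subalg
    by induction (auto intro: subalg.intros)
qed

text \<open>Regularity of x, y as an extension principle: an element that lies in the surface ring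
  after inverting x and also after inverting y lies in the ring itself.\<close>

lemma emb_surf_of_multiples:
  assumes "emb sx ^ N * g = emb p" "emb sy ^ K * g = emb q" "p \<in> surf" "q \<in> surf"
  shows "\<exists>s\<in>surf. g = emb s"
proof -
  have "emb (sy ^ K * p) = emb (sx ^ N * q)"
    unfolding rhomD[OF rhom_emb] assms(1,2)[symmetric] by (simp add: ac_simps)
  hence "sy ^ K * p = sx ^ N * q" by simp
  then obtain s where s: "s \<in> surf" "p = sx ^ N * s"
    using sx_power_dvd_of_sy_power[OF assms(3,4)] by blast
  have "emb sx ^ N * g = emb sx ^ N * emb s" using assms(1) s(2) by (simp add: rhomD[OF rhom_emb])
  hence "g = emb s" using sx_nz by simp
  thus ?thesis using s(1) by blast
qed

text \<open>Common form of two localisations: with x inverted, u becomes a polynomial in v; with y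
  inverted, v becomes a polynomial in u. Accordingly \<open>d\<close> and \<open>t\<close> are
  instantiated by x, v and by y, u.\<close>

lemma clear_denominators:
  assumes e: "e \<in> thr" and d: "d \<in> surf"
    and u: "\<exists>N. \<exists>r\<in>polys_over surf. lft d ^ N * tu = eval_poly lft t r"
    and v: "\<exists>N. \<exists>r\<in>polys_over surf. lft d ^ N * tv = eval_poly lft t r"
  shows "\<exists>N. \<exists>r\<in>polys_over surf. lft d ^ N * e = eval_poly lft t r"
proof -
  note E = rhomD[OF rhom_eval_poly[OF rhom_lft, of t]] eval_poly_simps[OF rhom_lft]
  have const_in: "[:s:] \<in> polys_over surf" if "s \<in> surf" for s
    using that by (auto simp: pCons_in_polys_over polys_over_surf_closed)
  have const_ok: "\<exists>N. \<exists>r\<in>polys_over surf. lft d ^ N * lft s = eval_poly lft t r" if "s \<in> surf" for s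
    using const_in[OF that] by (intro exI[of _ 0] bexI[of _ "[:s:]"]) (simp_all add: E)
  from e show ?thesis unfolding thr_eq_subalg
  proof induction
    case (const k)
    show ?case unfolding cst_def by (rule const_ok[OF surf_gens(4)])
  next
    case (gen g)
    thus ?case using u v const_ok[OF surf_gens(1)] const_ok[OF surf_gens(2)] const_ok[OF surf_gens(3)] by blast
  next
    case (add p q)
    then obtain N K r s where 1: "r \<in> polys_over surf" "lft d ^ N * p = eval_poly lft t r"
      and 2: "s \<in> polys_over surf" "lft d ^ K * q = eval_poly lft t s" by blast
    have "lft d ^ (N + K) * (p + q) = lft d ^ K * (lft d ^ N * p) + lft d ^ N * (lft d ^ K * q)"
      by (simp add: power_add algebra_simps)
    also have "\<dots> = eval_poly lft t ([:d ^ K:] * r + [:d ^ N:] * s)"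
      unfolding 1 2 by (simp only: E rhomD[OF rhom_lft])
    finally have eq: "lft d ^ (N + K) * (p + q) = \<dots>" .
    have "[:d ^ K:] * r + [:d ^ N:] * s \<in> polys_over surf"
      by (intro polys_over_surf_closed const_in surf_power d 1 2)
    thus ?case using eq by (intro exI bexI)
  next
    case (mult p q)
    then obtain N K r s where 1: "r \<in> polys_over surf" "lft d ^ N * p = eval_poly lft t r"
      and 2: "s \<in> polys_over surf" "lft d ^ K * q = eval_poly lft t s" by blast
    have "lft d ^ (N + K) * (p * q) = (lft d ^ N * p) * (lft d ^ K * q)"
      by (simp add: power_add algebra_simps)
    also have "\<dots> = eval_poly lft t (r * s)" unfolding 1 2 by (simp only: E)
    finally have eq: "lft d ^ (N + K) * (p * q) = \<dots>" .
    have "r * s \<in> polys_over surf" by (intro polys_over_surf_closed 1 2)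
    thus ?case using eq by (intro exI bexI)
  qed
qed

lemma linear_in_polys_over_surf: "s \<in> surf \<Longrightarrow> t \<in> surf \<Longrightarrow> [:s, t:] \<in> polys_over surf"
  by (simp add: pCons_in_polys_over polys_over_surf_closed)

lemma clear_tx:
  assumes "e \<in> thr"
  shows "\<exists>N. \<exists>r\<in>polys_over surf. tx ^ N * e = eval_poly lft tv r"
proof (rule clear_denominators[OF assms surf_gens(1)])
  have "tx ^ m * tu = eval_poly lft tv [:1, sy ^ n:]"
    unfolding tx_tu by (simp add: eval_poly_pCons[OF rhom_lft] rhomD[OF rhom_lft] eval_poly_simps[OF rhom_lft])
  thus "\<exists>N. \<exists>r\<in>polys_over surf. tx ^ N * tu = eval_poly lft tv r"
    using linear_in_polys_over_surf surf_01 surf_power[OF surf_gens(2)] by blast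
  have "tx ^ 0 * tv = eval_poly lft tv [:0, 1:]" by (simp add: eval_poly_simps[OF rhom_lft])
  thus "\<exists>N. \<exists>r\<in>polys_over surf. tx ^ N * tv = eval_poly lft tv r"
    using linear_in_polys_over_surf surf_01 by blast
qed

lemma clear_ty:
  assumes "e \<in> thr"
  shows "\<exists>N. \<exists>r\<in>polys_over surf. ty ^ N * e = eval_poly lft tu r"
proof (rule clear_denominators[OF assms surf_gens(2)])
  have "ty ^ n * tv = eval_poly lft tu [:- 1, sx ^ m:]"
    unfolding ty_tv by (simp add: eval_poly_pCons[OF rhom_lft] rhomD[OF rhom_lft] eval_poly_simps[OF rhom_lft])
  thus "\<exists>N. \<exists>r\<in>polys_over surf. ty ^ N * tv = eval_poly lft tu r"
    using linear_in_polys_over_surf surf_01 surf_minus surf_power[OF surf_gens(1)] by blast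
  have "ty ^ 0 * tu = eval_poly lft tu [:0, 1:]" by (simp add: eval_poly_simps[OF rhom_lft])
  thus "\<exists>N. \<exists>r\<in>polys_over surf. ty ^ N * tu = eval_poly lft tu r"
    using linear_in_polys_over_surf surf_01 by blast
qed

lemma eval_poly_lft: "eval_poly lft t r = pcompose (map_poly emb r) t"
proof (induction r)
  case (pCons k r)
  show ?case
    using pCons unfolding eval_poly_pCons[OF rhom_lft]
    by (simp add: map_poly_pCons rhomD[OF rhom_emb] pcompose_pCons lft_def[of k])
qed (simp add: eval_poly_def)

lemma coeff_eval_poly_tv: "coeff (eval_poly lft tv r) i = emb (coeff r i)"
  unfolding eval_poly_lft tv_def by (simp add: coeff_map_poly rhomD[OF rhom_emb])

lemma degree_map_emb: "degree (map_poly emb r) = degree r"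
  by (rule degree_map_poly) simp

lemma degree_tu: "degree tu = 1"
  by (simp add: tu_def sx_nz sy_nz)

lemma degree_eval_poly_tu: "degree (eval_poly lft tu r) = degree r"
  unfolding eval_poly_lft degree_pcompose degree_map_emb degree_tu by simp

lemma degree_lft_power_mult_le: "degree (lft d ^ N * e) \<le> degree e"
  unfolding lft_power using degree_mult_le[of "[:emb d ^ N:]" e] by simp

lemma coeff_lft_power_mult: "coeff (lft d ^ N * e) i = emb d ^ N * coeff e i"
  unfolding lft_power by simp

lemma polys_over_coeff: "r \<in> polys_over surf \<Longrightarrow> coeff r i \<in> surf"
  by (simp add: polys_over_def)

text \<open>Since u is linear in v, degree 0 in v also means degree 0 in u. Both localisations then
  show multiples x^N e and y^K e in the surface ring.\<close>

lemma thr_const: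
  assumes "e \<in> thr" "degree e = 0"
  shows "\<exists>s\<in>surf. e = lft s"
proof -
  obtain N r where r: "r \<in> polys_over surf" "tx ^ N * e = eval_poly lft tv r" using clear_tx assms(1) by blast
  obtain K q where q: "q \<in> polys_over surf" "ty ^ K * e = eval_poly lft tu q" using clear_ty assms(1) by blast
  obtain g where g: "e = [:g:]" using assms(2) degree_eq_zeroE by blast
  have 1: "emb sx ^ N * g = emb (coeff r 0)"
    unfolding coeff_eval_poly_tv[symmetric] r(2)[symmetric] g coeff_lft_power_mult by simp
  have "degree q = 0"
    using degree_eval_poly_tu[of q] degree_lft_power_mult_le[of sy K e] assms(2) unfolding q(2) by simp
  then obtain s where s: "q = [:s:]" using degree_eq_zeroE by blast
  have "[:emb sy ^ K * g:] = [:emb s:]"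
    using q(2) unfolding s g by (simp add: lft_power eval_poly_simps[OF rhom_lft]) (simp add: lft_def mult.commute)
  hence 2: "emb sy ^ K * g = emb s" by simp
  have "s \<in> surf" using polys_over_coeff[OF q(1), of 0] by (simp add: s)
  thus ?thesis using emb_surf_of_multiples[OF 1 2 polys_over_coeff[OF r(1)]] g by (auto simp: lft_def)
qed

text \<open>The coefficient of v in u is y^n / x^m. Seen through u, the factor x^m clears this
  denominator, so x^m times the coefficient lies in the surface ring after inverting either x or
  y.\<close>

lemma thr_linear_coeff:
  assumes "e \<in> thr" "degree e \<le> 1"
  shows "\<exists>s\<in>surf. emb sx ^ m * coeff e 1 = emb s"
proof -
  obtain N r where r: "r \<in> polys_over surf" "tx ^ N * e = eval_poly lft tv r" using clear_tx assms(1) by blast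
  obtain K q where q: "q \<in> polys_over surf" "ty ^ K * e = eval_poly lft tu q" using clear_ty assms(1) by blast
  have "emb sx ^ N * coeff e 1 = emb (coeff r 1)"
    unfolding coeff_eval_poly_tv[symmetric] r(2)[symmetric] coeff_lft_power_mult by simp
  hence 1: "emb sx ^ N * (emb sx ^ m * coeff e 1) = emb (sx ^ m * coeff r 1)"
    by (simp add: rhomD[OF rhom_emb] ac_simps)
  have "degree q \<le> 1"
    using degree_eval_poly_tu[of q] degree_lft_power_mult_le[of sy K e] assms(2) unfolding q(2) by simp
  then obtain s t where st: "q = [:s, t:]"
    by (metis One_nat_def degree1_coeffs degree_eq_zeroE le_Suc_eq le_zero_eq pCons_0_0)
  have "emb sy ^ K * coeff e 1 = coeff (eval_poly lft tu q) 1"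
    unfolding q(2)[symmetric] coeff_lft_power_mult ..
  also have "\<dots> = emb t * emb sy ^ n / emb sx ^ m"
    unfolding st by (simp add: eval_poly_pCons[OF rhom_lft] eval_poly_simps[OF rhom_lft] tu_def lft_def)
  finally have 2: "emb sy ^ K * (emb sx ^ m * coeff e 1) = emb (t * sy ^ n)"
    using sx_nz by (simp add: rhomD[OF rhom_emb] field_simps)
  have "t \<in> surf" using polys_over_coeff[OF q(1), of 1] by (simp add: st)
  thus ?thesis
    by (intro emb_surf_of_multiples[OF 1 2] surf_mult surf_power surf_gens polys_over_coeff r)
qed

section \<open>The kernel of evaluation at u, v: generated by x^m U - y^n V - 1, sorted by powers of
  V in \<open>relA\<close>\<close>

definition relA :: "complex fls poly poly poly"
  where "relA = [:[:- 1, sx ^ m:], [:- (sy ^ n):]:]"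

lemma evA_generators:
  "evA [:[:p:]:] = lft p" "evA [:[:0, 1:]:] = tu" "evA [:0, 1:] = tv"
  by (simp_all add: evA_def evU_def eval_poly_simps rhom_lft rhom_evU[unfolded evU_def])

lemma evA_relA: "evA relA = 0"
proof -
  have "relA = [:[:sx:]:] ^ m * [:[:0, 1:]:] - [:[:sy:]:] ^ n * [:0, 1:] - 1"
    by (simp add: relA_def const_poly_power one_pCons)
  thus ?thesis
    using threefold_equation by (simp only: rhomD[OF rhom_evA] evA_generators) simp
qed

text \<open>Polynomials free of U, kept inside the type of polynomials in U and V so that they can
  serve as remainders modulo \<open>relA\<close>.\<close>

definition surf_V :: "complex fls poly poly poly set"
  where "surf_V = polys_over ((\<lambda>s. [:s:]) ` surf)"

lemma surf_V_closed:
  "0 \<in> surf_V" "p \<in> surf_V \<Longrightarrow> q \<in> surf_V \<Longrightarrow> p + q \<in> surf_V"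
  "s \<in> surf \<Longrightarrow> p \<in> surf_V \<Longrightarrow> smult [:s:] p \<in> surf_V"
  "p \<in> surf_V \<Longrightarrow> pCons 0 p \<in> surf_V" "s \<in> surf \<Longrightarrow> [:[:s:]:] \<in> surf_V"
proof -
  let ?C = "(\<lambda>s. [:s:]) ` surf"
  have "[:0:] \<in> ?C" using surf_01(1) by blast
  hence C0: "0 \<in> ?C" by simp
  have Cadd: "p + q \<in> ?C" if "p \<in> ?C" "q \<in> ?C" for p q using that surf_add by force
  have Cmult: "[:s:] * p \<in> ?C" if "s \<in> surf" "p \<in> ?C" for s p using that surf_mult by force
  show "0 \<in> surf_V" "p \<in> surf_V \<Longrightarrow> q \<in> surf_V \<Longrightarrow> p + q \<in> surf_V"
    "s \<in> surf \<Longrightarrow> p \<in> surf_V \<Longrightarrow> smult [:s:] p \<in> surf_V"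
    "p \<in> surf_V \<Longrightarrow> pCons 0 p \<in> surf_V"
    unfolding surf_V_def using C0 Cadd Cmult by (simp_all add: pCons_in_polys_over) (simp_all add: polys_over_def)
  show "s \<in> surf \<Longrightarrow> [:[:s:]:] \<in> surf_V"
    unfolding surf_V_def using C0 by (simp add: pCons_in_polys_over) (simp add: polys_over_def)
qed

text \<open>Without U only V is left, and V goes to the polynomial variable itself; coefficients can
  be peeled off one by one.\<close>

lemma evA_surf_V_eq_0: "r \<in> surf_V \<Longrightarrow> evA r = 0 \<Longrightarrow> r = 0"
proof (induction r)
  case (pCons k r)
  then obtain s where s: "k = [:s:]" "s \<in> surf" and r: "r \<in> surf_V"
    unfolding surf_V_def pCons_in_polys_over by blast
  have "evA (pCons k r) = lft s + tv * evA r"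
    by (simp add: evA_def eval_poly_pCons[OF rhom_evU]) (simp add: s(1) evU_def eval_poly_simps[OF rhom_lft])
  also have "\<dots> = pCons (emb s) (evA r)" by (simp add: tv_def lft_def)
  finally have "s = 0" "evA r = 0" using pCons.prems(2) by simp_all
  thus ?case using pCons.IH r s(1) by simp
qed simp

text \<open>Modulo \<open>relA\<close> the product x^m U is 1 + y^n V, so each occurrence of U is
  eliminated at the price of a factor x^m.\<close>

lemma reduce_mod_relA:
  assumes "p \<in> surf_UV"
  shows "\<exists>N. \<exists>q\<in>surf_UV. \<exists>r\<in>surf_V. smult [:sx ^ N:] p = q * relA + r"
proof -
  let ?good = "\<lambda>p. \<exists>N. \<exists>q\<in>surf_UV. \<exists>r\<in>surf_V. smult [:sx ^ N:] p = q * relA + r"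
  have const_in: "[:[:s:]:] \<in> surf_UV" if "s \<in> surf" for s
    using that unfolding surf_UV_def
    by (simp add: pCons_in_polys_over polys_over_surf_closed) (simp add: polys_over_def[of "polys_over surf"] polys_over_surf_closed)
  have UV_in: "[:[:0, 1:]:] \<in> surf_UV" "[:0, 1:] \<in> surf_UV"
    unfolding surf_UV_def by (simp_all add: pCons_in_polys_over polys_over_surf_closed surf_01)
      (simp_all add: polys_over_def[of "polys_over surf"] polys_over_surf_closed)
  have good_const: "?good [:[:s:]:]" if "s \<in> surf" for s
    by (rule exI[of _ 0], rule bexI[of _ 0], rule bexI[of _ "[:[:s:]:]"])
      (simp_all add: surf_V_closed that surf_UV_closed one_pCons[symmetric])
  have good_add: "?good (p + q)" if p: "?good p" and q: "?good q" for p q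
  proof -
    obtain N q1 r1 where 1: "q1 \<in> surf_UV" "r1 \<in> surf_V" "smult [:sx ^ N:] p = q1 * relA + r1" using p by blast
    obtain K q2 r2 where 2: "q2 \<in> surf_UV" "r2 \<in> surf_V" "smult [:sx ^ K:] q = q2 * relA + r2" using q by blast
    have "smult [:sx ^ (N + K):] (p + q) =
        [:[:sx ^ K:]:] * smult [:sx ^ N:] p + [:[:sx ^ N:]:] * smult [:sx ^ K:] q"
      by (simp add: power_add smult_add_right ac_simps)
    also have "\<dots> = ([:[:sx ^ K:]:] * q1 + [:[:sx ^ N:]:] * q2) * relA + (smult [:sx ^ K:] r1 + smult [:sx ^ N:] r2)"
      unfolding 1 2 by (simp add: algebra_simps smult_add_right)
    finally have eq: "smult [:sx ^ (N + K):] (p + q) = \<dots>" .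
    have "[:[:sx ^ K:]:] * q1 + [:[:sx ^ N:]:] * q2 \<in> surf_UV"
      by (intro surf_UV_closed const_in surf_power surf_gens 1 2)
    moreover have "smult [:sx ^ K:] r1 + smult [:sx ^ N:] r2 \<in> surf_V"
      by (intro surf_V_closed surf_power surf_gens 1 2)
    ultimately show ?thesis using eq by (intro exI bexI)
  qed
  have good_V: "?good ([:0, 1:] * p)" if p: "?good p" for p
  proof -
    obtain N q1 r1 where 1: "q1 \<in> surf_UV" "r1 \<in> surf_V" "smult [:sx ^ N:] p = q1 * relA + r1" using p by blast
    have "smult [:sx ^ N:] ([:0, 1:] * p) = [:0, 1:] * smult [:sx ^ N:] p" by simp
    also have "\<dots> = ([:0, 1:] * q1) * relA + pCons 0 r1" unfolding 1 by (simp add: algebra_simps)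
    finally have eq: "smult [:sx ^ N:] ([:0, 1:] * p) = \<dots>" .
    have "[:0, 1:] * q1 \<in> surf_UV" by (intro surf_UV_closed UV_in 1)
    moreover have "pCons 0 r1 \<in> surf_V" by (intro surf_V_closed 1)
    ultimately show ?thesis using eq by (intro exI bexI)
  qed
  have good_U: "?good ([:[:0, 1:]:] * p)" if p: "?good p" for p
  proof -
    obtain N q1 r1 where 1: "q1 \<in> surf_UV" "r1 \<in> surf_V" "smult [:sx ^ N:] p = q1 * relA + r1" using p by blast
    have r1: "r1 \<in> surf_UV"
    proof -
      have "(\<lambda>s. [:s:]) ` surf \<subseteq> polys_over surf"
        by (auto simp: pCons_in_polys_over polys_over_surf_closed)
      thus ?thesis using 1(2) unfolding surf_UV_def surf_V_def polys_over_def[of "polys_over surf"]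
          polys_over_def[of "(\<lambda>s. [:s:]) ` surf"] by blast
    qed
    have xU: "[:[:sx ^ m:]:] * [:[:0, 1:]:] = relA + [:1, [:sy ^ n:]:]"
      by (simp add: relA_def one_pCons)
    have "smult [:sx ^ (N + m):] ([:[:0, 1:]:] * p) =
        ([:[:sx ^ m:]:] * [:[:0, 1:]:]) * smult [:sx ^ N:] p"
      by (simp add: power_add ac_simps)
    also have "\<dots> = ([:[:sx ^ m:]:] * [:[:0, 1:]:]) * q1 * relA + (relA + [:1, [:sy ^ n:]:]) * r1"
      unfolding 1(3) xU[symmetric] by (simp only: distrib_left mult.assoc)
    also have "\<dots> = (([:[:sx ^ m:]:] * [:[:0, 1:]:]) * q1 + r1) * relA
        + (r1 + pCons 0 (smult [:sy ^ n:] r1))"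
      by (simp add: algebra_simps)
    finally have eq: "smult [:sx ^ (N + m):] ([:[:0, 1:]:] * p) = \<dots>" .
    have "([:[:sx ^ m:]:] * [:[:0, 1:]:]) * q1 + r1 \<in> surf_UV"
      by (intro surf_UV_closed const_in surf_power surf_gens UV_in 1 r1)
    moreover have "r1 + pCons 0 (smult [:sy ^ n:] r1) \<in> surf_V"
      by (intro surf_V_closed surf_power surf_gens 1)
    ultimately show ?thesis using eq by (intro exI bexI)
  qed
  have good0: "?good 0" using good_const[OF surf_01(1)] by simp
  have good_inner: "k \<in> polys_over surf \<Longrightarrow> ?good [:k:]" for k
  proof (induction k)
    case (pCons s k)
    hence "?good ([:[:s:]:] + [:[:0, 1:]:] * [:k:])"
      by (intro good_add good_const good_U) (auto simp: pCons_in_polys_over)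
    thus ?case by simp
  qed (use good0 in simp)
  from assms show ?thesis
  proof (induction p)
    case (pCons k p)
    hence "?good ([:k:] + [:0, 1:] * p)"
      by (intro good_add good_inner good_V) (auto simp: pCons_in_polys_over surf_UV_def)
    thus ?case by simp
  qed (use good0 in simp)
qed

text \<open>Modulo x the relation is -(1 + y^n V), whose constant term in V is a unit. Comparing
  coefficients of V from the lowest upwards, each coefficient of \<open>q\<close> is a multiple of x
  minus y^n times the previous one.\<close>

lemma cancel_sx_relA:
  assumes "p \<in> surf_UV" "q \<in> surf_UV" "smult [:sx:] p = q * relA"
  shows "\<exists>q'\<in>surf_UV. q = smult [:sx:] q'"
proof -
  let ?P = "polys_over surf"
  have pk: "coeff p k \<in> ?P" and qk: "coeff q k \<in> ?P" for k
    using assms(1,2) unfolding surf_UV_def polys_over_def[of ?P] by auto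
  obtain l where l: "m = Suc l" using mpos gr0_implies_Suc by blast
  have U: "[:0, 1:] \<in> ?P" and c_in: "s \<in> surf \<Longrightarrow> [:s:] \<in> ?P" for s
    by (simp_all add: pCons_in_polys_over polys_over_surf_closed surf_01)
  have rec: "coeff q k = smult sx (smult (sx ^ l) ([:0, 1:] * coeff q k) - coeff p k)
      - (if k = 0 then 0 else smult (sy ^ n) (coeff q (k - 1)))" for k
  proof -
    have "q * relA = q * [:[:- 1, sx ^ m:]:] + q * ([:0, 1:] * [:[:- (sy ^ n):]:])"
      by (simp add: relA_def flip: distrib_left)
    hence "q * relA = smult [:- 1, sx ^ m:] q + pCons 0 (smult [:- (sy ^ n):] q)"
      by (simp add: mult.commute)
    hence "smult sx (coeff p k) = [:- 1, sx ^ m:] * coeff q k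
        + (if k = 0 then 0 else [:- (sy ^ n):] * coeff q (k - 1))"
      using arg_cong[OF assms(3), of "\<lambda>r. coeff r k"] by (auto simp: coeff_pCons split: nat.splits)
    thus ?thesis by (auto simp: l algebra_simps smult_add_right smult_diff_right)
  qed
  have ex: "\<exists>t\<in>?P. coeff q k = smult sx t" for k
  proof (induction k)
    case 0
    have "smult (sx ^ l) ([:0, 1:] * coeff q 0) - coeff p 0 \<in> ?P"
      using polys_over_surf_closed(3)[OF polys_over_surf_closed(4)[OF c_in[OF surf_power[OF surf_gens(1)]]
        polys_over_surf_closed(4)[OF U qk]] polys_over_surf_closed(5)[OF pk], of l 0 0] by simp
    moreover have "coeff q 0 = smult sx (smult (sx ^ l) ([:0, 1:] * coeff q 0) - coeff p 0)"
      using rec[of 0] unfolding if_P[OF refl] diff_0_right .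
    ultimately show ?case by (rule bexI[rotated])
  next
    case (Suc k)
    then obtain t where t: "t \<in> ?P" "coeff q k = smult sx t" by blast
    have in1: "smult (sx ^ l) ([:0, 1:] * coeff q (Suc k)) - coeff p (Suc k) \<in> ?P"
      using polys_over_surf_closed(3)[OF polys_over_surf_closed(4)[OF c_in[OF surf_power[OF surf_gens(1)]]
        polys_over_surf_closed(4)[OF U qk]] polys_over_surf_closed(5)[OF pk], of l "Suc k" "Suc k"] by simp
    have in2: "- smult (sy ^ n) t \<in> ?P"
      using polys_over_surf_closed(5)[OF polys_over_surf_closed(4)[OF c_in[OF surf_power[OF surf_gens(2)]] t(1)], of n]
      by simp
    have "coeff q (Suc k) = smult sx ((smult (sx ^ l) ([:0, 1:] * coeff q (Suc k)) - coeff p (Suc k))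
        + - smult (sy ^ n) t)"
      by (subst rec) (simp add: t(2) smult_add_right smult_diff_right mult.commute)
    thus ?case using polys_over_surf_closed(3)[OF in1 in2] by (rule bexI)
  qed
  define d where "d = (\<lambda>s. SOME t. t \<in> ?P \<and> s = smult sx t)"
  have d: "d (coeff q k) \<in> ?P \<and> coeff q k = smult sx (d (coeff q k))" for k
    unfolding d_def by (rule someI_ex) (use ex in blast)
  \<comment> \<open>Coefficients of \<open>map_poly d q\<close> are those of \<open>q\<close> under
    \<open>d\<close> only if \<open>d\<close> sends 0 to 0; this holds for the choice because x is
    nonzero.\<close>
  have "d 0 \<in> ?P \<and> 0 = smult sx (d 0)"
    unfolding d_def by (rule someI[of _ 0]) (simp add: polys_over_surf_closed)
  hence d0: "d 0 = 0" using sx_nz by simp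
  have "map_poly d q \<in> surf_UV"
    unfolding surf_UV_def polys_over_def[of ?P] using d by (simp add: coeff_map_poly d0)
  moreover have "q = smult [:sx:] (map_poly d q)"
    by (rule poly_eqI) (use d in \<open>simp add: coeff_map_poly d0\<close>)
  ultimately show ?thesis by blast
qed

text \<open>After multiplication by some x^N a remainder without U is left, and it must vanish. The
  factors x are then cancelled one at a time.\<close>

lemma evA_eq_0_iff:
  assumes "p \<in> surf_UV"
  shows "evA p = 0 \<longleftrightarrow> (\<exists>q\<in>surf_UV. p = q * relA)"
proof
  assume z: "evA p = 0"
  obtain N q r where qr: "q \<in> surf_UV" "r \<in> surf_V" "smult [:sx ^ N:] p = q * relA + r"
    using reduce_mod_relA[OF assms] by blast
  have "evA (smult [:sx ^ N:] p) = 0"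
    unfolding evA_def eval_poly_simps[OF rhom_evU] using z by (simp add: evA_def)
  hence "evA r = 0" unfolding qr(3) by (simp add: rhomD[OF rhom_evA] evA_relA)
  hence "smult [:sx ^ N:] p = q * relA" using evA_surf_V_eq_0 qr by simp
  from this qr(1) show "\<exists>q\<in>surf_UV. p = q * relA"
  proof (induction N arbitrary: q)
    case 0
    thus ?case by (auto simp: one_pCons[symmetric])
  next
    case (Suc N)
    let ?p = "smult [:sx ^ N:] p"
    have "[:[:sx ^ N:]:] * p \<in> surf_UV"
      by (rule surf_UV_closed(4)[OF _ assms])
        (auto simp: surf_UV_def pCons_in_polys_over polys_over_surf_closed surf_power surf_gens,
         simp add: polys_over_def[of "polys_over surf"] polys_over_surf_closed)
    hence "?p \<in> surf_UV" by simp
    moreover have eq: "smult [:sx:] ?p = q * relA" using Suc.prems(1) by (simp add: mult.commute)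
    ultimately obtain q' where q': "q' \<in> surf_UV" "q = smult [:sx:] q'"
      using cancel_sx_relA[OF _ Suc.prems(2)] by blast
    have "smult [:sx:] ?p = smult [:sx:] (q' * relA)" using eq q'(2) by simp
    hence "smult [:sx:] (?p - q' * relA) = 0" unfolding smult_diff_right by (rule right_minus_eq[THEN iffD2])
    hence "?p = q' * relA" using sx_nz unfolding smult_eq_0_iff by simp
    thus ?case using Suc.IH q'(1) by blast
  qed
qed (auto simp: rhomD[OF rhom_evA] evA_relA)

end


section \<open>Automorphisms of the surface\<close>

text \<open>The function lives on the whole ambient type, but bijectivity and the ring laws are
  demanded on the subring only. Equality of automorphisms is therefore always tested on
  \<open>S\<close>.\<close>

definition sub_aut :: "('k \<Rightarrow> 'a::comm_ring_1) \<Rightarrow> 'a set \<Rightarrow> ('a \<Rightarrow> 'a) \<Rightarrow> bool"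
  where "sub_aut \<iota> S s \<longleftrightarrow> bij_betw s S S \<and> (\<forall>t. s (\<iota> t) = \<iota> t) \<and>
    (\<forall>p\<in>S. \<forall>q\<in>S. s (p + q) = s p + s q \<and> s (p * q) = s p * s q)"

context
  fixes \<iota> :: "'k::comm_ring_1 \<Rightarrow> 'a::comm_ring_1" and G :: "'a set" and S :: "'a set" and s :: "'a \<Rightarrow> 'a"
  assumes \<iota>: "rhom \<iota>" and aut: "sub_aut \<iota> S s" and S: "S = subalg \<iota> G"
begin

lemma sub_aut_add: "p \<in> S \<Longrightarrow> q \<in> S \<Longrightarrow> s (p + q) = s p + s q"
  and sub_aut_mult: "p \<in> S \<Longrightarrow> q \<in> S \<Longrightarrow> s (p * q) = s p * s q"
  and sub_aut_const: "s (\<iota> t) = \<iota> t"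
  using aut unfolding sub_aut_def by auto

lemma sub_aut_in: "p \<in> S \<Longrightarrow> s p \<in> S"
  using aut unfolding sub_aut_def by (auto dest: bij_betwE)

lemma sub_aut_surj: "q \<in> S \<Longrightarrow> \<exists>p\<in>S. q = s p"
  using aut unfolding sub_aut_def bij_betw_def by auto

lemma sub_aut_inj: "p \<in> S \<Longrightarrow> q \<in> S \<Longrightarrow> s p = s q \<Longrightarrow> p = q"
  using aut unfolding sub_aut_def bij_betw_def by (auto dest: inj_onD)

lemma sub_aut_0: "s 0 = 0" and sub_aut_1: "s 1 = 1"
  using sub_aut_const[of 0] sub_aut_const[of 1] by (simp_all add: rhomD[OF \<iota>])

lemma sub_aut_power: "p \<in> S \<Longrightarrow> s (p ^ k) = s p ^ k"
proof (induction k)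
  case (Suc k)
  thus ?case using sub_aut_mult[of p "p ^ k"] subalg_power[OF \<iota>, of p G k] by (simp add: S)
qed (simp add: sub_aut_1)

lemma sub_aut_diff: "p \<in> S \<Longrightarrow> q \<in> S \<Longrightarrow> s (p - q) = s p - s q"
  using sub_aut_add[of "p - q" q] subalg_diff[OF \<iota>, of p G q] S by (simp add: algebra_simps)

lemma sub_aut_nz: "p \<in> S \<Longrightarrow> p \<noteq> 0 \<Longrightarrow> s p \<noteq> 0"
  using sub_aut_inj[of p 0] subalg_0[OF \<iota>, of G] sub_aut_0 S by auto

lemma sub_aut_inv: "sub_aut \<iota> S (inv_into S s)"
  unfolding sub_aut_def
proof (intro conjI ballI allI)
  have bij: "bij_betw s S S" using aut unfolding sub_aut_def by simp
  show b: "bij_betw (inv_into S s) S S" using bij by (rule bij_betw_inv_into)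
  note inv_in = bij_betwE[OF b, rule_format]
  have inv: "s (inv_into S s p) = p" if "p \<in> S" for p
    using bij_betw_inv_into_right[OF bij that] .
  have inv': "inv_into S s (s p) = p" if "p \<in> S" for p
    using bij_betw_inv_into_left[OF bij that] .
  show "inv_into S s (\<iota> t) = \<iota> t" for t
    using inv'[of "\<iota> t"] sub_aut_const S subalg.const[of \<iota> t G] by simp
  fix p q assume pq: "p \<in> S" "q \<in> S"
  have "inv_into S s p + inv_into S s q \<in> S" "inv_into S s p * inv_into S s q \<in> S"
    using inv_in pq subalg.add[of _ \<iota> G] subalg.mult[of _ \<iota> G] unfolding S by auto
  from inv'[OF this(1)] inv'[OF this(2)]
  show "inv_into S s (p + q) = inv_into S s p + inv_into S s q"
    "inv_into S s (p * q) = inv_into S s p * inv_into S s q"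
    using pq inv_in inv by (simp_all add: sub_aut_add sub_aut_mult)
qed

lemma sub_aut_eqI:
  assumes "sub_aut \<iota> S s'" "\<And>g. g \<in> G \<Longrightarrow> s g = s' g" "p \<in> S"
  shows "s p = s' p"
  using assms(3) unfolding S
proof induction
  case (const k)
  show ?case using sub_aut_const assms(1) unfolding sub_aut_def by simp
next
  case (add p q)
  thus ?case using sub_aut_add assms(1) unfolding sub_aut_def S by simp
next
  case (mult p q)
  thus ?case using sub_aut_mult assms(1) unfolding sub_aut_def S by simp
qed (rule assms(2))

end

section \<open>Arithmetic of the weights bc, ac, ab: they have gcd 1\<close>

lemma bezout_three:
  fixes a b c :: nat
  assumes "coprime a b" "coprime a c" "coprime b c"
  obtains p q r :: int where "p * (int b * int c) + q * (int a * int c) + r * (int a * int b) = 1"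
proof -
  have "gcd (int b * int c) (int a) = 1" using assms by (simp add: coprime_commute ac_simps)
  then obtain u v where 1: "u * (int b * int c) + v * int a = 1" using bezout_int by metis
  have "gcd (int c) (int b) = 1" using assms by (simp add: coprime_commute ac_simps)
  then obtain q r where 2: "q * int c + r * int b = 1" using bezout_int by metis
  have "u * (int b * int c) + (v * q) * (int a * int c) + (v * r) * (int a * int b)
      = u * (int b * int c) + v * int a * (q * int c + r * int b)" by (simp add: algebra_simps)
  also have "\<dots> = 1" unfolding 2 using 1 by simp
  finally show thesis by (rule that)
qed

text \<open>\<mu> is the product of powers of \<alpha>, \<beta>, \<gamma> with the Bezout
  coefficients of the weights as exponents. In each required power of \<mu> the equations rewrite
  all three factors to one base, whose exponent is the Bezout sum 1.\<close>

lemma simultaneous_roots: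
  fixes \<alpha> \<beta> \<gamma> :: "'a::field"
  assumes "coprime a b" "coprime a c" "coprime b c" "\<alpha> \<noteq> 0" "\<beta> \<noteq> 0" "\<gamma> \<noteq> 0"
    "\<alpha> ^ a = \<beta> ^ b" "\<beta> ^ b = \<gamma> ^ c"
  obtains \<mu> where "\<mu> \<noteq> 0" "\<mu> ^ (b * c) = \<alpha>" "\<mu> ^ (a * c) = \<beta>" "\<mu> ^ (a * b) = \<gamma>"
proof -
  obtain p q r :: int where b1: "p * (int b * int c) + q * (int a * int c) + r * (int a * int b) = 1"
    using bezout_three[OF assms(1-3)] .
  define \<mu> where "\<mu> = \<alpha> powi p * \<beta> powi q * \<gamma> powi r"
  have \<mu>: "\<mu> ^ k = \<alpha> powi (p * int k) * \<beta> powi (q * int k) * \<gamma> powi (r * int k)" for k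
    unfolding \<mu>_def by (simp add: power_mult_distrib power_int_mult)
  have pw: "t powi (int k * l) = (t ^ k) powi l" for t :: 'a and k l
    by (simp add: power_int_mult)
  have e: "\<alpha> powi (int a * l) = \<beta> powi (int b * l)" "\<beta> powi (int b * l) = \<gamma> powi (int c * l)" for l
    unfolding pw using assms(7,8) by simp_all
  have "\<mu> ^ (b * c) = \<alpha> powi (p * (int b * int c)) * \<beta> powi (int b * (q * int c)) * \<gamma> powi (int c * (r * int b))"
    unfolding \<mu> by (simp add: ac_simps)
  also have "\<dots> = \<alpha> powi (p * (int b * int c) + int a * (q * int c) + int a * (r * int b))"
    unfolding e[symmetric] using assms(4) by (simp add: power_int_add)
  also have "\<dots> = \<alpha>" using b1 by (simp add: ac_simps)
  finally have 1: "\<mu> ^ (b * c) = \<alpha>" .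
  have "\<mu> ^ (a * c) = \<alpha> powi (int a * (p * int c)) * \<beta> powi (q * (int a * int c)) * \<gamma> powi (int c * (r * int a))"
    unfolding \<mu> by (simp add: ac_simps)
  also have "\<dots> = \<beta> powi (int b * (p * int c) + q * (int a * int c) + int b * (r * int a))"
    unfolding e(1) e(2)[symmetric] using assms(5) by (simp add: power_int_add)
  also have "\<dots> = \<beta>" using b1 by (simp add: ac_simps)
  finally have 2: "\<mu> ^ (a * c) = \<beta>" .
  have "\<mu> ^ (a * b) = \<alpha> powi (int a * (p * int b)) * \<beta> powi (int b * (q * int a)) * \<gamma> powi (r * (int a * int b))"
    unfolding \<mu> by (simp add: ac_simps)
  also have "\<dots> = \<gamma> powi (int c * (p * int b) + int c * (q * int a) + r * (int a * int b))"
    unfolding e using assms(6) by (simp add: power_int_add)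
  also have "\<dots> = \<gamma>" using b1 by (simp add: ac_simps)
  finally have 3: "\<mu> ^ (a * b) = \<gamma>" .
  show thesis using that[of \<mu>] 1 2 3 assms(4-6) by (simp add: \<mu>_def)
qed

context surface
begin

text \<open>Splits off the value at the origin from a member of the ideal of x, y, z. Applied to
  preimages under an automorphism, it expresses x and y through the images of the
  generators.\<close>

lemma surf_augmentation:
  assumes "e \<in> surf"
  shows "\<exists>t. \<exists>e1\<in>surf. \<exists>e2\<in>surf. \<exists>e3\<in>surf. e = scalar t + e1 * sx + e2 * sy + e3 * sz"
proof -
  note h = rhomD[OF rhom_scalar]
  from assms have "e \<in> subalg scalar {sz, sy, sx}" by (simp add: surf_eq_subalg)
  thus ?thesis
  proof induction
    case (const k)
    have "scalar k = scalar k + 0 * sx + 0 * sy + 0 * sz" by simp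
    thus ?case using surf_01 by blast
  next
    case (gen g)
    have "sx = scalar 0 + 1 * sx + 0 * sy + 0 * sz" "sy = scalar 0 + 0 * sx + 1 * sy + 0 * sz"
      "sz = scalar 0 + 0 * sx + 0 * sy + 1 * sz" by (simp_all add: h)
    thus ?case using gen surf_01 by blast
  next
    case (add p q)
    then obtain t e1 e2 e3 t' e1' e2' e3' where 1:
      "e1 \<in> surf" "e2 \<in> surf" "e3 \<in> surf" "p = scalar t + e1 * sx + e2 * sy + e3 * sz"
      "e1' \<in> surf" "e2' \<in> surf" "e3' \<in> surf" "q = scalar t' + e1' * sx + e2' * sy + e3' * sz" by blast
    have "p + q = scalar (t + t') + (e1 + e1') * sx + (e2 + e2') * sy + (e3 + e3') * sz"
      unfolding 1 h by (simp add: algebra_simps)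
    thus ?case using 1 surf_add by blast
  next
    case (mult p q)
    then obtain t e1 e2 e3 t' e1' e2' e3' where 1:
      "e1 \<in> surf" "e2 \<in> surf" "e3 \<in> surf" "p = scalar t + e1 * sx + e2 * sy + e3 * sz"
      "e1' \<in> surf" "e2' \<in> surf" "e3' \<in> surf" "q = scalar t' + e1' * sx + e2' * sy + e3' * sz" by blast
    have q: "q \<in> surf" using mult(2) by (simp add: surf_eq_subalg)
    have "p * q = (e1 * sx + e2 * sy + e3 * sz) * q + scalar t * q"
      unfolding 1(4) by (simp add: algebra_simps)
    also have "scalar t * q = scalar (t * t') + (scalar t * e1') * sx + (scalar t * e2') * sy + (scalar t * e3') * sz"
      unfolding 1(8) h by (simp add: algebra_simps)
    finally have "p * q = scalar (t * t') + (e1 * q + scalar t * e1') * sx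
      + (e2 * q + scalar t * e2') * sy + (e3 * q + scalar t * e3') * sz"
      by (simp add: algebra_simps)
    moreover have "e1 * q + scalar t * e1' \<in> surf" "e2 * q + scalar t * e2' \<in> surf"
      "e3 * q + scalar t * e3' \<in> surf" by (intro surf_add surf_mult surf_gens 1 q)+
    ultimately show ?case by blast
  qed
qed

text \<open>Modulo \<open>P\<close> and \<open>Q\<close> the power e^c is (\<gamma> T)^c, and T^c =
  -(P^a + Q^b) lies in the ideal of \<open>P\<close> and \<open>Q\<close>.\<close>

lemma combination_power_two:
  fixes P Q T :: "'b::comm_ring_1"
  assumes "P ^ a + Q ^ b + T ^ c = 0" "\<alpha> * P + \<beta> * Q + \<gamma> * T = e"
  shows "\<exists>\<alpha>' \<beta>'. \<alpha>' * P + \<beta>' * Q = e ^ c"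
proof -
  have "e - \<gamma> * T dvd e ^ c - (\<gamma> * T) ^ c" by (simp add: power_diff_sumr2)
  then obtain k where "e ^ c - (\<gamma> * T) ^ c = (e - \<gamma> * T) * k" by blast
  moreover have "e - \<gamma> * T = \<alpha> * P + \<beta> * Q" using assms(2) by (simp add: algebra_simps)
  ultimately have "e ^ c = (\<alpha> * P + \<beta> * Q) * k + \<gamma> ^ c * T ^ c"
    by (simp add: algebra_simps power_mult_distrib)
  also have "T ^ c = - (P ^ a + Q ^ b)" using assms(1) by (simp add: algebra_simps eq_neg_iff_add_eq_0)
  also have "P ^ a = P ^ (a - 1) * P" using pos(1) by (simp add: power_eq_if)
  also have "Q ^ b = Q ^ (b - 1) * Q" using pos(2) by (simp add: power_eq_if)
  finally have "(\<alpha> * k - \<gamma> ^ c * P ^ (a - 1)) * P + (\<beta> * k - \<gamma> ^ c * Q ^ (b - 1)) * Q = e ^ c"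
    by (simp add: algebra_simps)
  thus ?thesis by blast
qed

text \<open>
  The ideal generated by \<open>P, Q, T\<close> contains \<open>sx - p\<^sub>0\<close> and \<open>sy - q\<^sub>0\<close> for some constants.
  If both constants are nonzero it contains the unit \<open>fls_X\<^sup>a q\<^sub>0\<^sup>b - p\<^sub>0\<^sup>a\<close>, as \<open>fls_X\<close> is
  transcendental over the constants; otherwise it contains a power of the variable.
\<close>

lemma surf_aut_bezout:
  assumes eq: "P ^ a + Q ^ b + T ^ c = 0"
    and x: "sx = scalar p0 + e1 * P + e2 * Q + e3 * T"
    and y: "sy = scalar q0 + f1 * P + f2 * Q + f3 * T"
  shows "\<exists>s t N. s * P + t * Q = [:0, 1:] ^ N"
proof -
  define J where "J = {e. \<exists>\<alpha> \<beta> \<gamma>. \<alpha> * P + \<beta> * Q + \<gamma> * T = e}"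
  have J_mult: "k * e \<in> J" if e: "e \<in> J" for k e
  proof -
    obtain \<alpha> \<beta> \<gamma> where "\<alpha> * P + \<beta> * Q + \<gamma> * T = e" using e unfolding J_def by blast
    hence "(k * \<alpha>) * P + (k * \<beta>) * Q + (k * \<gamma>) * T = k * e" by (simp add: algebra_simps flip: \<open>_ = e\<close>)
    thus ?thesis unfolding J_def by blast
  qed
  have J_diff: "e - f \<in> J" if ef: "e \<in> J" "f \<in> J" for e f
  proof -
    obtain \<alpha> \<beta> \<gamma> \<alpha>' \<beta>' \<gamma>' where "\<alpha> * P + \<beta> * Q + \<gamma> * T = e" "\<alpha>' * P + \<beta>' * Q + \<gamma>' * T = f"
      using ef unfolding J_def by blast
    hence "(\<alpha> - \<alpha>') * P + (\<beta> - \<beta>') * Q + (\<gamma> - \<gamma>') * T = e - f" by (simp add: algebra_simps)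
    thus ?thesis unfolding J_def by blast
  qed
  have "e1 * P + e2 * Q + e3 * T = sx - scalar p0" "f1 * P + f2 * Q + f3 * T = sy - scalar q0"
    using x y by (simp_all add: algebra_simps)
  hence Jx: "sx - scalar p0 \<in> J" and Jy: "sy - scalar q0 \<in> J"
    unfolding J_def by blast+
  have J_power: "\<exists>s t. s * P + t * Q = e ^ c" if "e \<in> J" for e
    using that combination_power_two[OF eq] unfolding J_def by blast
  have "\<exists>N. [:0, 1:] ^ N \<in> J"
  proof (cases "q0 = 0")
    case True
    hence "sy \<in> J" using Jy by (simp add: rhomD[OF rhom_scalar])
    moreover have "sy = [:0, 1:] ^ (a * c)" by (simp add: sy_def monom_altdef)
    ultimately show ?thesis by metis
  next
    case q0: False
    show ?thesis
    proof (cases "p0 = 0")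
      case True
      hence "sx \<in> J" using Jx by (simp add: rhomD[OF rhom_scalar])
      hence "[:inverse fls_X:] * sx \<in> J" by (rule J_mult)
      moreover have "[:inverse fls_X:] * sx = [:0, 1:] ^ (b * c)"
        by (simp add: sx_def monom_altdef)
      ultimately show ?thesis by metis
    next
      case p0: False
      have "sx - scalar p0 dvd sx ^ a - scalar p0 ^ a" "sy - scalar q0 dvd sy ^ b - scalar q0 ^ b"
        by (simp_all add: power_diff_sumr2)
      hence J1: "sx ^ a - scalar p0 ^ a \<in> J" and J2: "sy ^ b - scalar q0 ^ b \<in> J"
        using J_mult[OF Jx] J_mult[OF Jy] by (metis dvdE mult.commute)+
      define \<kappa> where "\<kappa> = fls_const (p0 ^ a) - fls_X ^ a * fls_const (q0 ^ b)"
      have "fls_nth \<kappa> 0 = p0 ^ a" using pos(1) by (simp add: \<kappa>_def)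
      hence \<kappa>: "\<kappa> \<noteq> 0" using p0 by auto
      have "sx ^ a = [:fls_X ^ a:] * sy ^ b"
        by (simp add: sx_def sy_def monom_power smult_monom ac_simps)
      hence "[:fls_X ^ a:] * (sy ^ b - scalar q0 ^ b) - (sx ^ a - scalar p0 ^ a) = [:\<kappa>:]"
        by (simp add: algebra_simps \<kappa>_def scalar_def const_poly_power fls_const_power)
      hence "[:\<kappa>:] \<in> J" using J_diff[OF J_mult[OF J2] J1] by metis
      hence "[:inverse \<kappa>:] * [:\<kappa>:] \<in> J" by (rule J_mult)
      hence "[:0, 1:] ^ 0 \<in> J" using \<kappa> by (simp add: one_pCons)
      thus ?thesis by blast
    qed
  qed
  then obtain N where "[:0, 1:] ^ N \<in> J" by blast
  hence "\<exists>s t. s * P + t * Q = [:0, 1:] ^ (N * c)" using J_power by (simp add: power_mult)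
  thus ?thesis by blast
qed

text \<open>\<open>l\<close> is the factor by which the images of x, y, z under an automorphism
  would exceed the original weights.\<close>

lemma common_factor_exponents:
  assumes "a * i = b * j" "b * j = c * k"
  obtains l where "i = b * c * l" "j = a * c * l" "k = a * b * l"
proof -
  have "b dvd a * i" "c dvd a * i" using assms by (metis dvd_triv_left)+
  hence "b dvd i" "c dvd i" using cop by (simp_all add: coprime_dvd_mult_right_iff coprime_commute)
  hence "b * c dvd i" using cop(3) by (rule divides_mult)
  then obtain l where l: "i = b * c * l" by blast
  have "b * j = b * (a * c * l)" "c * k = c * (a * b * l)"
    using assms[symmetric] l by (simp_all add: ac_simps)
  hence "j = a * c * l" "k = a * b * l" using pos by (metis mult_cancel1 neq0_conv)+
  thus thesis using l that by blast
qed

lemma common_divisor_weights: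
  assumes "l dvd b * c" "l dvd a * c" "l dvd a * b"
  shows "l = 1"
proof -
  have "l dvd gcd (a * c) (b * c)" using assms by simp
  hence "l dvd c" using cop(1) by (simp add: gcd_mult_distrib_nat[symmetric] mult.commute[of _ c])
  moreover have "coprime c (a * b)" using cop by (simp add: coprime_commute)
  ultimately have "l dvd 1" using assms(3) by (metis coprime_common_divisor)
  thus ?thesis by simp
qed

text \<open>The images are monomials in w whose exponents are l times the weights. By surjectivity
  every exponent of w that occurs in the surface ring is then divisible by l, and gcd 1 of the
  weights gives l = 1. So each image is a scalar multiple of its generator, and the equation ties
  the three scalars together.\<close>

lemma surf_aut_scaling:
  assumes aut: "sub_aut scalar surf \<rho>"
  obtains \<mu> where "\<mu> \<noteq> 0" "\<rho> sx = scalar (\<mu> ^ (b * c)) * sx"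
    "\<rho> sy = scalar (\<mu> ^ (a * c)) * sy" "\<rho> sz = scalar (\<mu> ^ (a * b)) * sz"
proof -
  note ctx = rhom_scalar aut surf_eq_subalg
  note hom = sub_aut_add[OF ctx] sub_aut_mult[OF ctx] sub_aut_const[OF ctx] sub_aut_power[OF ctx]
    sub_aut_0[OF ctx]
  have rs: "\<rho> p \<in> surf" if "p \<in> surf" for p using sub_aut_in[OF ctx that] .
  note surj = sub_aut_surj[OF ctx]
  have "\<rho> (sx ^ a + sy ^ b + sz ^ c) = 0" by (simp add: surface_equation hom)
  hence eq: "\<rho> sx ^ a + \<rho> sy ^ b + \<rho> sz ^ c = 0" by (simp add: hom surf_gens surf_power surf_add)
  have comb: "\<exists>t e1 e2 e3. e = scalar t + e1 * \<rho> sx + e2 * \<rho> sy + e3 * \<rho> sz" if e: "e \<in> surf" for e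
  proof -
    obtain p where p: "p \<in> surf" "e = \<rho> p" using surj[OF e] by blast
    obtain t e1 e2 e3 where 1: "e1 \<in> surf" "e2 \<in> surf" "e3 \<in> surf"
      "p = scalar t + e1 * sx + e2 * sy + e3 * sz" using surf_augmentation[OF p(1)] by blast
    have "e = scalar t + \<rho> e1 * \<rho> sx + \<rho> e2 * \<rho> sy + \<rho> e3 * \<rho> sz"
      unfolding p(2) 1(4) by (simp add: hom surf_gens surf_add surf_mult 1(1-3))
    thus ?thesis by blast
  qed
  obtain p0 e1 e2 e3 where x: "sx = scalar p0 + e1 * \<rho> sx + e2 * \<rho> sy + e3 * \<rho> sz"
    using comb[OF surf_gens(1)] by blast
  obtain q0 f1 f2 f3 where y: "sy = scalar q0 + f1 * \<rho> sx + f2 * \<rho> sy + f3 * \<rho> sz"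
    using comb[OF surf_gens(2)] by blast
  obtain s t N where bez: "s * \<rho> sx + t * \<rho> sy = [:0, 1:] ^ N" using surf_aut_bezout[OF eq x y] by blast
  have nz: "\<rho> sx \<noteq> 0" "\<rho> sy \<noteq> 0" "\<rho> sz \<noteq> 0"
    using sub_aut_nz[OF ctx] surf_gens sx_nz sy_nz sz_nz by auto
  obtain \<xi> \<eta> \<theta> i j k where mon: "\<rho> sx = monom \<xi> i" "\<rho> sy = monom \<eta> j" "\<rho> sz = monom \<theta> k"
    and ij: "a * i = b * j" "b * j = c * k"
    using mason_monomials[OF eq bez nz pos hyp] .
  obtain l where l: "i = b * c * l" "j = a * c * l" "k = a * b * l"
    using common_factor_exponents[OF ij] .
  have div: "\<forall>d. coeff (\<rho> p) d \<noteq> 0 \<longrightarrow> l dvd d" if "p \<in> surf" for p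
  proof -
    from that have "p \<in> subalg scalar {sz, sy, sx}" by (simp add: surf_eq_subalg)
    thus ?thesis
    proof induction
      case (const t)
      show ?case unfolding sub_aut_const[OF ctx] by (auto simp: scalar_def coeff_pCons split: nat.splits)
    next
      case (gen g)
      thus ?case using mon l by (auto split: if_splits)
    next
      case (add p q)
      hence "\<rho> (p + q) = \<rho> p + \<rho> q" by (simp add: hom surf_eq_subalg)
      thus ?case using add by (metis add.right_neutral coeff_add)
    next
      case (mult p q)
      hence pq: "\<rho> (p * q) = \<rho> p * \<rho> q" by (simp add: hom surf_eq_subalg)
      show ?case
      proof (intro allI impI)
        fix d assume "coeff (\<rho> (p * q)) d \<noteq> 0"
        then obtain i where "i \<le> d" "coeff (\<rho> p) i * coeff (\<rho> q) (d - i) \<noteq> 0"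
          unfolding pq coeff_mult by (meson atMost_iff sum.not_neutral_contains_not_neutral)
        hence "l dvd i" "l dvd d - i" using mult by auto
        thus "l dvd d" using \<open>i \<le> d\<close> by (metis dvd_add le_add_diff_inverse)
      qed
    qed
  qed
  have div': "coeff e d \<noteq> 0 \<Longrightarrow> l dvd d" if "e \<in> surf" for e d
    using surj[OF that] div by blast
  have "l dvd b * c" "l dvd a * c" "l dvd a * b"
    using div'[OF surf_gens(1), of "b * c"] div'[OF surf_gens(2), of "a * c"]
      div'[OF surf_gens(3), of "a * b"] \<zeta>_nz by (simp_all add: sx_def sy_def sz_def)
  hence "l = 1" by (rule common_divisor_weights)
  hence mon': "\<rho> sx = monom \<xi> (b * c)" "\<rho> sy = monom \<eta> (a * c)" "\<rho> sz = monom \<theta> (a * b)"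
    using mon l by auto
  obtain \<alpha> \<beta> \<gamma> where ABC: "\<rho> sx = scalar \<alpha> * sx" "\<rho> sy = scalar \<beta> * sy" "\<rho> sz = scalar \<gamma> * sz"
    using surf_homogeneous(1)[of \<xi>] surf_homogeneous(2)[of \<eta>] surf_homogeneous(3)[of \<theta>]
      rs[OF surf_gens(1)] rs[OF surf_gens(2)] rs[OF surf_gens(3)] unfolding mon' by metis
  have nz': "\<alpha> \<noteq> 0" "\<beta> \<noteq> 0" "\<gamma> \<noteq> 0" using nz ABC by (auto simp: rhomD[OF rhom_scalar])
  \<comment> \<open>The whole equation sits in weight abc. Its coefficient there is a series in
    \<open>fls_X\<close>, whose terms of degree 0 and a give the two equalities among the
    powers.\<close>
  have "coeff ((scalar \<alpha> * sx) ^ a + (scalar \<beta> * sy) ^ b + (scalar \<gamma> * sz) ^ c) (a * b * c) =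
      fls_const (\<alpha> ^ a) * fls_X ^ a + fls_const (\<beta> ^ b) - fls_const (\<gamma> ^ c) * (1 + fls_X ^ a)"
    by (simp add: scalar_def sx_def sy_def sz_def monom_power smult_monom power_mult_distrib \<zeta>_power
        ac_simps flip: fls_const_power) (simp add: algebra_simps)
  hence z: "fls_const (\<alpha> ^ a) * fls_X ^ a + fls_const (\<beta> ^ b) - fls_const (\<gamma> ^ c) * (1 + fls_X ^ a) = 0"
    using eq unfolding ABC by simp
  have "\<beta> ^ b = \<gamma> ^ c" using arg_cong[OF z, of "\<lambda>f. fls_nth f 0"] pos(1) by (simp add: algebra_simps)
  moreover have "\<alpha> ^ a = \<gamma> ^ c" using arg_cong[OF z, of "\<lambda>f. fls_nth f (int a)"] pos(1)
    by (simp add: algebra_simps)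
  ultimately have e: "\<alpha> ^ a = \<beta> ^ b" "\<beta> ^ b = \<gamma> ^ c" by simp_all
  obtain \<mu> where "\<mu> \<noteq> 0" "\<mu> ^ (b * c) = \<alpha>" "\<mu> ^ (a * c) = \<beta>" "\<mu> ^ (a * b) = \<gamma>"
    using simultaneous_roots[OF cop nz' e] .
  thus thesis using that ABC by blast
qed

end


section \<open>Automorphisms of the threefold\<close>

lemma sub_aut_comp:
  assumes "sub_aut \<iota> S s" "sub_aut \<iota> S s'"
  shows "sub_aut \<iota> S (\<lambda>p. s (s' p))"
proof -
  have "bij_betw (s \<circ> s') S S" using assms unfolding sub_aut_def by (meson bij_betw_trans)
  moreover have "s' p \<in> S" if "p \<in> S" for p using that assms(2) unfolding sub_aut_def by (auto dest: bij_betwE)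
  ultimately show ?thesis using assms unfolding sub_aut_def comp_def by simp
qed

text \<open>The candidates are ring maps of the ambient type, so that range and inverse have to be
  checked on generators only.\<close>

lemma sub_aut_of_rhom:
  assumes h: "rhom h" and k: "rhom k" and \<iota>: "rhom \<iota>"
    and fixed: "\<And>t. h (\<iota> t) = \<iota> t" "\<And>t. k (\<iota> t) = \<iota> t"
    and gens: "\<And>g. g \<in> G \<Longrightarrow> h g \<in> subalg \<iota> G" "\<And>g. g \<in> G \<Longrightarrow> k g \<in> subalg \<iota> G"
    and inv: "\<And>g. g \<in> G \<Longrightarrow> k (h g) = g" "\<And>g. g \<in> G \<Longrightarrow> h (k g) = g"
  shows "sub_aut \<iota> (subalg \<iota> G) h"
proof -
  have in_h: "h p \<in> subalg \<iota> G" if "p \<in> subalg \<iota> G" for p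
    using that by induction (auto simp: rhomD[OF h] fixed gens intro: subalg.const subalg.add subalg.mult)
  have in_k: "k p \<in> subalg \<iota> G" if "p \<in> subalg \<iota> G" for p
    using that by induction (auto simp: rhomD[OF k] fixed gens intro: subalg.const subalg.add subalg.mult)
  have kh: "k (h p) = p" if "p \<in> subalg \<iota> G" for p
    using that by induction (auto simp: rhomD[OF h] rhomD[OF k] fixed inv)
  have hk: "h (k p) = p" if "p \<in> subalg \<iota> G" for p
    using that by induction (auto simp: rhomD[OF h] rhomD[OF k] fixed inv)
  have "bij_betw h (subalg \<iota> G) (subalg \<iota> G)"
    by (rule bij_betw_byWitness[of _ k]) (use in_h in_k kh hk in auto)
  thus ?thesis unfolding sub_aut_def by (simp add: fixed rhomD[OF h])
qed

context threefold
begin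

subsection \<open>The two families\<close>

definition shear :: "complex fls poly \<Rightarrow> complex fls fls poly \<Rightarrow> complex fls fls poly"
  where "shear f p = pcompose p (tv + lft f * tx ^ m)"

text \<open>The substitution of \<mu> w for w. It is the torus action belonging to the grading: an
  element of weight k is multiplied by \<mu>^k.\<close>

definition twist :: "complex \<Rightarrow> complex fls fls \<Rightarrow> complex fls fls"
  where "twist \<mu> q = fls_compose_fps q (fps_const (fls_const \<mu>) * fps_X)"

definition scale :: "complex \<Rightarrow> complex fls fls poly \<Rightarrow> complex fls fls poly"
  where "scale \<mu> = eval_poly (\<lambda>q. [:twist \<mu> q:]) (cst (\<mu> powi (- int (n * a * c))) * tv)"

lemma rhom_shear: "rhom (shear f)"
  unfolding rhom_def shear_def by (simp add: pcompose_1 pcompose_add pcompose_mult)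

lemma shear_lft: "shear f (lft p) = lft p"
  by (simp add: shear_def lft_def)

lemma shear_cst: "shear f (cst t) = cst t"
  by (simp add: cst_def shear_lft)

lemma shear_tv: "shear f tv = tv + lft f * tx ^ m"
  by (simp add: shear_def tv_def pcompose_pCons)

text \<open>In the realisation u is a fraction, not a variable. Its image follows from applying the
  map to x^m u = 1 + y^n v and cancelling x^m.\<close>

lemma shear_tu: "shear f tu = tu + lft f * ty ^ n"
proof -
  note h = rhomD[OF rhom_shear]
  have "tx ^ m * shear f tu = shear f (tx ^ m * tu)" by (simp add: h shear_lft)
  also have "\<dots> = 1 + ty ^ n * (tv + lft f * tx ^ m)" unfolding tx_tu by (simp add: h shear_lft shear_tv)
  also have "\<dots> = (1 + ty ^ n * tv) + tx ^ m * (lft f * ty ^ n)" by (simp add: algebra_simps)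
  also have "\<dots> = tx ^ m * (tu + lft f * ty ^ n)" unfolding tx_tu[symmetric] by (simp add: algebra_simps)
  finally show ?thesis using txyz_nz by simp
qed

lemma lft_minus: "lft (- f) = - lft f"
  by (simp add: rhomD[OF rhom_lft])

lemma shear_aut:
  assumes "f \<in> surf"
  shows "sub_aut cst thr (shear f)"
proof -
  have gens: "shear g p \<in> thr" if "p \<in> {tv, tu, tz, ty, tx}" "g \<in> surf" for g p
    using that thr_gens thr_closed lft_surf_in_thr by (auto simp: shear_tv shear_tu shear_lft)
  have inv: "shear (- g) (shear g p) = p" if "p \<in> {tv, tu, tz, ty, tx}" for g p
    using that by (auto simp: shear_tv shear_tu shear_lft rhomD[OF rhom_shear] lft_minus)
  show ?thesis unfolding thr_eq_subalg
    by (rule sub_aut_of_rhom[of _ "shear (- f)"])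
      (use gens[OF _ assms] gens[OF _ surf_minus[OF assms]] inv[of _ f] inv[of _ "- f"]
        in \<open>simp_all add: rhom_shear rhom_cst shear_cst thr_eq_subalg\<close>)
qed

lemma rhom_twist:
  assumes "\<mu> \<noteq> 0"
  shows "rhom (twist \<mu>)"
proof -
  have "fps_const (fls_const \<mu>) * fps_X \<noteq> (0 :: complex fls fps)" using assms by simp
  thus ?thesis unfolding rhom_def twist_def by (simp add: fls_compose_fps_add fls_compose_fps_mult)
qed

lemma twist_emb_monom: "\<mu> \<noteq> 0 \<Longrightarrow> twist \<mu> (emb (monom \<xi> k)) = emb (scalar (\<mu> ^ k) * monom \<xi> k)"
proof -
  assume "\<mu> \<noteq> 0"
  note tw = rhomD[OF rhom_twist[OF this]]
  have e: "emb (monom \<xi> k) = fls_const \<xi> * fls_X ^ k" for \<xi> k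
    by (simp add: emb_def monom_altdef fps_of_poly_smult fps_of_poly_power fls_times_fps_to_fls
        fps_to_fls_power)
  have "twist \<mu> (emb (monom \<xi> k)) = fls_const \<xi> * (fls_const (fls_const \<mu>) * fls_X) ^ k"
    unfolding e tw by (simp add: twist_def fls_times_fps_to_fls)
  also have "\<dots> = emb (monom (fls_const (\<mu> ^ k) * \<xi>) k)"
    unfolding e by (simp add: power_mult_distrib fls_const_power ac_simps flip: fls_const_mult_const)
  finally show ?thesis by (simp add: scalar_def smult_monom)
qed

lemma rhom_scale: "\<mu> \<noteq> 0 \<Longrightarrow> rhom (scale \<mu>)"
  unfolding scale_def by (intro rhom_eval_poly rhom_comp[OF rhom_const_poly] rhom_twist)

lemma scale_const: "\<mu> \<noteq> 0 \<Longrightarrow> scale \<mu> [:q:] = [:twist \<mu> q:]"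
  unfolding scale_def by (subst eval_poly_simps) (auto intro: rhom_comp[OF rhom_const_poly] rhom_twist)

lemma scale_lft_monom: "\<mu> \<noteq> 0 \<Longrightarrow> scale \<mu> (lft (monom \<xi> k)) = cst (\<mu> ^ k) * lft (monom \<xi> k)"
  by (simp add: lft_def[of "monom \<xi> k"] scale_const twist_emb_monom)
    (simp add: cst_def lft_def rhomD[OF rhom_emb] mult.commute)

lemma scale_xyz:
  assumes "\<mu> \<noteq> 0"
  shows "scale \<mu> tx = cst (\<mu> ^ (b * c)) * tx" "scale \<mu> ty = cst (\<mu> ^ (a * c)) * ty"
    "scale \<mu> tz = cst (\<mu> ^ (a * b)) * tz"
  unfolding sx_def sy_def sz_def by (rule scale_lft_monom[OF assms])+

lemma scale_cst: "\<mu> \<noteq> 0 \<Longrightarrow> scale \<mu> (cst t) = cst t"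
proof -
  assume "\<mu> \<noteq> 0"
  hence "scale \<mu> (lft (monom (fls_const t) 0)) = cst 1 * lft (monom (fls_const t) 0)"
    by (simp add: scale_lft_monom)
  thus ?thesis by (simp add: cst_def scalar_def monom_0 rhomD[OF rhom_lft] one_pCons[symmetric])
qed

lemma scale_tv: "\<mu> \<noteq> 0 \<Longrightarrow> scale \<mu> tv = cst (\<mu> powi (- int (n * a * c))) * tv"
  unfolding scale_def tv_def
  by (subst eval_poly_simps) (auto intro: rhom_comp[OF rhom_const_poly] rhom_twist)

lemma cst_mult: "cst s * cst t = cst (s * t)" and cst_power: "cst s ^ k = cst (s ^ k)" and cst_1: "cst 1 = 1"
  by (simp_all add: rhomD[OF rhom_cst])

lemma cst_mult_assoc: "cst s * (cst t * p) = cst (s * t) * p"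
  by (simp add: cst_mult flip: mult.assoc)

lemma scale_tu:
  assumes "\<mu> \<noteq> 0"
  shows "scale \<mu> tu = cst (\<mu> powi (- int (m * b * c))) * tu"
proof -
  note h = rhomD[OF rhom_scale[OF assms]]
  have 1: "\<mu> ^ (m * b * c) * \<mu> powi (- int (m * b * c)) = 1"
    "(\<mu> ^ (a * c)) ^ n * \<mu> powi (- int (n * a * c)) = 1"
    using assms by (simp_all add: power_int_minus power_mult[symmetric] ac_simps del: of_nat_mult)
  have "tx ^ m * (cst (\<mu> ^ (m * b * c)) * scale \<mu> tu) = (cst (\<mu> ^ (b * c)) * tx) ^ m * scale \<mu> tu"
    by (simp add: power_mult_distrib cst_power power_mult[symmetric] ac_simps)
  also have "\<dots> = scale \<mu> (tx ^ m * tu)" by (simp add: h scale_xyz[OF assms])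
  also have "\<dots> = 1 + (cst (\<mu> ^ (a * c)) * ty) ^ n * (cst (\<mu> powi (- int (n * a * c))) * tv)"
    unfolding tx_tu by (simp add: h scale_xyz[OF assms] scale_tv[OF assms])
  also have "\<dots> = 1 + (cst ((\<mu> ^ (a * c)) ^ n) * cst (\<mu> powi (- int (n * a * c)))) * (ty ^ n * tv)"
    by (simp add: power_mult_distrib cst_power ac_simps)
  also have "\<dots> = tx ^ m * tu" unfolding cst_mult 1 tx_tu by (simp add: cst_1)
  finally have "cst (\<mu> ^ (m * b * c)) * scale \<mu> tu = tu" using txyz_nz by simp
  hence A: "cst (\<mu> powi (- int (m * b * c))) * (cst (\<mu> ^ (m * b * c)) * scale \<mu> tu)
      = cst (\<mu> powi (- int (m * b * c))) * tu" by simp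
  have B: "cst (\<mu> powi (- int (m * b * c))) * (cst (\<mu> ^ (m * b * c)) * scale \<mu> tu) = scale \<mu> tu"
    unfolding mult.assoc[symmetric] cst_mult using 1(1) by (simp add: mult.commute cst_1)
  show ?thesis using A unfolding B .
qed

lemma scale_aut:
  assumes "\<mu> \<noteq> 0"
  shows "sub_aut cst thr (scale \<mu>)"
proof -
  have gens: "scale \<nu> p \<in> thr" if "p \<in> {tv, tu, tz, ty, tx}" "\<nu> \<noteq> 0" for \<nu> p
    using that thr_gens thr_closed
    by (auto simp: scale_tv[OF that(2)] scale_tu[OF that(2)] scale_xyz[OF that(2)])
  have inv: "scale (inverse \<nu>) (scale \<nu> p) = p" if "p \<in> {tv, tu, tz, ty, tx}" "\<nu> \<noteq> 0" for \<nu> p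
  proof -
    have nu': "inverse \<nu> \<noteq> 0" using that by simp
    have "\<nu> powi k * inverse \<nu> powi k = 1" "\<nu> ^ l * inverse \<nu> ^ l = 1" for k l
      using that(2) by (simp_all flip: power_int_mult_distrib power_mult_distrib)
    thus ?thesis using that(1)
      by (auto simp: scale_tv[OF that(2)] scale_tu[OF that(2)] scale_xyz[OF that(2)] scale_cst[OF nu']
          scale_tv[OF nu'] scale_tu[OF nu'] scale_xyz[OF nu'] rhomD[OF rhom_scale[OF nu']]
          cst_mult_assoc cst_1)
  qed
  show ?thesis unfolding thr_eq_subalg
    by (rule sub_aut_of_rhom[of _ "scale (inverse \<mu>)"])
      (use assms gens[OF _ assms] gens[of _ "inverse \<mu>"] inv[of _ \<mu>] inv[of _ "inverse \<mu>"]
        in \<open>simp_all add: rhom_scale rhom_cst scale_cst thr_eq_subalg\<close>)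
qed

subsection \<open>Automorphisms preserve the surface\<close>

text \<open>What Mason--Stothers leaves open are monomials of positive degree in v. A positive
  exponent for x forces one for y, and then the preserved relation would read 0 = 1 at v =
  0.\<close>

lemma aut_preserves_surf:
  assumes aut: "sub_aut cst thr s" and p: "p \<in> surf"
  shows "\<exists>q\<in>surf. s (lft p) = lft q"
proof -
  note ctx = rhom_cst aut thr_eq_subalg
  note hom = sub_aut_add[OF ctx] sub_aut_mult[OF ctx] sub_aut_const[OF ctx] sub_aut_power[OF ctx]
    sub_aut_0[OF ctx] sub_aut_1[OF ctx] sub_aut_diff[OF ctx]
  have "tx ^ a + ty ^ b + tz ^ c = 0"
    using surface_equation by (simp flip: rhomD(3,5)[OF rhom_lft])
  hence "s (tx ^ a + ty ^ b + tz ^ c) = 0" by (simp add: hom)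
  hence eq: "s tx ^ a + s ty ^ b + s tz ^ c = 0" by (simp add: hom thr_gens thr_closed)
  have "s (tx ^ m * tu - ty ^ n * tv) = 1" unfolding threefold_equation by (simp add: hom)
  hence eq2: "s tx ^ m * s tu - s ty ^ n * s tv = 1" by (simp add: hom thr_gens thr_closed)
  obtain m' n' where mn: "m = Suc m'" "n = Suc n'" using mpos npos gr0_implies_Suc by metis
  have bez: "(s tx ^ m' * s tu) * s tx + (- (s ty ^ n' * s tv)) * s ty = [:0, 1:] ^ 0"
    using eq2 by (simp add: mn ac_simps)
  have nz: "s tx \<noteq> 0" "s ty \<noteq> 0" "s tz \<noteq> 0"
    using sub_aut_nz[OF ctx] thr_gens txyz_nz by auto
  obtain \<xi> \<eta> \<theta> i j k where mon: "s tx = monom \<xi> i" "s ty = monom \<eta> j" "s tz = monom \<theta> k"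
    and ij: "a * i = b * j" "b * j = c * k"
    using mason_monomials[OF eq bez nz pos hyp] .
  have "i = 0"
  proof (rule ccontr)
    assume "i \<noteq> 0"
    hence "j \<noteq> 0" using ij pos by (metis mult_is_0 neq0_conv)
    have "poly ((s tx ^ m' * s tu) * s tx + (- (s ty ^ n' * s tv)) * s ty) 0 = 0"
      unfolding mon using \<open>i \<noteq> 0\<close> \<open>j \<noteq> 0\<close> by (simp add: poly_monom zero_power)
    thus False unfolding bez by simp
  qed
  hence "j = 0" "k = 0" using ij pos by auto
  have "\<exists>q\<in>surf. s tx = lft q" "\<exists>q\<in>surf. s ty = lft q" "\<exists>q\<in>surf. s tz = lft q"
    using thr_const[OF sub_aut_in[OF ctx thr_gens(1)]] thr_const[OF sub_aut_in[OF ctx thr_gens(2)]]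
      thr_const[OF sub_aut_in[OF ctx thr_gens(3)]] mon \<open>i = 0\<close> \<open>j = 0\<close> \<open>k = 0\<close> by (simp_all add: monom_0)
  note gens = this
  from p have "p \<in> subalg scalar {sz, sy, sx}" by (simp add: surf_eq_subalg)
  thus ?thesis
  proof induction
    case (const t)
    have "s (lft (scalar t)) = lft (scalar t)" using sub_aut_const[OF ctx, of t] by (simp add: cst_def)
    thus ?case using surf_gens(4) by blast
  next
    case (gen g)
    thus ?case using gens by blast
  next
    case (add p q)
    then obtain p' q' where 1: "p' \<in> surf" "q' \<in> surf" "s (lft p) = lft p'" "s (lft q) = lft q'" by blast
    have "s (lft (p + q)) = lft (p' + q')"
      using add 1 lft_surf_in_thr by (simp add: hom rhomD[OF rhom_lft] surf_eq_subalg)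
    thus ?case using 1 surf_add by blast
  next
    case (mult p q)
    then obtain p' q' where 1: "p' \<in> surf" "q' \<in> surf" "s (lft p) = lft p'" "s (lft q) = lft q'" by blast
    have "s (lft (p * q)) = lft (p' * q')"
      using mult 1 lft_surf_in_thr by (simp add: hom rhomD[OF rhom_lft] surf_eq_subalg)
    thus ?case using 1 surf_mult by blast
  qed
qed

text \<open>\<open>\<rho>\<close> is the restriction to the surface ring, read through
  \<open>lft\<close>. It is onto because the inverse automorphism preserves the surface ring as
  well.\<close>

lemma aut_scaling:
  assumes aut: "sub_aut cst thr s"
  obtains \<mu> where "\<mu> \<noteq> 0" "s tx = cst (\<mu> ^ (b * c)) * tx" "s ty = cst (\<mu> ^ (a * c)) * ty"
    "s tz = cst (\<mu> ^ (a * b)) * tz"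
proof -
  note ctx = rhom_cst aut thr_eq_subalg
  define \<rho> where "\<rho> = (\<lambda>p. SOME q. q \<in> surf \<and> s (lft p) = lft q)"
  have \<rho>: "\<rho> p \<in> surf" "s (lft p) = lft (\<rho> p)" if p: "p \<in> surf" for p
  proof -
    have "\<rho> p \<in> surf \<and> s (lft p) = lft (\<rho> p)"
      unfolding \<rho>_def by (rule someI_ex) (use aut_preserves_surf[OF aut p] in blast)
    thus "\<rho> p \<in> surf" "s (lft p) = lft (\<rho> p)" by auto
  qed
  have "sub_aut scalar surf \<rho>"
    unfolding sub_aut_def
  proof (intro conjI allI ballI)
    show "bij_betw \<rho> surf surf" unfolding bij_betw_def
    proof
      show "inj_on \<rho> surf"
      proof (rule inj_onI)
        fix p q assume pq: "p \<in> surf" "q \<in> surf" "\<rho> p = \<rho> q"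
        hence "s (lft p) = s (lft q)" using \<rho> by simp
        hence "lft p = lft q" using sub_aut_inj[OF ctx] lft_surf_in_thr pq by blast
        thus "p = q" by simp
      qed
      have "q \<in> \<rho> ` surf" if q: "q \<in> surf" for q
      proof -
        obtain p where p: "p \<in> surf" "inv_into thr s (lft q) = lft p"
          using aut_preserves_surf[OF sub_aut_inv[OF ctx] q] by blast
        have "bij_betw s thr thr" using aut unfolding sub_aut_def by simp
        hence "s (lft p) = lft q"
          unfolding p(2)[symmetric] using bij_betw_inv_into_right lft_surf_in_thr[OF q] by fast
        hence "q = \<rho> p" using \<rho>[OF p(1)] by simp
        thus ?thesis using p(1) by blast
      qed
      thus "\<rho> ` surf = surf" using \<rho>(1) by blast
    qed
    show "\<rho> (scalar t) = scalar t" for t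
      using \<rho>(2)[OF surf_gens(4)[of t]] sub_aut_const[OF ctx, of t] by (simp add: cst_def)
    fix p q assume pq: "p \<in> surf" "q \<in> surf"
    have "lft (\<rho> (p + q)) = lft (\<rho> p + \<rho> q)" "lft (\<rho> (p * q)) = lft (\<rho> p * \<rho> q)"
      using pq \<rho>(2) surf_add surf_mult sub_aut_add[OF ctx] sub_aut_mult[OF ctx] lft_surf_in_thr
      by (simp_all add: rhomD[OF rhom_lft] flip: \<rho>(2))
    thus "\<rho> (p + q) = \<rho> p + \<rho> q" "\<rho> (p * q) = \<rho> p * \<rho> q" by simp_all
  qed
  then obtain \<mu> where "\<mu> \<noteq> 0" "\<rho> sx = scalar (\<mu> ^ (b * c)) * sx"
    "\<rho> sy = scalar (\<mu> ^ (a * c)) * sy" "\<rho> sz = scalar (\<mu> ^ (a * b)) * sz"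
    by (rule surf_aut_scaling)
  thus thesis using that[of \<mu>] \<rho>(2) surf_gens by (simp add: rhomD[OF rhom_lft] cst_def)
qed

subsection \<open>Automorphisms that fix the surface\<close>

text \<open>Put Du = s u - u and Dv = s v - v. The preserved relation gives x^m Du = y^n Dv, and
  with x^m u - y^n v = 1 the determinant f = u Dv - v Du satisfies f y^n = Du and f x^m = Dv. No
  division occurs, so f stays in the algebra.\<close>

lemma aut_fix_shear_form:
  assumes aut: "sub_aut cst thr s" and xyz: "s tx = tx" "s ty = ty" "s tz = tz"
  defines "f \<equiv> tu * (s tv - tv) - tv * (s tu - tu)"
  shows "f \<in> thr" "s tu = tu + f * ty ^ n" "s tv = tv + f * tx ^ m"
proof -
  note ctx = rhom_cst aut thr_eq_subalg
  show "f \<in> thr" unfolding f_def by (intro thr_closed sub_aut_in[OF ctx] thr_gens)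
  have "s (tx ^ m * tu - ty ^ n * tv) = 1" unfolding threefold_equation by (rule sub_aut_1[OF ctx])
  hence eq: "tx ^ m * s tu - ty ^ n * s tv = 1"
    by (simp add: sub_aut_diff[OF ctx] sub_aut_mult[OF ctx] sub_aut_power[OF ctx] thr_gens thr_closed xyz)
  have "f * ty ^ n = tu * (ty ^ n * s tv - ty ^ n * tv) - (ty ^ n * tv) * (s tu - tu)"
    unfolding f_def by (simp add: algebra_simps)
  also have "ty ^ n * s tv = tx ^ m * s tu - 1" using eq by (simp add: algebra_simps)
  also have "tu * (tx ^ m * s tu - 1 - ty ^ n * tv) - (ty ^ n * tv) * (s tu - tu) = s tu - tu"
    unfolding ty_tv by (simp add: algebra_simps)
  finally show "s tu = tu + f * ty ^ n" by simp
  have "f * tx ^ m = (tx ^ m * tu) * (s tv - tv) - tv * (tx ^ m * s tu - tx ^ m * tu)"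
    unfolding f_def by (simp add: algebra_simps)
  also have "tx ^ m * s tu = 1 + ty ^ n * s tv" using eq by (simp add: algebra_simps)
  also have "(tx ^ m * tu) * (s tv - tv) - tv * (1 + ty ^ n * s tv - tx ^ m * tu) = s tv - tv"
    unfolding tx_tu by (simp add: algebra_simps)
  finally show "s tv = tv + f * tx ^ m" by simp
qed

lemma aut_fix_lft:
  assumes aut: "sub_aut cst thr s" and xyz: "s tx = tx" "s ty = ty" "s tz = tz" and p: "p \<in> surf"
  shows "s (lft p) = lft p"
proof -
  note ctx = rhom_cst aut thr_eq_subalg
  from p have "p \<in> subalg scalar {sz, sy, sx}" by (simp add: surf_eq_subalg)
  thus ?thesis
  proof induction
    case (const t)
    show ?case using sub_aut_const[OF ctx, of t] by (simp add: cst_def)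
  next
    case (gen g)
    thus ?case using xyz by auto
  next
    case (add p q)
    thus ?case using lft_surf_in_thr by (simp add: rhomD[OF rhom_lft] sub_aut_add[OF ctx] surf_eq_subalg)
  next
    case (mult p q)
    thus ?case using lft_surf_in_thr by (simp add: rhomD[OF rhom_lft] sub_aut_mult[OF ctx] surf_eq_subalg)
  qed
qed

lemma aut_fix_eval:
  assumes aut: "sub_aut cst thr s" and xyz: "s tx = tx" "s ty = ty" "s tz = tz"
    and "r \<in> polys_over surf"
  shows "eval_poly lft tv r \<in> thr \<and> s (eval_poly lft tv r) = eval_poly lft (s tv) r"
  using assms(5)
proof (induction r)
  case 0
  show ?case using sub_aut_0[OF rhom_cst aut thr_eq_subalg] by (simp add: thr_closed)
next
  case (pCons k r)
  note ctx = rhom_cst aut thr_eq_subalg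
  have k: "k \<in> surf" and IH: "eval_poly lft tv r \<in> thr" "s (eval_poly lft tv r) = eval_poly lft (s tv) r"
    using pCons by (auto simp: pCons_in_polys_over)
  have "lft k \<in> thr" using lft_surf_in_thr[OF k] .
  thus ?case unfolding eval_poly_pCons[OF rhom_lft] using IH aut_fix_lft[OF aut xyz k]
    by (simp add: thr_closed thr_gens sub_aut_add[OF ctx] sub_aut_mult[OF ctx])
qed

text \<open>Let p be the preimage of v and write x^N p = q(v) with coefficients in the surface ring.
  Applying s gives x^N v = q(s v). Degrees multiply under composition, so q and s v are both linear,
  and their leading coefficients multiply to x^N.\<close>

lemma aut_fix_linear:
  assumes aut: "sub_aut cst thr s" and xyz: "s tx = tx" "s ty = ty" "s tz = tz"
  shows "degree (s tv) = 1" "degree (inv_into thr s tv) \<le> 1"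
    "coeff (s tv) 1 * coeff (inv_into thr s tv) 1 = 1"
proof -
  note ctx = rhom_cst aut thr_eq_subalg
  have bij: "bij_betw s thr thr" using aut unfolding sub_aut_def by simp
  define p where "p = inv_into thr s tv"
  have p: "p \<in> thr" unfolding p_def using sub_aut_in[OF rhom_cst sub_aut_inv[OF ctx] thr_eq_subalg] thr_gens by blast
  have sp: "s p = tv" unfolding p_def using bij_betw_inv_into_right[OF bij thr_gens(5)] .
  obtain N q where q: "q \<in> polys_over surf" "tx ^ N * p = eval_poly lft tv q" using clear_tx[OF p] by blast
  have "s (tx ^ N * p) = tx ^ N * tv"
    by (simp add: sub_aut_mult[OF ctx] sub_aut_power[OF ctx] thr_gens thr_closed p sp xyz)
  hence "tx ^ N * tv = eval_poly lft (s tv) q" using aut_fix_eval[OF aut xyz q(1)] q(2) by simp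
  hence comp: "[:0, emb sx ^ N:] = pcompose (map_poly emb q) (s tv)"
    by (simp add: eval_poly_lft lft_power tv_def)
  have "degree [:0, emb sx ^ N:] = 1" using sx_nz by simp
  hence "degree q * degree (s tv) = 1" unfolding comp by (simp add: degree_pcompose degree_map_emb)
  hence dq: "degree q = 1" and ds: "degree (s tv) = 1" by simp_all
  show "degree (s tv) = 1" by (fact ds)
  have "degree (tx ^ N * p) = degree p"
    by (cases "p = 0") (simp_all add: degree_mult_eq lft_power sx_nz)
  hence "degree p = degree (map_poly emb q)" unfolding q(2) eval_poly_lft tv_def by simp
  thus "degree (inv_into thr s tv) \<le> 1" using dq by (simp add: degree_map_emb p_def)
  obtain q0 q1 where q01: "q = [:q0, q1:]" using dq degree1_coeffs by blast
  have "emb sx ^ N = coeff (pcompose (map_poly emb q) (s tv)) 1" unfolding comp[symmetric] by simp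
  also have "\<dots> = emb q1 * coeff (s tv) 1"
    unfolding q01 eval_poly_lft[symmetric] eval_poly_pCons[OF rhom_lft] by (simp add: lft_def)
  finally have 1: "emb sx ^ N = emb q1 * coeff (s tv) 1" .
  have 2: "emb sx ^ N * coeff p 1 = emb q1"
    using coeff_lft_power_mult[of sx N p 1] unfolding q(2) coeff_eval_poly_tv by (simp add: q01)
  have "emb sx ^ N * (coeff (s tv) 1 * coeff p 1) = (emb sx ^ N * coeff p 1) * coeff (s tv) 1"
    by (simp only: ac_simps)
  also have "\<dots> = emb sx ^ N * 1" unfolding 2 using 1 by simp
  finally have "emb sx ^ N * (coeff (s tv) 1 * coeff p 1) = emb sx ^ N * 1" .
  thus "coeff (s tv) 1 * coeff (inv_into thr s tv) 1 = 1" unfolding p_def using sx_nz by simp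
qed

text \<open>From x^m f = s v - v, the leading coefficient of s v is 1 plus x^m times that of f,
  hence lies in the surface ring. Assuming just a degree bound lets the lemma serve the inverse
  automorphism too.\<close>

lemma aut_fix_leading:
  assumes aut: "sub_aut cst thr s" and xyz: "s tx = tx" "s ty = ty" "s tz = tz" and "degree (s tv) \<le> 1"
  defines "f \<equiv> tu * (s tv - tv) - tv * (s tu - tu)"
  shows "degree f \<le> 1" "\<exists>g\<in>surf. emb sx ^ m * coeff f 1 = emb g \<and> coeff (s tv) 1 = emb (1 + g)"
proof -
  note sf = aut_fix_shear_form[OF aut xyz, folded f_def]
  have e: "tx ^ m * f = s tv - tv" using sf(3) by simp
  have "degree (tx ^ m * f) = degree f"
    by (cases "f = 0") (simp_all add: degree_mult_eq lft_power sx_nz)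
  moreover have "degree (s tv - tv) \<le> 1" using assms(5) by (intro degree_diff_le) (simp_all add: tv_def)
  ultimately show d: "degree f \<le> 1" using e by simp
  obtain g where g: "g \<in> surf" "emb sx ^ m * coeff f 1 = emb g" using thr_linear_coeff[OF sf(1) d] by blast
  have "emb sx ^ m * coeff f 1 = coeff (s tv) 1 - 1"
    using coeff_lft_power_mult[of sx m f 1] unfolding e by (simp add: tv_def)
  hence "coeff (s tv) 1 = emb (1 + g)" using g by (simp add: rhomD[OF rhom_emb] algebra_simps)
  thus "\<exists>g\<in>surf. emb sx ^ m * coeff f 1 = emb g \<and> coeff (s tv) 1 = emb (1 + g)" using g by blast
qed

text \<open>Both x and y vanish at w = 0, so the defining relation of the threefold has no solution
  over the surface ring.\<close>

lemma no_unimodular_row: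
  assumes "p \<in> surf" "q \<in> surf"
  shows "sx ^ m * p - sy ^ n * q \<noteq> 1"
proof
  assume "sx ^ m * p - sy ^ n * q = 1"
  hence "poly (sx ^ m * p - sy ^ n * q) 0 = poly 1 0" by simp
  thus False using pos mpos npos by (simp add: sx_def sy_def poly_monom zero_power)
qed

text \<open>
  The coefficient \<open>\<alpha>\<close> of \<open>s v = \<alpha> v + \<beta>\<close> is a unit of the surface ring, hence a constant
  \<open>1 + \<kappa>\<close>. If \<open>\<kappa> \<noteq> 0\<close>, then \<open>\<sigma> = f / \<kappa>\<close> is a slice of the derivation \<open>x\<^sup>m \<partial>/\<partial>v\<close>, and
  subtracting multiples of it from \<open>u, v\<close> solves \<open>x\<^sup>m u\<^sub>0 - y\<^sup>n v\<^sub>0 = 1\<close> in the surface ring.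
\<close>

lemma aut_fix_is_shear:
  assumes aut: "sub_aut cst thr s" and xyz: "s tx = tx" "s ty = ty" "s tz = tz"
  obtains f where "f \<in> surf" "s tu = tu + lft f * ty ^ n" "s tv = tv + lft f * tx ^ m"
proof -
  note ctx = rhom_cst aut thr_eq_subalg
  define s' where "s' = inv_into thr s"
  have aut': "sub_aut cst thr s'" unfolding s'_def by (rule sub_aut_inv[OF ctx])
  have bij: "bij_betw s thr thr" using aut unfolding sub_aut_def by simp
  have xyz': "s' tx = tx" "s' ty = ty" "s' tz = tz"
    using bij_betw_inv_into_left[OF bij] thr_gens xyz unfolding s'_def by metis+
  define f where "f = tu * (s tv - tv) - tv * (s tu - tu)"
  note sf = aut_fix_shear_form[OF aut xyz, folded f_def]
  note lin = aut_fix_linear[OF aut xyz, folded s'_def]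
  have ds: "degree (s tv) \<le> 1" using lin(1) by simp
  note df = aut_fix_leading(1)[OF aut xyz ds, folded f_def]
  obtain g where g: "g \<in> surf" "emb sx ^ m * coeff f 1 = emb g" "coeff (s tv) 1 = emb (1 + g)"
    using aut_fix_leading(2)[OF aut xyz ds, folded f_def] by blast
  obtain g' where g': "g' \<in> surf" "coeff (s' tv) 1 = emb (1 + g')"
    using aut_fix_leading(2)[OF aut' xyz' lin(2)] by blast
  have "emb ((1 + g) * (1 + g')) = emb 1"
    using lin(3) g(3) g'(2) by (simp add: rhomD[OF rhom_emb])
  hence unit: "(1 + g) * (1 + g') = 1" by simp
  \<comment> \<open>A unit has degree 0 in w. The weight-0 part of the surface ring consists of
    complex scalars, although the ambient coefficients are Laurent series.\<close>
  hence "degree (1 + g) + degree (1 + g') = 0" using degree_mult_eq[of "1 + g" "1 + g'"] by fastforce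
  then obtain \<xi> where \<xi>: "1 + g = monom \<xi> 0" by (metis add_is_0 degree_eq_zeroE monom_0)
  moreover have "1 + g \<in> surf" using g surf_01 surf_add by blast
  ultimately obtain t where t: "1 + g = scalar t" using surf_homogeneous(4) by metis
  define \<kappa> where "\<kappa> = t - 1"
  have "g = scalar t - 1" using t by (simp add: algebra_simps)
  hence g\<kappa>: "g = scalar \<kappa>" by (simp add: \<kappa>_def rhomD[OF rhom_scalar])
  have "\<kappa> = 0"
  proof (rule ccontr)
    assume nz: "\<kappa> \<noteq> 0"
    define \<sigma> where "\<sigma> = cst (inverse \<kappa>) * f"
    have \<sigma>: "\<sigma> \<in> thr" unfolding \<sigma>_def by (intro thr_closed sf)
    have "emb sx ^ m * coeff \<sigma> 1 = emb (scalar (inverse \<kappa>)) * (emb sx ^ m * coeff f 1)"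
      by (simp add: \<sigma>_def cst_def lft_def)
    also have "\<dots> = emb (scalar (inverse \<kappa> * \<kappa>))" unfolding g g\<kappa> by (simp add: rhomD[OF rhom_emb] rhomD[OF rhom_scalar])
    finally have c\<sigma>: "emb sx ^ m * coeff \<sigma> 1 = 1" using nz by (simp add: rhomD[OF rhom_emb] rhomD[OF rhom_scalar])
    have d\<sigma>: "degree \<sigma> \<le> 1" unfolding \<sigma>_def cst_def using degree_lft_power_mult_le[of "scalar (inverse \<kappa>)" 1 f] df by simp
    define v0 where "v0 = tv - tx ^ m * \<sigma>"
    define u0 where "u0 = tu - ty ^ n * \<sigma>"
    have "degree v0 \<le> 1" unfolding v0_def
      using degree_lft_power_mult_le[of sx m \<sigma>] d\<sigma> by (intro degree_diff_le) (simp_all add: tv_def)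
    moreover have "coeff v0 1 = 0" unfolding v0_def using c\<sigma> by (simp add: coeff_lft_power_mult tv_def)
    ultimately have dv: "degree v0 = 0" by (metis degree_0 le_neq_implies_less leading_coeff_0_iff less_one)
    have eq: "tx ^ m * u0 = 1 + ty ^ n * v0"
      unfolding u0_def v0_def right_diff_distrib tx_tu by (simp add: ac_simps)
    have "degree (tx ^ m * u0) = degree u0"
      by (cases "u0 = 0") (simp_all add: degree_mult_eq lft_power sx_nz)
    moreover have "degree (1 + ty ^ n * v0) \<le> 0"
      using degree_lft_power_mult_le[of sy n v0] dv by (intro degree_add_le) simp_all
    ultimately have du: "degree u0 = 0" using eq by simp
    have "v0 \<in> thr" "u0 \<in> thr" unfolding u0_def v0_def by (intro thr_closed thr_gens \<sigma>)+
    then obtain p q where pq: "p \<in> surf" "q \<in> surf" "u0 = lft p" "v0 = lft q" using thr_const dv du by metis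
    have "lft (sx ^ m * p - sy ^ n * q) = lft 1"
      using eq unfolding pq by (simp add: rhomD[OF rhom_lft])
    hence "sx ^ m * p - sy ^ n * q = 1" by simp
    thus False using no_unimodular_row[OF pq(1,2)] by simp
  qed
  hence "coeff f 1 = 0" using g(2) g\<kappa> sx_nz by (simp add: rhomD[OF rhom_emb] rhomD[OF rhom_scalar])
  hence "degree f = 0" using df by (metis degree_0 le_neq_implies_less leading_coeff_0_iff less_one)
  then obtain f0 where "f0 \<in> surf" "f = lft f0" using thr_const[OF sf(1)] by blast
  thus thesis using that sf by blast
qed

theorem thr_aut_decomposition:
  assumes aut: "sub_aut cst thr s"
  obtains \<mu> f where "\<mu> \<noteq> 0" "f \<in> surf" "\<And>p. p \<in> thr \<Longrightarrow> s p = scale \<mu> (shear f p)"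
proof -
  obtain \<mu> where \<mu>: "\<mu> \<noteq> 0" "s tx = cst (\<mu> ^ (b * c)) * tx" "s ty = cst (\<mu> ^ (a * c)) * ty"
    "s tz = cst (\<mu> ^ (a * b)) * tz" by (rule aut_scaling[OF aut])
  note sc = scale_aut[OF \<mu>(1)]
  note ctx = rhom_cst sc thr_eq_subalg
  define k where "k = inv_into thr (scale \<mu>)"
  have k: "sub_aut cst thr k" unfolding k_def by (rule sub_aut_inv[OF ctx])
  have bij: "bij_betw (scale \<mu>) thr thr" using sc unfolding sub_aut_def by simp
  have inv: "k (scale \<mu> p) = p" "scale \<mu> (k p) = p" if "p \<in> thr" for p
    unfolding k_def using bij_betw_inv_into_left[OF bij that] bij_betw_inv_into_right[OF bij that] .
  have ks: "sub_aut cst thr (\<lambda>p. k (s p))" by (rule sub_aut_comp[OF k aut])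
  have xyz: "k (s tx) = tx" "k (s ty) = ty" "k (s tz) = tz"
    using inv thr_gens scale_xyz[OF \<mu>(1)] \<mu> by metis+
  obtain f where f: "f \<in> surf" "k (s tu) = tu + lft f * ty ^ n" "k (s tv) = tv + lft f * tx ^ m"
    using aut_fix_is_shear[OF ks xyz] .
  have "s p = scale \<mu> (shear f p)" if p: "p \<in> thr" for p
  proof -
    have "k (s p) = shear f p"
      by (rule sub_aut_eqI[OF rhom_cst ks thr_eq_subalg shear_aut[OF f(1)] _ p])
        (auto simp: xyz f shear_tu shear_tv shear_lft)
    moreover have "s p \<in> thr" using sub_aut_in[OF rhom_cst aut thr_eq_subalg p] .
    ultimately show ?thesis using inv(2) by metis
  qed
  thus thesis using that \<mu>(1) f(1) by blast
qed

end


section \<open>Realising quotients of polynomial rings inside types\<close>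

text \<open>The bridge from the carrier-based rings of the statement to concrete subsets of types,
  where arithmetic is that of type classes.\<close>

definition embeds :: "('s, 'm) ring_scheme \<Rightarrow> ('s \<Rightarrow> 'b::comm_ring_1) \<Rightarrow> 'b set \<Rightarrow> bool"
  where "embeds S h B \<longleftrightarrow> cring S \<and> bij_betw h (carrier S) B \<and> h \<one>\<^bsub>S\<^esub> = 1 \<and>
    (\<forall>p\<in>carrier S. \<forall>q\<in>carrier S. h (p \<oplus>\<^bsub>S\<^esub> q) = h p + h q \<and> h (p \<otimes>\<^bsub>S\<^esub> q) = h p * h q)"

context
  fixes S :: "('s, 'm) ring_scheme" (structure) and h :: "'s \<Rightarrow> 'b::comm_ring_1" and B
  assumes emb: "embeds S h B"
begin

lemma embeds_cring: "cring S"
  using emb by (simp add: embeds_def)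

lemma embeds_add: "p \<in> carrier S \<Longrightarrow> q \<in> carrier S \<Longrightarrow> h (p \<oplus> q) = h p + h q"
  and embeds_mult: "p \<in> carrier S \<Longrightarrow> q \<in> carrier S \<Longrightarrow> h (p \<otimes> q) = h p * h q"
  and embeds_one: "h \<one> = 1"
  using emb by (simp_all add: embeds_def)

lemma embeds_in: "p \<in> carrier S \<Longrightarrow> h p \<in> B"
  using emb by (auto simp: embeds_def dest: bij_betwE)

lemma embeds_inj: "p \<in> carrier S \<Longrightarrow> q \<in> carrier S \<Longrightarrow> h p = h q \<longleftrightarrow> p = q"
  using emb by (auto simp: embeds_def bij_betw_def dest: inj_onD)

lemma embeds_surj: "e \<in> B \<Longrightarrow> \<exists>p\<in>carrier S. e = h p"
  using emb by (auto simp: embeds_def bij_betw_def)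

lemma embeds_zero: "h \<zero> = 0"
proof -
  interpret cring S by (rule embeds_cring)
  have "h \<zero> + h \<zero> = h \<zero>" by (simp flip: embeds_add)
  thus ?thesis by simp
qed

lemma embeds_minus:
  assumes "p \<in> carrier S" "q \<in> carrier S"
  shows "h (p \<ominus> q) = h p - h q"
proof -
  interpret cring S by (rule embeds_cring)
  have "h (p \<ominus> q) + h q = h (p \<ominus> q \<oplus> q)" using assms by (simp add: embeds_add)
  also have "p \<ominus> q \<oplus> q = p" using assms by algebra
  finally show ?thesis by (simp add: algebra_simps)
qed

lemma embeds_power:
  assumes "p \<in> carrier S"
  shows "h (p [^] (k::nat)) = h p ^ k"
proof -
  interpret cring S by (rule embeds_cring)
  show ?thesis using assms by (induction k) (simp_all add: embeds_one embeds_mult mult.commute)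
qed

lemma embeds_finsum:
  assumes "finite A" "f \<in> A \<rightarrow> carrier S"
  shows "h (finsum S f A) = (\<Sum>i\<in>A. h (f i))"
proof -
  interpret cring S by (rule embeds_cring)
  show ?thesis using assms
  proof (induction A rule: finite_induct)
    case (insert i A)
    hence "f i \<in> carrier S" "f \<in> A \<rightarrow> carrier S" by auto
    thus ?case using insert by (simp add: embeds_add)
  qed (simp add: embeds_zero)
qed

end

lemma embeds_type_algebra: "embeds (ring_of_type_algebra :: complex ring) id UNIV"
  unfolding embeds_def using cring_from_type_algebra[where ?'a = complex]
  by (simp add: ring_of_type_algebra_def)

section \<open>Polynomial rings and principal quotients along an embedding\<close>

definition up_map :: "('s \<Rightarrow> 'b::comm_ring_1) \<Rightarrow> (nat \<Rightarrow> 's) \<Rightarrow> 'b poly"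
  where "up_map h p = Abs_poly (\<lambda>i. h (p i))"

context
  fixes S :: "('s, 'm) ring_scheme" (structure) and h :: "'s \<Rightarrow> 'b::comm_ring_1" and B
  assumes emb: "embeds S h B"
begin

lemma coeff_up_map:
  assumes "p \<in> carrier (UP S)"
  shows "coeff (up_map h p) i = h (p i)"
proof -
  obtain k where k: "bound \<zero> k p" using assms by (auto simp: UP_def up_def)
  have "\<forall>\<^sub>\<infinity>i. h (p i) = 0"
    unfolding MOST_nat using bound.bound[OF k] embeds_zero[OF emb] by (intro exI[of _ k]) auto
  thus ?thesis unfolding up_map_def by (simp add: Abs_poly_inverse)
qed

lemma UP_carrierD: "p \<in> carrier (UP S) \<Longrightarrow> p i \<in> carrier S"
  by (auto simp: UP_def up_def)

lemma UP_ops: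
  "\<one>\<^bsub>UP S\<^esub> = (\<lambda>i. if i = 0 then \<one> else \<zero>)"
  "p \<in> carrier (UP S) \<Longrightarrow> q \<in> carrier (UP S) \<Longrightarrow> p \<oplus>\<^bsub>UP S\<^esub> q = (\<lambda>i. p i \<oplus> q i)"
  "p \<in> carrier (UP S) \<Longrightarrow> q \<in> carrier (UP S) \<Longrightarrow>
    p \<otimes>\<^bsub>UP S\<^esub> q = (\<lambda>k. \<Oplus>i\<in>{..k}. p i \<otimes> q (k - i))"
  by (simp_all add: UP_def)

lemma embeds_UP: "embeds (UP S) (up_map h) (polys_over B)"
  unfolding embeds_def
proof (intro conjI ballI)
  interpret S: cring S by (rule embeds_cring[OF emb])
  interpret P: UP_cring S "UP S" by unfold_locales simp
  show "cring (UP S)" by (rule P.UP_cring)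
  note [simp] = coeff_up_map
  show "bij_betw (up_map h) (carrier (UP S)) (polys_over B)"
    unfolding bij_betw_def
  proof
    show "inj_on (up_map h) (carrier (UP S))"
    proof (rule inj_onI)
      fix p q assume pq: "p \<in> carrier (UP S)" "q \<in> carrier (UP S)" "up_map h p = up_map h q"
      show "p = q"
      proof
        fix i
        have "h (p i) = h (q i)" using pq(3) pq(1,2)[THEN coeff_up_map, of i] by simp
        thus "p i = q i" using embeds_inj[OF emb] UP_carrierD pq by blast
      qed
    qed
    show "up_map h ` carrier (UP S) = polys_over B"
    proof
      show "up_map h ` carrier (UP S) \<subseteq> polys_over B"
        using embeds_in[OF emb UP_carrierD] by (auto simp: polys_over_def)
      show "polys_over B \<subseteq> up_map h ` carrier (UP S)"
      proof
        fix r assume r: "r \<in> polys_over B"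
        define p where "p = (\<lambda>i. inv_into (carrier S) h (coeff r i))"
        have im: "h ` carrier S = B" and inj: "inj_on h (carrier S)"
          using emb by (auto simp: embeds_def bij_betw_def)
        have p: "p i \<in> carrier S" "h (p i) = coeff r i" for i
          unfolding p_def using r im by (auto simp: polys_over_def intro: inv_into_into f_inv_into_f)
        have "p i = \<zero>" if "i > degree r" for i
          using p[of i] that embeds_inj[OF emb p(1)[of i] S.zero_closed] embeds_zero[OF emb] by (simp add: coeff_eq_0)
        hence "bound \<zero> (degree r) p" by (intro bound.intro) auto
        hence pc: "p \<in> carrier (UP S)" using p(1) by (auto simp: UP_def up_def)
        have "r = up_map h p" by (rule poly_eqI) (simp add: pc p(2))
        thus "r \<in> up_map h ` carrier (UP S)" using pc by blast
      qed
    qed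
  qed
  note one = UP_ops(1)
  show "up_map h \<one>\<^bsub>UP S\<^esub> = 1"
    by (rule poly_eqI) (simp add: P.P.one_closed, simp add: one embeds_one[OF emb] embeds_zero[OF emb])
  fix p q assume pq: "p \<in> carrier (UP S)" "q \<in> carrier (UP S)"
  hence pqc: "p i \<in> carrier S" "q i \<in> carrier S" for i by (simp_all add: UP_carrierD)
  note add = UP_ops(2)[OF pq]
  show "up_map h (p \<oplus>\<^bsub>UP S\<^esub> q) = up_map h p + up_map h q"
    by (rule poly_eqI) (simp add: pq P.P.add.m_closed, simp add: add embeds_add[OF emb] pq pqc)
  note mult = UP_ops(3)[OF pq]
  show "up_map h (p \<otimes>\<^bsub>UP S\<^esub> q) = up_map h p * up_map h q"
  proof (rule poly_eqI)
    fix k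
    have "coeff (up_map h (p \<otimes>\<^bsub>UP S\<^esub> q)) k = h (\<Oplus>i\<in>{..k}. p i \<otimes> q (k - i))"
      by (simp add: pq P.P.m_closed) (simp add: mult)
    also have "\<dots> = (\<Sum>i\<le>k. h (p i) * h (q (k - i)))"
      by (subst embeds_finsum[OF emb]) (auto simp: pqc embeds_mult[OF emb])
    finally show "coeff (up_map h (p \<otimes>\<^bsub>UP S\<^esub> q)) k = coeff (up_map h p * up_map h q) k"
      by (simp add: coeff_mult pq)
  qed
qed

lemma up_const_closed: "s \<in> carrier S \<Longrightarrow> up_const S s \<in> carrier (UP S)"
  and up_var_closed: "up_var S \<in> carrier (UP S)"
proof -
  interpret S: cring S by (rule embeds_cring[OF emb])
  interpret P: UP_cring S "UP S" by unfold_locales simp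
  show "s \<in> carrier S \<Longrightarrow> up_const S s \<in> carrier (UP S)" "up_var S \<in> carrier (UP S)"
    unfolding up_const_def up_var_def by (simp_all add: P.monom_closed)
qed

lemma up_map_const: "s \<in> carrier S \<Longrightarrow> up_map h (up_const S s) = [:h s:]"
proof -
  assume s: "s \<in> carrier S"
  have e: "up_const S s = (\<lambda>i. if i = 0 then s else \<zero>)" using s by (simp add: up_const_def UP_def)
  have "coeff (up_map h (up_const S s)) i = coeff [:h s:] i" for i
    unfolding coeff_up_map[OF up_const_closed[OF s]] unfolding e
    by (simp add: coeff_pCons embeds_zero[OF emb] split: nat.splits)
  thus ?thesis by (rule poly_eqI)
qed

lemma up_map_var: "up_map h (up_var S) = [:0, 1:]"
proof -
  interpret S: cring S by (rule embeds_cring[OF emb])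
  have e: "up_var S = (\<lambda>i. if i = 1 then \<one> else \<zero>)" by (simp add: up_var_def UP_def)
  have "coeff (up_map h (up_var S)) i = coeff [:0, 1:] i" for i
    unfolding coeff_up_map[OF up_var_closed] unfolding e
    by (simp add: coeff_pCons embeds_zero[OF emb] embeds_one[OF emb] split: nat.splits)
  thus ?thesis by (rule poly_eqI)
qed

text \<open>The first isomorphism theorem in this setting: \<open>ker\<close> says that the kernel
  of \<open>k\<close> on \<open>B\<close> is generated by the image of \<open>g\<close>. It is used
  with \<open>brieskorn\<close> for R and with \<open>relA\<close> for A.\<close>

lemma embeds_quotient:
  assumes g: "g \<in> carrier S" and k: "rhom k"
    and ker: "\<And>p. p \<in> B \<Longrightarrow> k p = 0 \<longleftrightarrow> (\<exists>q\<in>B. p = q * h g)"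
  obtains h' where "embeds (S Quot PIdl g) h' (k ` B)"
    "\<And>p. p \<in> carrier S \<Longrightarrow> PIdl g +> p \<in> carrier (S Quot PIdl g) \<and> h' (PIdl g +> p) = k (h p)"
proof -
  interpret S: cring S by (rule embeds_cring[OF emb])
  interpret I: ideal "PIdl g" S by (rule S.cgenideal_ideal[OF g])
  note hom = I.rcos_ring_hom
  have mem: "p \<in> PIdl g \<longleftrightarrow> k (h p) = 0" if p: "p \<in> carrier S" for p
  proof -
    have "k (h p) = 0 \<longleftrightarrow> (\<exists>q\<in>B. h p = q * h g)" using ker embeds_in[OF emb p] by simp
    also have "\<dots> \<longleftrightarrow> (\<exists>r\<in>carrier S. h p = h r * h g)"
      using embeds_surj[OF emb] embeds_in[OF emb] by fast
    also have "\<dots> \<longleftrightarrow> (\<exists>r\<in>carrier S. p = r \<otimes> g)"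
      using embeds_inj[OF emb p] g by (intro bex_cong refl) (simp add: embeds_mult[OF emb, symmetric])
    also have "\<dots> \<longleftrightarrow> p \<in> PIdl g" unfolding cgenideal_def by blast
    finally show ?thesis by (rule sym)
  qed
  have eq: "PIdl g +> p = PIdl g +> q \<longleftrightarrow> k (h p) = k (h q)" if pq: "p \<in> carrier S" "q \<in> carrier S" for p q
    using S.quotient_eq_iff_same_a_r_cos[OF I.ideal_axioms pq] mem[of "p \<ominus> q"] pq
    by (simp add: embeds_minus[OF emb] rhomD[OF k])
  have cls: "PIdl g +> p \<in> carrier (S Quot PIdl g)" if "p \<in> carrier S" for p
    using ring_hom_closed[OF hom that] .
  have rep: "\<exists>p\<in>carrier S. C = PIdl g +> p" if "C \<in> carrier (S Quot PIdl g)" for C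
    using that by (auto simp: FactRing_def A_RCOSETS_def')
  define h' where "h' = (\<lambda>C. k (h (SOME p. p \<in> carrier S \<and> C = PIdl g +> p)))"
  have h': "h' (PIdl g +> p) = k (h p)" if p: "p \<in> carrier S" for p
  proof -
    define q where "q = (SOME q. q \<in> carrier S \<and> PIdl g +> p = PIdl g +> q)"
    have "q \<in> carrier S \<and> PIdl g +> p = PIdl g +> q"
      unfolding q_def by (rule someI[of _ p]) (simp add: p)
    thus ?thesis using eq[OF p, of q] by (simp add: h'_def q_def)
  qed
  have "embeds (S Quot PIdl g) h' (k ` B)"
    unfolding embeds_def
  proof (intro conjI ballI)
    show "cring (S Quot PIdl g)" by (rule I.quotient_is_cring[OF S.is_cring])
    show "bij_betw h' (carrier (S Quot PIdl g)) (k ` B)"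
      unfolding bij_betw_def
    proof
      show "inj_on h' (carrier (S Quot PIdl g))"
      proof (rule inj_onI)
        fix C D assume CD: "C \<in> carrier (S Quot PIdl g)" "D \<in> carrier (S Quot PIdl g)" "h' C = h' D"
        obtain p q where "p \<in> carrier S" "q \<in> carrier S" "C = PIdl g +> p" "D = PIdl g +> q"
          using rep[OF CD(1)] rep[OF CD(2)] by blast
        thus "C = D" using CD(3) h' eq by simp
      qed
      show "h' ` carrier (S Quot PIdl g) = k ` B"
      proof
        show "h' ` carrier (S Quot PIdl g) \<subseteq> k ` B"
        proof
          fix e assume "e \<in> h' ` carrier (S Quot PIdl g)"
          then obtain p where "p \<in> carrier S" "e = h' (PIdl g +> p)" using rep by blast
          thus "e \<in> k ` B" using h' embeds_in[OF emb] by simp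
        qed
        show "k ` B \<subseteq> h' ` carrier (S Quot PIdl g)"
        proof
          fix e assume "e \<in> k ` B"
          then obtain q where q: "q \<in> B" "e = k q" by blast
          obtain p where "p \<in> carrier S" "q = h p" using embeds_surj[OF emb q(1)] by blast
          hence "e = h' (PIdl g +> p)" "PIdl g +> p \<in> carrier (S Quot PIdl g)" using q h' cls by auto
          thus "e \<in> h' ` carrier (S Quot PIdl g)" by blast
        qed
      qed
    qed
    show "h' \<one>\<^bsub>S Quot PIdl g\<^esub> = 1"
      using h'[OF S.one_closed] ring_hom_one[OF hom] by (simp add: embeds_one[OF emb] rhomD[OF k])
    fix C D assume CD: "C \<in> carrier (S Quot PIdl g)" "D \<in> carrier (S Quot PIdl g)"
    obtain p q where pq: "p \<in> carrier S" "q \<in> carrier S" "C = PIdl g +> p" "D = PIdl g +> q"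
      using rep[OF CD(1)] rep[OF CD(2)] by blast
    show "h' (C \<oplus>\<^bsub>S Quot PIdl g\<^esub> D) = h' C + h' D"
      unfolding pq(3,4) ring_hom_add[OF hom pq(1,2), symmetric]
      using pq by (simp add: h' embeds_add[OF emb] rhomD[OF k])
    show "h' (C \<otimes>\<^bsub>S Quot PIdl g\<^esub> D) = h' C * h' D"
      unfolding pq(3,4) ring_hom_mult[OF hom pq(1,2), symmetric]
      using pq by (simp add: h' embeds_mult[OF emb] rhomD[OF k])
  qed
  thus thesis using that[of h'] h' cls by blast
qed

end

section \<open>Internal semidirect products\<close>

text \<open>\<open>norm\<close> yields the action by conjugation and \<open>dec\<close>
  surjectivity. \<open>triv\<close> states at once that \<open>T2\<close> is injective and that the
  two images meet trivially.\<close>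

lemma internal_semidirect_product:
  fixes G :: "('g, 'x) monoid_scheme" (structure) and N :: "('n, 'y) monoid_scheme"
    and H :: "('h, 'z) monoid_scheme"
  assumes "group G" "group N" "group H"
    and T1: "T1 \<in> hom N G" and T2: "T2 \<in> hom H G" and inj: "inj_on T1 (carrier N)"
    and norm: "\<And>h f. h \<in> carrier H \<Longrightarrow> f \<in> carrier N \<Longrightarrow> \<exists>f'\<in>carrier N. T2 h \<otimes> T1 f = T1 f' \<otimes> T2 h"
    and dec: "\<And>g. g \<in> carrier G \<Longrightarrow> \<exists>h\<in>carrier H. \<exists>f\<in>carrier N. g = T2 h \<otimes> T1 f"
    and triv: "\<And>h f. h \<in> carrier H \<Longrightarrow> f \<in> carrier N \<Longrightarrow> T2 h = T1 f \<Longrightarrow> h = \<one>\<^bsub>H\<^esub>"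
  shows "\<exists>\<theta>\<in>hom H (AutoGroup N). \<exists>\<Psi>\<in>iso (semidirect_prod H N \<theta>) G.
    (\<forall>f\<in>carrier N. \<Psi> (\<one>\<^bsub>H\<^esub>, f) = T1 f) \<and> (\<forall>h\<in>carrier H. \<Psi> (h, \<one>\<^bsub>N\<^esub>) = T2 h)"
proof -
  interpret G: group G by fact
  interpret N: group N by fact
  interpret H: group H by fact
  interpret h1: group_hom N G T1 using T1 by unfold_locales
  interpret h2: group_hom H G T2 using T2 by unfold_locales
  have T1_eq: "T1 f = T1 f' \<longleftrightarrow> f = f'" if "f \<in> carrier N" "f' \<in> carrier N" for f f'
    using inj that by (auto dest: inj_onD)
  define \<tau> where "\<tau> h f = (SOME f'. f' \<in> carrier N \<and> T2 h \<otimes> T1 f = T1 f' \<otimes> T2 h)" for h f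
  have \<tau>: "\<tau> h f \<in> carrier N" "T2 h \<otimes> T1 f = T1 (\<tau> h f) \<otimes> T2 h"
    if hf: "h \<in> carrier H" "f \<in> carrier N" for h f
  proof -
    have "\<tau> h f \<in> carrier N \<and> T2 h \<otimes> T1 f = T1 (\<tau> h f) \<otimes> T2 h"
      unfolding \<tau>_def by (rule someI_ex) (use norm[OF hf] in blast)
    thus "\<tau> h f \<in> carrier N" "T2 h \<otimes> T1 f = T1 (\<tau> h f) \<otimes> T2 h" by auto
  qed
  have \<tau>_eqI: "\<tau> h f = f'" if "h \<in> carrier H" "f \<in> carrier N" "f' \<in> carrier N"
    "T2 h \<otimes> T1 f = T1 f' \<otimes> T2 h" for h f f'
  proof -
    have "T1 (\<tau> h f) \<otimes> T2 h = T1 f' \<otimes> T2 h" using \<tau>[OF that(1,2)] that(4) by simp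
    hence "T1 (\<tau> h f) = T1 f'" using that \<tau>[OF that(1,2)] by simp
    thus ?thesis using T1_eq \<tau>[OF that(1,2)] that(3) by blast
  qed
  have \<tau>_mult: "\<tau> h (f \<otimes>\<^bsub>N\<^esub> f') = \<tau> h f \<otimes>\<^bsub>N\<^esub> \<tau> h f'"
    if h: "h \<in> carrier H" and f: "f \<in> carrier N" "f' \<in> carrier N" for h f f'
  proof (rule \<tau>_eqI)
    note t = \<tau>[OF h f(1)] \<tau>[OF h f(2)]
    have "T2 h \<otimes> T1 (f \<otimes>\<^bsub>N\<^esub> f') = (T2 h \<otimes> T1 f) \<otimes> T1 f'" using h f by (simp add: G.m_assoc)
    also have "\<dots> = T1 (\<tau> h f) \<otimes> (T2 h \<otimes> T1 f')" using h f t by (simp add: G.m_assoc)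
    also have "\<dots> = T1 (\<tau> h f) \<otimes> (T1 (\<tau> h f') \<otimes> T2 h)" unfolding t(4) ..
    also have "\<dots> = T1 (\<tau> h f \<otimes>\<^bsub>N\<^esub> \<tau> h f') \<otimes> T2 h" using h t by (simp add: G.m_assoc)
    finally show "T2 h \<otimes> T1 (f \<otimes>\<^bsub>N\<^esub> f') = T1 (\<tau> h f \<otimes>\<^bsub>N\<^esub> \<tau> h f') \<otimes> T2 h" .
  qed (use h f \<tau> in auto)
  have \<tau>_comp: "\<tau> (h \<otimes>\<^bsub>H\<^esub> h') f = \<tau> h (\<tau> h' f)"
    if h: "h \<in> carrier H" "h' \<in> carrier H" and f: "f \<in> carrier N" for h h' f
  proof (rule \<tau>_eqI)
    note t' = \<tau>[OF h(2) f]
    note t = \<tau>[OF h(1) t'(1)]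
    have "T2 (h \<otimes>\<^bsub>H\<^esub> h') \<otimes> T1 f = T2 h \<otimes> (T2 h' \<otimes> T1 f)" using h f by (simp add: G.m_assoc)
    also have "\<dots> = (T2 h \<otimes> T1 (\<tau> h' f)) \<otimes> T2 h'" unfolding t'(2) using h t' by (simp add: G.m_assoc)
    also have "\<dots> = T1 (\<tau> h (\<tau> h' f)) \<otimes> T2 (h \<otimes>\<^bsub>H\<^esub> h')" unfolding t(2) using h t by (simp add: G.m_assoc)
    finally show "T2 (h \<otimes>\<^bsub>H\<^esub> h') \<otimes> T1 f = T1 (\<tau> h (\<tau> h' f)) \<otimes> T2 (h \<otimes>\<^bsub>H\<^esub> h')" .
  qed (use h f \<tau> in auto)
  have \<tau>_one: "\<tau> \<one>\<^bsub>H\<^esub> f = f" if "f \<in> carrier N" for f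
    by (rule \<tau>_eqI) (use that in simp_all)
  define \<theta> where "\<theta> h = restrict (\<tau> h) (carrier N)" for h
  have \<theta>_Bij: "\<theta> h \<in> Bij (carrier N)" if h: "h \<in> carrier H" for h
  proof -
    have "bij_betw (\<tau> h) (carrier N) (carrier N)"
      by (rule bij_betw_byWitness[of _ "\<tau> (inv\<^bsub>H\<^esub> h)"])
        (use h \<tau>(1) in \<open>auto simp: \<tau>_one simp flip: \<tau>_comp\<close>)
    thus ?thesis unfolding Bij_def \<theta>_def by simp
  qed
  have \<theta>_hom: "\<theta> \<in> hom H (AutoGroup N)"
  proof (rule homI)
    fix h assume h: "h \<in> carrier H"
    have "\<theta> h \<in> hom N N" using \<tau>(1) \<tau>_mult h by (auto simp: \<theta>_def hom_def)
    thus "\<theta> h \<in> carrier (AutoGroup N)" using \<theta>_Bij[OF h] by (simp add: AutoGroup_def auto_def)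
    fix h' assume h': "h' \<in> carrier H"
    have "\<theta> (h \<otimes>\<^bsub>H\<^esub> h') = compose (carrier N) (\<theta> h) (\<theta> h')"
      by (rule ext) (use h h' \<tau>(1) in \<open>simp add: \<theta>_def compose_def \<tau>_comp\<close>)
    thus "\<theta> (h \<otimes>\<^bsub>H\<^esub> h') = \<theta> h \<otimes>\<^bsub>AutoGroup N\<^esub> \<theta> h'"
      using \<theta>_Bij h h' by (simp add: AutoGroup_def BijGroup_def)
  qed
  \<comment> \<open>The normal factor stands on the left, as the multiplication of
    \<open>semidirect_prod\<close> demands. Decompositions in the opposite order are converted by
    \<open>\<tau>\<close>.\<close>
  define \<Psi> where "\<Psi> = (\<lambda>(h, f). T1 f \<otimes> T2 h)"
  have \<Psi>_hom: "\<Psi> \<in> hom (semidirect_prod H N \<theta>) G"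
  proof (rule homI)
    fix p assume "p \<in> carrier (semidirect_prod H N \<theta>)"
    then obtain h f where p: "p = (h, f)" "h \<in> carrier H" "f \<in> carrier N" by (auto simp: semidirect_prod_def)
    show "\<Psi> p \<in> carrier G" using p by (simp add: \<Psi>_def)
    fix q assume "q \<in> carrier (semidirect_prod H N \<theta>)"
    then obtain h' f' where q: "q = (h', f')" "h' \<in> carrier H" "f' \<in> carrier N" by (auto simp: semidirect_prod_def)
    note t = \<tau>[OF p(2) q(3)]
    have "\<Psi> (p \<otimes>\<^bsub>semidirect_prod H N \<theta>\<^esub> q) = T1 (f \<otimes>\<^bsub>N\<^esub> \<tau> h f') \<otimes> T2 (h \<otimes>\<^bsub>H\<^esub> h')"
      using p q by (simp add: \<Psi>_def semidirect_prod_def \<theta>_def)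
    also have "\<dots> = T1 f \<otimes> (T1 (\<tau> h f') \<otimes> T2 h) \<otimes> T2 h'" using p q t by (simp add: G.m_assoc)
    also have "\<dots> = T1 f \<otimes> (T2 h \<otimes> T1 f') \<otimes> T2 h'" unfolding t(2) ..
    also have "\<dots> = \<Psi> p \<otimes> \<Psi> q" using p q by (simp add: \<Psi>_def G.m_assoc)
    finally show "\<Psi> (p \<otimes>\<^bsub>semidirect_prod H N \<theta>\<^esub> q) = \<Psi> p \<otimes> \<Psi> q" .
  qed
  have "bij_betw \<Psi> (carrier (semidirect_prod H N \<theta>)) (carrier G)"
    unfolding bij_betw_def
  proof
    have "h = h' \<and> f = f'" if "h \<in> carrier H" "h' \<in> carrier H" "f \<in> carrier N" "f' \<in> carrier N"
      "T1 f \<otimes> T2 h = T1 f' \<otimes> T2 h'" for h h' f f'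
    proof -
      have "T2 (h \<otimes>\<^bsub>H\<^esub> inv\<^bsub>H\<^esub> h') = (inv T1 f) \<otimes> (T1 f \<otimes> T2 h) \<otimes> inv (T2 h')"
        using that(1-4) by (simp add: G.m_assoc[symmetric])
      also have "\<dots> = T1 (inv\<^bsub>N\<^esub> f \<otimes>\<^bsub>N\<^esub> f')"
        unfolding that(5) using that(1-4) by (simp add: G.m_assoc)
      finally have "h \<otimes>\<^bsub>H\<^esub> inv\<^bsub>H\<^esub> h' = \<one>\<^bsub>H\<^esub>" using triv that by (meson H.inv_closed H.m_closed N.inv_closed N.m_closed)
      hence "h = h'" using that by (metis H.inv_closed H.inv_equality H.inv_inv)
      thus ?thesis using that T1_eq by simp
    qed
    thus "inj_on \<Psi> (carrier (semidirect_prod H N \<theta>))"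
      by (intro inj_onI) (auto simp: \<Psi>_def semidirect_prod_def)
    have "\<exists>p\<in>carrier (semidirect_prod H N \<theta>). g = \<Psi> p" if g: "g \<in> carrier G" for g
    proof -
      obtain h f where hf: "h \<in> carrier H" "f \<in> carrier N" "g = T2 h \<otimes> T1 f" using dec[OF g] by blast
      have "g = \<Psi> (h, \<tau> h f)" "(h, \<tau> h f) \<in> carrier (semidirect_prod H N \<theta>)"
        using \<tau>[OF hf(1,2)] hf by (simp_all add: \<Psi>_def semidirect_prod_def)
      thus ?thesis by blast
    qed
    thus "\<Psi> ` carrier (semidirect_prod H N \<theta>) = carrier G"
      using \<Psi>_hom by (auto simp: hom_def)
  qed
  hence "\<Psi> \<in> iso (semidirect_prod H N \<theta>) G" using \<Psi>_hom by (simp add: iso_def)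
  moreover have "\<forall>f\<in>carrier N. \<Psi> (\<one>\<^bsub>H\<^esub>, f) = T1 f" "\<forall>h\<in>carrier H. \<Psi> (h, \<one>\<^bsub>N\<^esub>) = T2 h"
    by (simp_all add: \<Psi>_def)
  ultimately show ?thesis using \<theta>_hom by blast
qed


section \<open>Transporting automorphisms\<close>

text \<open>Restricted to the carrier, because the automorphism group consists of extensional
  functions.\<close>

definition transp :: "('s, 'm) ring_scheme \<Rightarrow> ('s \<Rightarrow> 'b::comm_ring_1) \<Rightarrow> ('b \<Rightarrow> 'b) \<Rightarrow> 's \<Rightarrow> 's"
  where "transp A h s = (\<lambda>p\<in>carrier A. inv_into (carrier A) h (s (h p)))"

locale realised_algebra =
  fixes A :: "('s, 'm) ring_scheme" and h :: "'s \<Rightarrow> 'b::comm_ring_1" and T :: "'b set" and G :: "'b set"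
    and \<iota> :: "'k::comm_ring_1 \<Rightarrow> 'b" and C :: "'k \<Rightarrow> 's" and K :: "('k, 'x) ring_scheme"
  assumes emb: "embeds A h T" and T: "T = subalg \<iota> G" and \<iota>: "rhom \<iota>"
    and C: "\<And>t. C t \<in> carrier A" "\<And>t. h (C t) = \<iota> t" and K: "carrier K = UNIV"
begin

abbreviation "tr \<equiv> transp A h"
abbreviation "Aut \<equiv> alg_aut_group K C A"

lemma carrier_Aut: "carrier Aut = alg_auts K C A"
  by (simp add: alg_aut_group_def)

lemma bij_h: "bij_betw h (carrier A) T"
  using emb by (simp add: embeds_def)

lemma tr_apply:
  assumes "sub_aut \<iota> T s" "p \<in> carrier A"
  shows "tr s p \<in> carrier A" "h (tr s p) = s (h p)"
proof -
  have "s (h p) \<in> T" using sub_aut_in[OF \<iota> assms(1) T] embeds_in[OF emb assms(2)] by blast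
  thus "tr s p \<in> carrier A" "h (tr s p) = s (h p)"
    using assms(2) bij_h bij_betw_inv_into_right[OF bij_h] bij_betwE[OF bij_betw_inv_into[OF bij_h]]
    by (auto simp: transp_def)
qed

lemma tr_eq_iff:
  assumes "sub_aut \<iota> T s" "p \<in> carrier A" "q \<in> carrier A"
  shows "tr s p = q \<longleftrightarrow> s (h p) = h q"
  using embeds_inj[OF emb tr_apply(1)[OF assms(1,2)] assms(3)] tr_apply(2)[OF assms(1,2)] by simp

lemma tr_in_Aut:
  assumes s: "sub_aut \<iota> T s"
  shows "tr s \<in> carrier Aut"
proof -
  interpret A: cring A by (rule embeds_cring[OF emb])
  note hom = embeds_add[OF emb] embeds_mult[OF emb] embeds_one[OF emb]
  have "tr s \<in> ring_hom A A"
  proof (rule ring_hom_memI)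
    show "tr s p \<in> carrier A" if "p \<in> carrier A" for p using tr_apply(1)[OF s that] .
    fix p q assume pq: "p \<in> carrier A" "q \<in> carrier A"
    show "tr s (p \<otimes>\<^bsub>A\<^esub> q) = tr s p \<otimes>\<^bsub>A\<^esub> tr s q"
      using pq tr_apply[OF s pq(1)] tr_apply[OF s pq(2)] embeds_in[OF emb]
      by (simp add: tr_eq_iff[OF s] hom sub_aut_mult[OF \<iota> s T])
    show "tr s (p \<oplus>\<^bsub>A\<^esub> q) = tr s p \<oplus>\<^bsub>A\<^esub> tr s q"
      using pq tr_apply[OF s pq(1)] tr_apply[OF s pq(2)] embeds_in[OF emb]
      by (simp add: tr_eq_iff[OF s] hom sub_aut_add[OF \<iota> s T])
  next
    show "tr s \<one>\<^bsub>A\<^esub> = \<one>\<^bsub>A\<^esub>" by (simp add: tr_eq_iff[OF s] hom sub_aut_1[OF \<iota> s T])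
  qed
  moreover have "bij_betw (\<lambda>p. inv_into (carrier A) h (s (h p))) (carrier A) (carrier A)"
  proof -
    have "bij_betw s T T" using s by (simp add: sub_aut_def)
    hence "bij_betw (inv_into (carrier A) h \<circ> (s \<circ> h)) (carrier A) (carrier A)"
      using bij_h bij_betw_inv_into by (blast intro: bij_betw_trans)
    thus ?thesis by (simp add: comp_def)
  qed
  hence "tr s \<in> Bij (carrier A)" by (simp add: Bij_def transp_def)
  moreover have "tr s (C t) = C t" for t
    by (simp add: tr_eq_iff[OF s] C sub_aut_const[OF \<iota> s T])
  ultimately show ?thesis by (simp add: carrier_Aut alg_auts_def)
qed

lemma tr_cong_iff:
  assumes "sub_aut \<iota> T s" "sub_aut \<iota> T s'"
  shows "tr s = tr s' \<longleftrightarrow> (\<forall>p\<in>T. s p = s' p)"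
proof
  assume eq: "tr s = tr s'"
  show "\<forall>p\<in>T. s p = s' p"
  proof
    fix p assume "p \<in> T"
    then obtain q where "q \<in> carrier A" "p = h q" using embeds_surj[OF emb] by blast
    thus "s p = s' p" using eq tr_apply(2)[OF assms(1)] tr_apply(2)[OF assms(2)] by metis
  qed
next
  assume "\<forall>p\<in>T. s p = s' p"
  thus "tr s = tr s'" unfolding transp_def using embeds_in[OF emb] by (intro restrict_ext) simp
qed

lemma Aut_obtain:
  assumes "\<phi> \<in> carrier Aut"
  obtains s where "sub_aut \<iota> T s" "\<phi> = tr s"
proof -
  interpret A: cring A by (rule embeds_cring[OF emb])
  have \<phi>: "\<phi> \<in> ring_hom A A" "\<phi> \<in> extensional (carrier A)" "bij_betw \<phi> (carrier A) (carrier A)" "\<And>t. \<phi> (C t) = C t"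
    using assms K by (auto simp: carrier_Aut alg_auts_def Bij_def)
  define k where "k = inv_into (carrier A) h"
  have k: "k p \<in> carrier A" "h (k p) = p" if "p \<in> T" for p
    using that bij_betw_inv_into_right[OF bij_h] bij_betwE[OF bij_betw_inv_into[OF bij_h]] by (auto simp: k_def)
  have kh: "k (h p) = p" if "p \<in> carrier A" for p
    using bij_betw_inv_into_left[OF bij_h that] by (simp add: k_def)
  define s where "s = (\<lambda>p. h (\<phi> (k p)))"
  have s: "sub_aut \<iota> T s"
    unfolding sub_aut_def
  proof (intro conjI allI ballI)
    have "bij_betw (h \<circ> (\<phi> \<circ> k)) T T"
      using bij_betw_inv_into[OF bij_h, folded k_def] \<phi>(3) bij_h by (blast intro: bij_betw_trans)
    thus "bij_betw s T T" by (simp add: s_def comp_def)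
    show "s (\<iota> t) = \<iota> t" for t
      using kh[OF C(1)[of t]] by (simp add: s_def C \<phi>(4))
    fix p q assume pq: "p \<in> T" "q \<in> T"
    note kpq = k[OF pq(1)] k[OF pq(2)]
    have "k (p + q) = k p \<oplus>\<^bsub>A\<^esub> k q" "k (p * q) = k p \<otimes>\<^bsub>A\<^esub> k q"
      using kh[OF A.add.m_closed[OF kpq(1,3)]] kh[OF A.m_closed[OF kpq(1,3)]] kpq
      by (simp_all add: embeds_add[OF emb] embeds_mult[OF emb])
    thus "s (p + q) = s p + s q" "s (p * q) = s p * s q"
      using kpq ring_hom_closed[OF \<phi>(1)]
      by (simp_all add: s_def ring_hom_add[OF \<phi>(1)] ring_hom_mult[OF \<phi>(1)] embeds_add[OF emb] embeds_mult[OF emb])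
  qed
  have "\<phi> p = tr s p" if "p \<in> carrier A" for p
    using that kh ring_hom_closed[OF \<phi>(1)] by (simp add: transp_def s_def flip: k_def)
  hence "\<phi> = tr s" using \<phi>(2) by (intro extensionalityI[of _ "carrier A"]) (auto simp: transp_def)
  thus thesis using s that by blast
qed

lemma tr_mult:
  assumes "sub_aut \<iota> T s" "sub_aut \<iota> T s'"
  shows "tr s \<otimes>\<^bsub>Aut\<^esub> tr s' = tr (\<lambda>p. s (s' p))"
proof -
  have "tr s \<in> Bij (carrier A)" "tr s' \<in> Bij (carrier A)"
    using tr_in_Aut assms by (auto simp: carrier_Aut alg_auts_def)
  hence "tr s \<otimes>\<^bsub>Aut\<^esub> tr s' = compose (carrier A) (tr s) (tr s')"
    by (simp add: alg_aut_group_def BijGroup_def)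
  also have "\<dots> = tr (\<lambda>p. s (s' p))"
    unfolding compose_def transp_def[of A h "\<lambda>p. s (s' p)"]
  proof (rule restrict_ext)
    fix p assume p: "p \<in> carrier A"
    have "tr s (tr s' p) = inv_into (carrier A) h (s (h (tr s' p)))"
      using tr_apply(1)[OF assms(2) p] by (simp add: transp_def[of A h s])
    thus "tr s (tr s' p) = inv_into (carrier A) h (s (s' (h p)))" using tr_apply(2)[OF assms(2) p] by simp
  qed
  finally show ?thesis .
qed

lemma sub_aut_id: "sub_aut \<iota> T (\<lambda>p. p)"
  unfolding sub_aut_def bij_betw_def by auto

lemma Aut_one: "\<one>\<^bsub>Aut\<^esub> = tr (\<lambda>p. p)"
  unfolding alg_aut_group_def BijGroup_def transp_def
  by (auto simp: bij_betw_inv_into_left[OF bij_h] intro!: restrict_ext)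

lemma group_Aut: "group Aut"
proof (rule groupI)
  fix \<phi> \<psi> assume "\<phi> \<in> carrier Aut" "\<psi> \<in> carrier Aut"
  then obtain s s' where s: "sub_aut \<iota> T s" "\<phi> = tr s" "sub_aut \<iota> T s'" "\<psi> = tr s'" by (metis Aut_obtain)
  show "\<phi> \<otimes>\<^bsub>Aut\<^esub> \<psi> \<in> carrier Aut" using s by (simp add: tr_mult tr_in_Aut sub_aut_comp)
  fix \<chi> assume "\<chi> \<in> carrier Aut"
  then obtain r where r: "sub_aut \<iota> T r" "\<chi> = tr r" by (metis Aut_obtain)
  show "\<phi> \<otimes>\<^bsub>Aut\<^esub> \<psi> \<otimes>\<^bsub>Aut\<^esub> \<chi> = \<phi> \<otimes>\<^bsub>Aut\<^esub> (\<psi> \<otimes>\<^bsub>Aut\<^esub> \<chi>)"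
    using s r by (simp add: tr_mult sub_aut_comp)
next
  show "\<one>\<^bsub>Aut\<^esub> \<in> carrier Aut" unfolding Aut_one by (rule tr_in_Aut[OF sub_aut_id])
next
  fix \<phi> assume "\<phi> \<in> carrier Aut"
  then obtain s where s: "sub_aut \<iota> T s" "\<phi> = tr s" by (metis Aut_obtain)
  show "\<one>\<^bsub>Aut\<^esub> \<otimes>\<^bsub>Aut\<^esub> \<phi> = \<phi>" unfolding Aut_one s(2) tr_mult[OF sub_aut_id s(1)] ..
  have bij: "bij_betw s T T" using s(1) by (simp add: sub_aut_def)
  note inv = sub_aut_inv[OF \<iota> s(1) T]
  have "tr (inv_into T s) \<otimes>\<^bsub>Aut\<^esub> \<phi> = \<one>\<^bsub>Aut\<^esub>"
    unfolding s(2) tr_mult[OF inv s(1)] Aut_one tr_cong_iff[OF sub_aut_comp[OF inv s(1)] sub_aut_id]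
    using bij_betw_inv_into_left[OF bij] by blast
  thus "\<exists>\<psi>\<in>carrier Aut. \<psi> \<otimes>\<^bsub>Aut\<^esub> \<phi> = \<one>\<^bsub>Aut\<^esub>" using tr_in_Aut[OF inv] by blast
qed

end

section \<open>The automorphism group\<close>

context threefold
begin

section \<open>Composition laws of shears and scalings\<close>

lemma thr_eqI:
  assumes "sub_aut cst thr s" "sub_aut cst thr s'" "s tx = s' tx" "s ty = s' ty" "s tz = s' tz"
    "s tu = s' tu" "s tv = s' tv" "p \<in> thr"
  shows "s p = s' p"
  by (rule sub_aut_eqI[OF rhom_cst assms(1) thr_eq_subalg assms(2) _ assms(8)]) (use assms(3-7) in auto)

lemma shear_comp:
  assumes "f \<in> surf" "g \<in> surf" "p \<in> thr"
  shows "shear f (shear g p) = shear (f + g) p"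
proof (rule thr_eqI[where s = "\<lambda>p. shear f (shear g p)"])
  show "sub_aut cst thr (\<lambda>p. shear f (shear g p))"
    by (rule sub_aut_comp[OF shear_aut[OF assms(1)] shear_aut[OF assms(2)]])
  show "sub_aut cst thr (shear (f + g))" by (intro shear_aut surf_add assms)
qed (simp_all add: shear_lft shear_tu shear_tv rhomD[OF rhom_shear] rhomD[OF rhom_lft] algebra_simps assms)

lemma scale_comp:
  assumes "\<mu> \<noteq> 0" "\<nu> \<noteq> 0" "p \<in> thr"
  shows "scale \<mu> (scale \<nu> p) = scale (\<mu> * \<nu>) p"
proof (rule thr_eqI[where s = "\<lambda>p. scale \<mu> (scale \<nu> p)"])
  have mn: "\<mu> * \<nu> \<noteq> 0" using assms by simp
  show "sub_aut cst thr (\<lambda>p. scale \<mu> (scale \<nu> p))"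
    by (rule sub_aut_comp[OF scale_aut[OF assms(1)] scale_aut[OF assms(2)]])
  show "sub_aut cst thr (scale (\<mu> * \<nu>))" by (rule scale_aut[OF mn])
  note * = scale_xyz scale_tu scale_tv scale_cst rhomD(4)[OF rhom_scale]
  show "scale \<mu> (scale \<nu> tx) = scale (\<mu> * \<nu>) tx" "scale \<mu> (scale \<nu> ty) = scale (\<mu> * \<nu>) ty"
    "scale \<mu> (scale \<nu> tz) = scale (\<mu> * \<nu>) tz" "scale \<mu> (scale \<nu> tu) = scale (\<mu> * \<nu>) tu"
    "scale \<mu> (scale \<nu> tv) = scale (\<mu> * \<nu>) tv"
    by (simp_all only: *[OF assms(1)] *[OF assms(2)] *[OF mn] cst_mult_assoc)
      (simp_all add: power_mult_distrib power_int_mult_distrib mult.commute)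
qed (rule assms)

text \<open>The scalings normalise the shears; this supplies the action in the semidirect
  product.\<close>

lemma scale_shear:
  assumes "\<mu> \<noteq> 0" "f \<in> surf"
  shows "\<exists>f'\<in>surf. \<forall>p\<in>thr. scale \<mu> (shear f p) = shear f' (scale \<mu> p)"
proof -
  obtain g where g: "g \<in> surf" "scale \<mu> (lft f) = lft g"
    using aut_preserves_surf[OF scale_aut[OF assms(1)] assms(2)] by blast
  define k l where "k = \<mu> ^ (m * b * c)" and "l = \<mu> ^ (n * a * c)"
  have kl: "\<mu> powi (- int (m * b * c)) = inverse k" "\<mu> powi (- int (n * a * c)) = inverse l"
    "k \<noteq> 0" "l \<noteq> 0" using assms(1) by (simp_all add: k_def l_def power_int_minus del: of_nat_mult)
  have kl': "(\<mu> ^ (b * c)) ^ m = k" "(\<mu> ^ (a * c)) ^ n = l"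
    by (simp_all add: k_def l_def ac_simps flip: power_mult)
  \<comment> \<open>Compare on u: scaling after shearing gives u/k + l g y^n, shearing after scaling
    gives (u + f' y^n)/k, so f' = k l g. Comparison on v leads to the same factor.\<close>
  define f' where "f' = scalar (k * l) * g"
  have f': "f' \<in> surf" unfolding f'_def by (intro surf_mult surf_gens g)
  have lf': "lft f' = cst (k * l) * lft g" by (simp add: f'_def cst_def rhomD[OF rhom_lft])
  note sc = scale_xyz[OF assms(1)] scale_tu[OF assms(1), unfolded kl] scale_tv[OF assms(1), unfolded kl]
    rhomD[OF rhom_scale[OF assms(1)]] g(2)
  note sh = shear_lft shear_cst shear_tu shear_tv rhomD[OF rhom_shear] lf'
  have "scale \<mu> (shear f p) = shear f' (scale \<mu> p)" if p: "p \<in> thr" for p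
  proof (rule thr_eqI[where s = "\<lambda>p. scale \<mu> (shear f p)" and s' = "\<lambda>p. shear f' (scale \<mu> p)", OF _ _ _ _ _ _ _ p])
    show "sub_aut cst thr (\<lambda>p. scale \<mu> (shear f p))"
      by (rule sub_aut_comp[OF scale_aut[OF assms(1)] shear_aut[OF assms(2)]])
    show "sub_aut cst thr (\<lambda>p. shear f' (scale \<mu> p))"
      by (rule sub_aut_comp[OF shear_aut[OF f'] scale_aut[OF assms(1)]])
    show "scale \<mu> (shear f tx) = shear f' (scale \<mu> tx)" "scale \<mu> (shear f ty) = shear f' (scale \<mu> ty)"
      "scale \<mu> (shear f tz) = shear f' (scale \<mu> tz)" by (simp_all add: sc sh)
    have "scale \<mu> (shear f tu) = cst (inverse k) * tu + lft g * (cst (\<mu> ^ (a * c)) * ty) ^ n" by (simp add: sc sh)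
    also have "\<dots> = cst (inverse k) * tu + cst l * lft g * ty ^ n"
      by (simp add: power_mult_distrib cst_power kl' ac_simps)
    also have "cst l = cst (inverse k) * cst (k * l)"
      unfolding cst_mult mult.assoc[symmetric] using kl(3) by simp
    also have "cst (inverse k) * tu + cst (inverse k) * cst (k * l) * lft g * ty ^ n = shear f' (scale \<mu> tu)"
      by (simp add: sc sh algebra_simps)
    finally show "scale \<mu> (shear f tu) = shear f' (scale \<mu> tu)" .
    have "scale \<mu> (shear f tv) = cst (inverse l) * tv + lft g * (cst (\<mu> ^ (b * c)) * tx) ^ m" by (simp add: sc sh)
    also have "\<dots> = cst (inverse l) * tv + cst k * lft g * tx ^ m"
      by (simp add: power_mult_distrib cst_power kl' ac_simps)
    also have "cst k = cst (inverse l) * cst (k * l)"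
      unfolding cst_mult mult.left_commute[of _ k] using kl(4) by simp
    also have "cst (inverse l) * tv + cst (inverse l) * cst (k * l) * lft g * tx ^ m = shear f' (scale \<mu> tv)"
      by (simp add: sc sh algebra_simps)
    finally show "scale \<mu> (shear f tv) = shear f' (scale \<mu> tv)" .
  qed
  thus ?thesis using f' by blast
qed

lemma shear_inject: "shear f tv = shear g tv \<Longrightarrow> f = g"
  using txyz_nz by (simp add: shear_tv)

lemma cst_eq_iff: "cst s = cst t \<longleftrightarrow> s = t"
  by (simp add: cst_def scalar_def) (metis fls_const_nth)

text \<open>By Bezout for the weights, \<mu> is a product of integer powers of \<mu>^(bc),
  \<mu>^(ac) and \<mu>^(ab).\<close>

lemma scale_trivial:
  assumes "\<mu> \<noteq> 0" "scale \<mu> tx = tx" "scale \<mu> ty = ty" "scale \<mu> tz = tz"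
  shows "\<mu> = 1"
proof -
  have "cst (\<mu> ^ (b * c)) * tx = cst 1 * tx" "cst (\<mu> ^ (a * c)) * ty = cst 1 * ty"
    "cst (\<mu> ^ (a * b)) * tz = cst 1 * tz"
    using assms scale_xyz[OF assms(1)] by (simp_all add: cst_1)
  hence pw: "\<mu> ^ (b * c) = 1" "\<mu> ^ (a * c) = 1" "\<mu> ^ (a * b) = 1" using txyz_nz by (simp_all add: cst_eq_iff)
  obtain p q r :: int where pqr: "p * (int b * int c) + q * (int a * int c) + r * (int a * int b) = 1"
    using bezout_three[OF cop] .
  have triv: "\<mu> powi (k * int l) = 1" if "\<mu> ^ l = 1" for k l
    using that by (simp add: power_int_mult mult.commute[of k])
  have "\<mu> powi (p * int (b * c) + q * int (a * c) + r * int (a * b)) =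
      \<mu> powi (p * int (b * c)) * \<mu> powi (q * int (a * c)) * \<mu> powi (r * int (a * b))"
    using assms(1) by (simp add: power_int_add)
  also have "\<dots> = 1" unfolding triv[OF pw(1)] triv[OF pw(2)] triv[OF pw(3)] by simp
  finally show ?thesis using pqr by simp
qed

text \<open>The unfolding of the two quotient rings is confined to this lemma; afterwards only the
  concrete models and the images of the generators matter.\<close>

lemma realisation:
  obtains hR hA where "embeds (R_ring a b c) hR surf" "embeds (A_ring a b c n m) hA thr"
    "\<forall>f\<in>carrier (R_ring a b c).
      R_to_A a b c n m f \<in> carrier (A_ring a b c n m) \<and> hA (R_to_A a b c n m f) = lft (hR f)"
    "\<forall>t. C_to_A a b c n m t \<in> carrier (A_ring a b c n m) \<and> hA (C_to_A a b c n m t) = cst t"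
    "A_x a b c n m \<in> carrier (A_ring a b c n m) \<and> hA (A_x a b c n m) = tx"
    "A_y a b c n m \<in> carrier (A_ring a b c n m) \<and> hA (A_y a b c n m) = ty"
    "A_z a b c n m \<in> carrier (A_ring a b c n m) \<and> hA (A_z a b c n m) = tz"
    "A_u a b c n m \<in> carrier (A_ring a b c n m) \<and> hA (A_u a b c n m) = tu"
    "A_v a b c n m \<in> carrier (A_ring a b c n m) \<and> hA (A_v a b c n m) = tv"
proof -
  have c_in: "t \<in> carrier complex_ring" for t by (simp add: ring_of_type_algebra_def)
  note e0 = embeds_type_algebra
  have e1: "embeds (UP complex_ring) (up_map id) UNIV" using embeds_UP[OF e0] by simp
  have e2: "embeds (UP (UP complex_ring)) (up_map (up_map id)) UNIV" using embeds_UP[OF e1] by simp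
  define h3 :: "cxyz \<Rightarrow> complex poly poly poly" where "h3 = up_map (up_map (up_map id))"
  have e3: "embeds CXYZ h3 UNIV" using embeds_UP[OF e2] by (simp add: CXYZ_def h3_def)
  interpret P3: cring CXYZ by (rule embeds_cring[OF e3])
  note cl = up_const_closed[OF e0] up_const_closed[OF e1] up_const_closed[OF e2]
    up_var_closed[OF e0] up_var_closed[OF e1] up_var_closed[OF e2]
  note mp = up_map_const[OF e0] up_map_const[OF e1] up_map_const[OF e2]
    up_map_var[OF e0] up_map_var[OF e1] up_map_var[OF e2]
  have in3: "CXYZ_X \<in> carrier CXYZ" "CXYZ_Y \<in> carrier CXYZ" "CXYZ_Z \<in> carrier CXYZ"
    "CXYZ_const t \<in> carrier CXYZ" for t
    unfolding CXYZ_def CXYZ_X_def CXYZ_Y_def CXYZ_Z_def CXYZ_const_def by (simp_all add: cl c_in)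
  have h3: "h3 CXYZ_X = [:[:[:0, 1:]:]:]" "h3 CXYZ_Y = [:[:0, 1:]:]" "h3 CXYZ_Z = [:0, 1:]"
    "h3 (CXYZ_const t) = [:[:[:t:]:]:]" for t
    unfolding h3_def CXYZ_X_def CXYZ_Y_def CXYZ_Z_def CXYZ_const_def by (simp_all add: mp cl c_in)
  define gR where "gR = CXYZ_X [^]\<^bsub>CXYZ\<^esub> a \<oplus>\<^bsub>CXYZ\<^esub> CXYZ_Y [^]\<^bsub>CXYZ\<^esub> b \<oplus>\<^bsub>CXYZ\<^esub> CXYZ_Z [^]\<^bsub>CXYZ\<^esub> c"
  have gR: "gR \<in> carrier CXYZ" by (simp add: gR_def in3)
  have hg: "h3 gR = brieskorn"
    by (simp add: gR_def in3 embeds_add[OF e3] embeds_power[OF e3] h3 brieskorn_def const_poly_power)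
  obtain hR where eR: "embeds (CXYZ Quot PIdl\<^bsub>CXYZ\<^esub> gR) hR (range ev)"
    and hR: "\<And>p. p \<in> carrier CXYZ \<Longrightarrow> PIdl\<^bsub>CXYZ\<^esub> gR +>\<^bsub>CXYZ\<^esub> p \<in> carrier (CXYZ Quot PIdl\<^bsub>CXYZ\<^esub> gR) \<and>
        hR (PIdl\<^bsub>CXYZ\<^esub> gR +>\<^bsub>CXYZ\<^esub> p) = ev (h3 p)"
    using embeds_quotient[OF e3 gR rhom_ev] ev_eq_0_iff unfolding hg by auto
  let ?R = "R_ring a b c"
  have idR: "R_ideal a b c = PIdl\<^bsub>CXYZ\<^esub> gR" by (simp add: R_ideal_def gR_def)
  have eR: "embeds ?R hR surf" using eR by (simp add: R_ring_def idR surf_def)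
  have hR: "R_class a b c p \<in> carrier ?R" "hR (R_class a b c p) = ev (h3 p)" if "p \<in> carrier CXYZ" for p
    using hR[OF that] by (simp_all add: R_class_def R_ring_def idR)
  have eU: "embeds (UP ?R) (up_map hR) (polys_over surf)" by (rule embeds_UP[OF eR])
  define h5 where "h5 = up_map (up_map hR)"
  let ?P = "poly_UV ?R"
  have eV: "embeds ?P h5 surf_UV" using embeds_UP[OF eU] by (simp add: poly_UV_def h5_def surf_UV_def)
  interpret P5: cring ?P by (rule embeds_cring[OF eV])
  have in5: "f \<in> carrier ?R \<Longrightarrow> UV_const ?R f \<in> carrier ?P" "UV_U ?R \<in> carrier ?P" "UV_V ?R \<in> carrier ?P" for f
    unfolding poly_UV_def UV_const_def UV_U_def UV_V_def
    by (simp_all add: up_const_closed[OF eR] up_const_closed[OF eU] up_var_closed[OF eR] up_var_closed[OF eU])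
  have h5: "f \<in> carrier ?R \<Longrightarrow> h5 (UV_const ?R f) = [:[:hR f:]:]" "h5 (UV_U ?R) = [:[:0, 1:]:]"
    "h5 (UV_V ?R) = [:0, 1:]" for f
    unfolding h5_def UV_const_def UV_U_def UV_V_def
    by (simp_all add: up_const_closed[OF eR] up_var_closed[OF eR] up_map_const[OF eR] up_map_const[OF eU]
        up_map_var[OF eR] up_map_var[OF eU])
  have hRx: "hR (R_class a b c CXYZ_X) = sx" "hR (R_class a b c CXYZ_Y) = sy" "hR (R_class a b c CXYZ_Z) = sz"
    "hR (R_class a b c (CXYZ_const t)) = scalar t" for t
    by (simp_all add: hR in3 h3 ev_generators)
  define x y where "x = UV_const ?R (R_class a b c CXYZ_X)" and "y = UV_const ?R (R_class a b c CXYZ_Y)"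
  have xy: "x \<in> carrier ?P" "y \<in> carrier ?P" "h5 x = [:[:sx:]:]" "h5 y = [:[:sy:]:]"
    by (simp_all add: x_def y_def in5 hR in3 h5 h3 ev_generators)
  define gA where "gA = x [^]\<^bsub>?P\<^esub> m \<otimes>\<^bsub>?P\<^esub> UV_U ?R \<ominus>\<^bsub>?P\<^esub> y [^]\<^bsub>?P\<^esub> n \<otimes>\<^bsub>?P\<^esub> UV_V ?R \<ominus>\<^bsub>?P\<^esub> \<one>\<^bsub>?P\<^esub>"
  have gA: "gA \<in> carrier ?P" by (simp add: gA_def in5 xy)
  have hgA: "h5 gA = relA"
    by (simp add: gA_def in5 xy embeds_minus[OF eV] embeds_mult[OF eV] embeds_power[OF eV] embeds_one[OF eV]
        h5 relA_def const_poly_power one_pCons)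
  obtain hA where eA: "embeds (?P Quot PIdl\<^bsub>?P\<^esub> gA) hA (evA ` surf_UV)"
    and hA: "\<And>p. p \<in> carrier ?P \<Longrightarrow> PIdl\<^bsub>?P\<^esub> gA +>\<^bsub>?P\<^esub> p \<in> carrier (?P Quot PIdl\<^bsub>?P\<^esub> gA) \<and>
        hA (PIdl\<^bsub>?P\<^esub> gA +>\<^bsub>?P\<^esub> p) = evA (h5 p)"
    using embeds_quotient[OF eV gA rhom_evA] evA_eq_0_iff unfolding hgA by auto
  let ?A = "A_ring a b c n m"
  have idA: "A_ideal a b c n m = PIdl\<^bsub>?P\<^esub> gA"
    by (simp add: A_ideal_def gA_def x_def y_def Let_def)
  have eA: "embeds ?A hA thr" using eA by (simp add: A_ring_def idA thr_def)
  have hA: "A_class a b c n m p \<in> carrier ?A" "hA (A_class a b c n m p) = evA (h5 p)" if "p \<in> carrier ?P" for p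
    using hA[OF that] by (simp_all add: A_class_def A_ring_def idA)
  have RA: "R_to_A a b c n m f \<in> carrier ?A \<and> hA (R_to_A a b c n m f) = lft (hR f)" if "f \<in> carrier ?R" for f
    unfolding R_to_A_def using that by (simp add: hA in5 h5 evA_generators)
  show thesis
    by (rule that[OF eR eA])
      (use RA RA[OF hR(1)] in \<open>simp_all add: C_to_A_def A_x_def A_y_def A_z_def A_u_def A_v_def hRx cst_def in3
        hA in5 h5 evA_generators\<close>)
qed

end

theorem theorem3:
  fixes a b c m n :: nat
  assumes "a > 0" and "b > 0" and "c > 0"
    and "coprime a b" and "coprime a c" and "coprime b c"
    and "1 / real a + 1 / real b + 1 / real c < 1"
    and "m \<ge> 2" and "n \<ge> 2"
  shows "(\<forall>f \<in> carrier (R_ring a b c). \<exists>!\<phi>. is_type1 a b c n m f \<phi>) \<and>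
    (\<forall>\<mu>. \<mu> \<noteq> 0 \<longrightarrow> (\<exists>!\<phi>. is_type2 a b c n m \<mu> \<phi>)) \<and>
    generate (Aut_A a b c n m)
      ({\<phi>. \<exists>f \<in> carrier (R_ring a b c). is_type1 a b c n m f \<phi>} \<union>
       {\<phi>. \<exists>\<mu>. \<mu> \<noteq> 0 \<and> is_type2 a b c n m \<mu> \<phi>}) = carrier (Aut_A a b c n m) \<and>
    (\<exists>\<theta> \<in> hom (units_of complex_ring) (AutoGroup (add_monoid (R_ring a b c))).
     \<exists>\<Psi> \<in> iso (semidirect_prod (units_of complex_ring) (add_monoid (R_ring a b c)) \<theta>)
              (Aut_A a b c n m).
       (\<forall>f \<in> carrier (R_ring a b c). is_type1 a b c n m f (\<Psi> (1, f))) \<and>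
       (\<forall>\<mu>. \<mu> \<noteq> 0 \<longrightarrow> is_type2 a b c n m \<mu> (\<Psi> (\<mu>, \<zero>\<^bsub>R_ring a b c\<^esub>))))"
proof -
  interpret threefold a b c n m
    using assms by unfold_locales auto
  let ?R = "R_ring a b c" and ?A = "A_ring a b c n m" and ?Aut = "Aut_A a b c n m"
  obtain hR hA where eR: "embeds ?R hR surf" and eA: "embeds ?A hA thr"
    and RA: "\<forall>f\<in>carrier ?R. R_to_A a b c n m f \<in> carrier ?A \<and> hA (R_to_A a b c n m f) = lft (hR f)"
    and CA: "\<forall>t. C_to_A a b c n m t \<in> carrier ?A \<and> hA (C_to_A a b c n m t) = cst t"
    and gens: "A_x a b c n m \<in> carrier ?A \<and> hA (A_x a b c n m) = tx"
      "A_y a b c n m \<in> carrier ?A \<and> hA (A_y a b c n m) = ty"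
      "A_z a b c n m \<in> carrier ?A \<and> hA (A_z a b c n m) = tz"
      "A_u a b c n m \<in> carrier ?A \<and> hA (A_u a b c n m) = tu"
      "A_v a b c n m \<in> carrier ?A \<and> hA (A_v a b c n m) = tv"
    by (rule realisation)
  note RA = RA[rule_format] and CA = CA[rule_format]
  interpret A: cring ?A by (rule embeds_cring[OF eA])
  interpret R: cring ?R by (rule embeds_cring[OF eR])
  interpret T: realised_algebra ?A hA thr "{tv, tu, tz, ty, tx}" cst "C_to_A a b c n m" complex_ring
    by unfold_locales (use eA CA in \<open>auto simp: thr_eq_subalg rhom_cst ring_of_type_algebra_def\<close>)
  have Aut_eq: "?Aut = T.Aut" by (simp add: Aut_A_def)
  note hom = embeds_add[OF eA] embeds_mult[OF eA] embeds_power[OF eA]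
  have type1: "is_type1 a b c n m f (T.tr s) \<longleftrightarrow> s tx = tx \<and> s ty = ty \<and> s tz = tz \<and>
      s tu = lft (hR f) * ty ^ n + tu \<and> s tv = lft (hR f) * tx ^ m + tv"
    if "f \<in> carrier ?R" "sub_aut cst thr s" for f s
    unfolding is_type1_def Let_def Aut_eq using T.tr_in_Aut[OF that(2)] gens RA[OF that(1)]
    by (simp add: T.tr_eq_iff[OF that(2)] hom)
  have type2: "is_type2 a b c n m \<mu> (T.tr s) \<longleftrightarrow> s tx = cst (\<mu> ^ (b * c)) * tx \<and>
      s ty = cst (\<mu> ^ (a * c)) * ty \<and> s tz = cst (\<mu> ^ (a * b)) * tz \<and>
      s tu = cst (\<mu> powi (- int (m * b * c))) * tu \<and> s tv = cst (\<mu> powi (- int (n * a * c))) * tv"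
    if "sub_aut cst thr s" for \<mu> s
    unfolding is_type2_def Let_def Aut_eq using T.tr_in_Aut[OF that] gens CA
    by (simp add: T.tr_eq_iff[OF that] hom del: of_nat_mult)
  have uniq: "T.tr s = T.tr s'" if "sub_aut cst thr s" "sub_aut cst thr s'" "s tx = s' tx" "s ty = s' ty"
    "s tz = s' tz" "s tu = s' tu" "s tv = s' tv" for s s'
    unfolding T.tr_cong_iff[OF that(1,2)] using thr_eqI[OF that] by blast
  define T1 where "T1 f = T.tr (shear (hR f))" for f
  define T2 where "T2 \<mu> = T.tr (scale \<mu>)" for \<mu>
  have sh: "sub_aut cst thr (shear (hR f))" if "f \<in> carrier ?R" for f
    by (rule shear_aut[OF embeds_in[OF eR that]])
  \<comment> \<open>The equivalence with one equation delivers existence and uniqueness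
    together.\<close>
  have t1: "is_type1 a b c n m f \<phi> \<longleftrightarrow> \<phi> = T1 f" if f: "f \<in> carrier ?R" for f \<phi>
  proof
    show "\<phi> = T1 f \<Longrightarrow> is_type1 a b c n m f \<phi>"
      unfolding T1_def by (simp add: type1[OF f sh[OF f]] shear_lft shear_tu shear_tv add.commute)
    assume t: "is_type1 a b c n m f \<phi>"
    hence "\<phi> \<in> carrier T.Aut" by (simp add: is_type1_def Let_def Aut_eq)
    then obtain s where s: "sub_aut cst thr s" "\<phi> = T.tr s" by (rule T.Aut_obtain)
    show "\<phi> = T1 f" unfolding s(2) T1_def
      by (rule uniq[OF s(1) sh[OF f]])
        (use t[unfolded s(2) type1[OF f s(1)]] in \<open>simp_all add: shear_lft shear_tu shear_tv add.commute\<close>)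
  qed
  have t2: "is_type2 a b c n m \<mu> \<phi> \<longleftrightarrow> \<phi> = T2 \<mu>" if \<mu>: "\<mu> \<noteq> 0" for \<mu> \<phi>
  proof
    show "\<phi> = T2 \<mu> \<Longrightarrow> is_type2 a b c n m \<mu> \<phi>"
      unfolding T2_def by (simp only: type2[OF scale_aut[OF \<mu>]] scale_xyz[OF \<mu>] scale_tu[OF \<mu>] scale_tv[OF \<mu>])
    assume t: "is_type2 a b c n m \<mu> \<phi>"
    hence "\<phi> \<in> carrier T.Aut" by (simp add: is_type2_def Let_def Aut_eq)
    then obtain s where s: "sub_aut cst thr s" "\<phi> = T.tr s" by (rule T.Aut_obtain)
    show "\<phi> = T2 \<mu>" unfolding s(2) T2_def
      by (rule uniq[OF s(1) scale_aut[OF \<mu>]])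
        (use t[unfolded s(2) type2[OF s(1)]] in \<open>simp_all only: scale_xyz[OF \<mu>] scale_tu[OF \<mu>] scale_tv[OF \<mu>]\<close>)
  qed
  let ?H = "units_of complex_ring" and ?N = "add_monoid ?R"
  interpret C: Ring.field complex_ring by (rule field_from_type_algebra)
  have Hc: "carrier ?H = {\<mu>. \<mu> \<noteq> 0}"
    using C.field_Units by (auto simp: units_of_def ring_of_type_algebra_def)
  have Hm: "\<mu> \<otimes>\<^bsub>?H\<^esub> \<nu> = \<mu> * \<nu>" "\<one>\<^bsub>?H\<^esub> = 1" for \<mu> \<nu>
    by (simp_all add: units_of_def ring_of_type_algebra_def)
  have gr: "group ?Aut" unfolding Aut_eq by (rule T.group_Aut)
  interpret Aut: group ?Aut by (rule gr)
  have T1c: "T1 f \<in> carrier ?Aut" if "f \<in> carrier ?R" for f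
    unfolding T1_def Aut_eq by (rule T.tr_in_Aut[OF sh[OF that]])
  have T2c: "T2 \<mu> \<in> carrier ?Aut" if "\<mu> \<noteq> 0" for \<mu>
    unfolding T2_def Aut_eq by (rule T.tr_in_Aut[OF scale_aut[OF that]])
  have T1_hom: "T1 \<in> hom ?N ?Aut"
  proof (rule homI)
    fix f g assume fg: "f \<in> carrier ?N" "g \<in> carrier ?N"
    have s: "hR f \<in> surf" "hR g \<in> surf" using fg embeds_in[OF eR] by simp_all
    show "T1 (f \<otimes>\<^bsub>?N\<^esub> g) = T1 f \<otimes>\<^bsub>?Aut\<^esub> T1 g"
      unfolding T1_def Aut_eq T.tr_mult[OF shear_aut[OF s(1)] shear_aut[OF s(2)]]
      using fg s shear_comp[OF s]
      by (simp add: embeds_add[OF eR] T.tr_cong_iff shear_aut surf_add sub_aut_comp)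
  qed (simp add: T1c)
  have T2_hom: "T2 \<in> hom ?H ?Aut"
  proof (rule homI)
    fix \<mu> \<nu> assume mn: "\<mu> \<in> carrier ?H" "\<nu> \<in> carrier ?H"
    hence nz: "\<mu> \<noteq> 0" "\<nu> \<noteq> 0" by (simp_all add: Hc)
    show "T2 (\<mu> \<otimes>\<^bsub>?H\<^esub> \<nu>) = T2 \<mu> \<otimes>\<^bsub>?Aut\<^esub> T2 \<nu>"
      unfolding T2_def Aut_eq T.tr_mult[OF scale_aut[OF nz(1)] scale_aut[OF nz(2)]] Hm
      using nz scale_comp[OF nz] by (simp add: T.tr_cong_iff scale_aut sub_aut_comp)
  qed (simp add: T2c Hc)
  have T1_inj: "inj_on T1 (carrier ?N)"
  proof (rule inj_onI)
    fix f g assume fg: "f \<in> carrier ?N" "g \<in> carrier ?N" "T1 f = T1 g"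
    hence fg': "f \<in> carrier ?R" "g \<in> carrier ?R" by simp_all
    have "shear (hR f) tv = shear (hR g) tv"
      using fg(3) T.tr_cong_iff[OF sh[OF fg'(1)] sh[OF fg'(2)]] thr_gens(5) unfolding T1_def by blast
    hence "hR f = hR g" by (rule shear_inject)
    thus "f = g" using embeds_inj[OF eR fg'] by simp
  qed
  have norm: "\<exists>f'\<in>carrier ?N. T2 \<mu> \<otimes>\<^bsub>?Aut\<^esub> T1 f = T1 f' \<otimes>\<^bsub>?Aut\<^esub> T2 \<mu>"
    if mf: "\<mu> \<in> carrier ?H" "f \<in> carrier ?N" for \<mu> f
  proof -
    have nz: "\<mu> \<noteq> 0" and f: "f \<in> carrier ?R" using mf by (simp_all add: Hc)
    obtain g where g: "g \<in> surf" "\<forall>p\<in>thr. scale \<mu> (shear (hR f) p) = shear g (scale \<mu> p)"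
      using scale_shear[OF nz embeds_in[OF eR f]] by blast
    obtain f' where f': "f' \<in> carrier ?R" "g = hR f'" using embeds_surj[OF eR g(1)] by blast
    have "T2 \<mu> \<otimes>\<^bsub>?Aut\<^esub> T1 f = T1 f' \<otimes>\<^bsub>?Aut\<^esub> T2 \<mu>"
      unfolding T1_def T2_def Aut_eq T.tr_mult[OF scale_aut[OF nz] sh[OF f]] T.tr_mult[OF sh[OF f'(1)] scale_aut[OF nz]]
      using T.tr_cong_iff[OF sub_aut_comp[OF scale_aut[OF nz] sh[OF f]] sub_aut_comp[OF sh[OF f'(1)] scale_aut[OF nz]]]
        g(2) f'(2) by simp
    thus ?thesis using f'(1) by auto
  qed
  have dec: "\<exists>\<mu>\<in>carrier ?H. \<exists>f\<in>carrier ?N. \<phi> = T2 \<mu> \<otimes>\<^bsub>?Aut\<^esub> T1 f" if phi: "\<phi> \<in> carrier ?Aut" for \<phi>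
  proof -
    obtain s where s: "sub_aut cst thr s" "\<phi> = T.tr s" using phi unfolding Aut_eq by (rule T.Aut_obtain)
    obtain \<mu> g where \<mu>: "\<mu> \<noteq> 0" and g: "g \<in> surf" "\<And>p. p \<in> thr \<Longrightarrow> s p = scale \<mu> (shear g p)"
      by (rule thr_aut_decomposition[OF s(1)]) blast
    obtain f where f: "f \<in> carrier ?R" "g = hR f" using embeds_surj[OF eR g(1)] by blast
    have "\<phi> = T2 \<mu> \<otimes>\<^bsub>?Aut\<^esub> T1 f"
      unfolding s(2) T1_def T2_def Aut_eq T.tr_mult[OF scale_aut[OF \<mu>] sh[OF f(1)]]
      using T.tr_cong_iff[OF s(1) sub_aut_comp[OF scale_aut[OF \<mu>] sh[OF f(1)]]] g(2) f(2) by simp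
    thus ?thesis using \<mu> f(1) Hc by auto
  qed
  \<comment> \<open>A shear fixes x, y and z, so a scaling that equals a shear fixes them
    too.\<close>
  have triv: "\<mu> = \<one>\<^bsub>?H\<^esub>" if h: "\<mu> \<in> carrier ?H" "f \<in> carrier ?N" "T2 \<mu> = T1 f" for \<mu> f
  proof -
    have nz: "\<mu> \<noteq> 0" and f: "f \<in> carrier ?R" using h by (simp_all add: Hc)
    have "\<forall>p\<in>thr. scale \<mu> p = shear (hR f) p"
      using h(3) T.tr_cong_iff[OF scale_aut[OF nz] sh[OF f]] by (simp add: T1_def T2_def)
    hence "\<mu> = 1" using scale_trivial[OF nz] thr_gens shear_lft by simp
    thus ?thesis by (simp add: Hm)
  qed
  have "\<exists>\<theta>\<in>hom ?H (AutoGroup ?N). \<exists>\<Psi>\<in>iso (semidirect_prod ?H ?N \<theta>) ?Aut.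
      (\<forall>f\<in>carrier ?N. \<Psi> (\<one>\<^bsub>?H\<^esub>, f) = T1 f) \<and> (\<forall>\<mu>\<in>carrier ?H. \<Psi> (\<mu>, \<one>\<^bsub>?N\<^esub>) = T2 \<mu>)"
    by (rule internal_semidirect_product[OF gr R.add.group_axioms C.units_group T1_hom T2_hom T1_inj norm dec triv])
  hence iso: "\<exists>\<theta>\<in>hom ?H (AutoGroup ?N). \<exists>\<Psi>\<in>iso (semidirect_prod ?H ?N \<theta>) ?Aut.
       (\<forall>f\<in>carrier ?R. is_type1 a b c n m f (\<Psi> (1, f))) \<and>
       (\<forall>\<mu>. \<mu> \<noteq> 0 \<longrightarrow> is_type2 a b c n m \<mu> (\<Psi> (\<mu>, \<zero>\<^bsub>?R\<^esub>)))"
    by (simp add: t1 t2 Hm Hc)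
  define E where "E = {\<phi>. \<exists>f\<in>carrier ?R. is_type1 a b c n m f \<phi>} \<union> {\<phi>. \<exists>\<mu>. \<mu> \<noteq> 0 \<and> is_type2 a b c n m \<mu> \<phi>}"
  have E: "T1 f \<in> E" "T2 \<mu> \<in> E" if "f \<in> carrier ?R" "\<mu> \<noteq> 0" for f \<mu>
    unfolding E_def using that t1 t2 by blast+
  have "E \<subseteq> carrier ?Aut" unfolding E_def using t1 t2 T1c T2c by auto
  hence "generate ?Aut E \<subseteq> carrier ?Aut" by (rule Aut.generate_incl)
  moreover have "carrier ?Aut \<subseteq> generate ?Aut E"
  proof
    fix \<phi> assume "\<phi> \<in> carrier ?Aut"
    then obtain \<mu> f where mf: "\<mu> \<in> carrier ?H" "f \<in> carrier ?N" "\<phi> = T2 \<mu> \<otimes>\<^bsub>?Aut\<^esub> T1 f" using dec by blast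
    have "T1 f \<in> E" "T2 \<mu> \<in> E" using E[of f \<mu>] mf(1,2) Hc by auto
    thus "\<phi> \<in> generate ?Aut E" unfolding mf(3) by (intro generate.eng generate.incl)
  qed
  ultimately have gen: "generate ?Aut E = carrier ?Aut" by blast
  show ?thesis using iso gen t1 t2 unfolding E_def by auto
qed

end
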